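(* Let $L$ be a finite dimensional Lie algebra with two ideals $I$ and $J$ such that $L = I+J$ and $I\cap J = 0$. Then $$\dim M(L,I,J) = \dim M(L,J) - \dim M(J).$$ Moreover, if $K$ is an ideal of $L$ with $K \subseteq J\cap Z(L)$, then $$\dim M(L,I,J) + \dim M(J) + \dim \left(K\cap [L,J]\right) \le \dim M(L/K,J/K) + \dim M(K) + \dim \frac{L}{L^2+K}\cdot \dim K.$$
   Context: Lie algebras are over a fixed field and dimensions are taken over that field. $L^2=[L,L]$, and $Z(L)$ is the center of $L$. $M(L)=H_2(L)$ is the Schur multiplier of $L$ (homology with trivial coefficients). Pairs: for an ideal $N$ of $L$, $B(L,N)$ is the mapping cone of the map $B(L)\to B(L/N)$ induced by the quotient map, where $B(L)$ is a classifying object with $H_k(B(L))=H_k(L)$ for all $k$. At the level of chains, $B(L)$ is the Chevalley–Eilenberg complex $C_*(L)=\Lambda^*L$ with trivial coefficients, and $B(L,N)$ is the mapping cone of $C_*(L)\to C_*(L/N)$, with degree-$k$ part $C_{k-1}(L)\oplus C_k(L/N)$. The Schur multiplier of the pair is $M(L,N)=H_3(B(L,N))$, and $H_3(L,N):=H_4(B(L,N))$. There is a natural exact sequence $H_3(L)\to H_3(L/N)\to M(L,N)\to M(L)\to M(L/N)\to N/[L,N]\to L/L^2\to L/(L^2+N)\to 0$. Triples: for ideals $I,J$ of $L$, $B(L,I,J)$ is the mapping cone of the canonical map $B(L,J)\to B(L/I,(I+J)/I)$, and the Schur multiplier of the triple is $M(L,I,J)=H_4(B(L,I,J))$. It fits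 into the natural exact sequence $$H_3(L,J)\to H_3\!\left(\tfrac{L}{I},\tfrac{I+J}{I}\right)\to M(L,I,J)\to M(L,J)\to M\!\left(\tfrac{L}{I},\tfrac{I+J}{I}\right)\to \tfrac{I\cap J}{[L,I\cap J]+[I,J]}\to \tfrac{J}{[L,J]}\to \tfrac{I+J}{I+[L,J]}\to 0.$$ *)

theory Defs
  imports "HOL-Algebra.AbelCoset" "Jordan_Normal_Form.Missing_VectorSpace"
begin

section \<open>Quotients, free spaces and exterior powers of vector spaces\<close>

text \<open>Vector spaces are \<^locale>\<open>vectorspace\<close>s over a field record. The fields \<^const>\<open>mult\<close> and
  \<^const>\<open>one\<close>, which module records inherit from ring records, carry no meaning here.\<close>

definition quot_smult :: "('k, 'a, 'z) module_scheme \<Rightarrow> 'a set \<Rightarrow> 'k \<Rightarrow> 'a set \<Rightarrow> 'a set" where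
  "quot_smult V W c X = (\<Union>x\<in>X. W +>\<^bsub>V\<^esub> (c \<odot>\<^bsub>V\<^esub> x))"

definition quot_space :: "('k, 'a, 'z) module_scheme \<Rightarrow> 'a set \<Rightarrow> ('k, 'a set) module" where
  "quot_space V W =
    \<lparr>carrier = a_rcosets\<^bsub>V\<^esub> W, mult = undefined, one = undefined,
     zero = W, add = set_add V, smult = quot_smult V W\<rparr>"

definition free_space :: "('k, 'm) ring_scheme \<Rightarrow> 'b set \<Rightarrow> ('k, 'b \<Rightarrow> 'k) module" where
  "free_space K X =
    \<lparr>carrier = {f. (\<forall>x. f x \<in> carrier K) \<and> (\<forall>x. x \<notin> X \<longrightarrow> f x = \<zero>\<^bsub>K\<^esub>) \<and> finite {x. f x \<noteq> \<zero>\<^bsub>K\<^esub>}},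
     mult = undefined, one = undefined,
     zero = (\<lambda>_. \<zero>\<^bsub>K\<^esub>), add = (\<lambda>f g x. f x \<oplus>\<^bsub>K\<^esub> g x), smult = (\<lambda>c f x. c \<otimes>\<^bsub>K\<^esub> f x)\<rparr>"

definition free_gen :: "('k, 'm) ring_scheme \<Rightarrow> 'b \<Rightarrow> 'b \<Rightarrow> 'k" where
  "free_gen K x = (\<lambda>y. if y = x then \<one>\<^bsub>K\<^esub> else \<zero>\<^bsub>K\<^esub>)"

text \<open>Degrees are integers throughout, so that everything vanishes in negative degrees: there is no
  tuple of negative length, hence \<open>\<Lambda>\<^sup>k V = 0\<close> for \<open>k < 0\<close>.\<close>

definition tuples :: "('k, 'a, 'z) module_scheme \<Rightarrow> int \<Rightarrow> 'a list set" where
  "tuples V k = {xs. set xs \<subseteq> carrier V \<and> int (length xs) = k}"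

text \<open>\<open>\<Lambda>\<^sup>k V\<close> is the free vector space on \<open>V\<^sup>k\<close> modulo the span of the multilinearity relations and
  of the tuples with a repeated entry. The latter (rather than antisymmetry) is the right relation
  also in characteristic 2.\<close>

definition ext_gens :: "('k, 'm) ring_scheme \<Rightarrow> ('k, 'a, 'z) module_scheme \<Rightarrow> int \<Rightarrow> ('a list \<Rightarrow> 'k) set" where
  "ext_gens K V k =
     (let T = free_space K (tuples V k) in
      {free_gen K (us @ (x \<oplus>\<^bsub>V\<^esub> y) # vs) \<ominus>\<^bsub>T\<^esub> (free_gen K (us @ x # vs) \<oplus>\<^bsub>T\<^esub> free_gen K (us @ y # vs))
        | us x y vs. us @ x # vs \<in> tuples V k \<and> y \<in> carrier V} \<union>
      {free_gen K (us @ (c \<odot>\<^bsub>V\<^esub> x) # vs) \<ominus>\<^bsub>T\<^esub> (c \<odot>\<^bsub>T\<^esub> free_gen K (us @ x # vs))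
        | us c x vs. us @ x # vs \<in> tuples V k \<and> c \<in> carrier K} \<union>
      {free_gen K xs | xs. xs \<in> tuples V k \<and> \<not> distinct xs})"

definition ext_rel :: "('k, 'm) ring_scheme \<Rightarrow> ('k, 'a, 'z) module_scheme \<Rightarrow> int \<Rightarrow> ('a list \<Rightarrow> 'k) set" where
  "ext_rel K V k = module.span K (free_space K (tuples V k)) (ext_gens K V k)"

definition ext_pow ::
  "('k, 'm) ring_scheme \<Rightarrow> ('k, 'a, 'z) module_scheme \<Rightarrow> int \<Rightarrow> ('k, ('a list \<Rightarrow> 'k) set) module" where
  "ext_pow K V k = quot_space (free_space K (tuples V k)) (ext_rel K V k)"

definition wedge ::
  "('k, 'm) ring_scheme \<Rightarrow> ('k, 'a, 'z) module_scheme \<Rightarrow> 'a list \<Rightarrow> ('a list \<Rightarrow> 'k) set" where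
  "wedge K V xs =
    ext_rel K V (int (length xs)) +>\<^bsub>free_space K (tuples V (int (length xs)))\<^esub> free_gen K xs"

text \<open>The linear map out of an exterior power that sends \<open>x\<^sub>1 \<and> \<dots> \<and> x\<^sub>k\<close> to \<open>\<phi> [x\<^sub>1, \<dots>, x\<^sub>k] \<in> W\<close>, for
  an alternating multilinear \<open>\<phi>\<close>: the linear extension of \<open>\<phi>\<close> to the free space is then constant on
  each coset \<open>X\<close>, and its value is selected.\<close>

definition ext_lift ::
  "('k, 'm) ring_scheme \<Rightarrow> ('k, 'b, 'z) module_scheme \<Rightarrow> ('a list \<Rightarrow> 'b) \<Rightarrow> ('a list \<Rightarrow> 'k) set \<Rightarrow> 'b" where
  "ext_lift K W \<phi> X =
    the_elem ((\<lambda>f. \<Oplus>\<^bsub>W\<^esub>xs\<in>{xs. f xs \<noteq> \<zero>\<^bsub>K\<^esub>}. f xs \<odot>\<^bsub>W\<^esub> \<phi> xs) ` X)"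

definition ext_map ::
  "('k, 'm) ring_scheme \<Rightarrow> ('k, 'b, 'z) module_scheme \<Rightarrow> ('a \<Rightarrow> 'b) \<Rightarrow> int
    \<Rightarrow> ('a list \<Rightarrow> 'k) set \<Rightarrow> ('b list \<Rightarrow> 'k) set" where
  "ext_map K W h k = ext_lift K (ext_pow K W k) (\<lambda>xs. wedge K W (map h xs))"


section \<open>Lie algebras\<close>

record ('k, 'a) lie_alg = "('k, 'a) module" +
  lie_bracket :: "'a \<Rightarrow> 'a \<Rightarrow> 'a"

locale lie_algebra = vectorspace K L
  for K :: "('k, 'm) ring_scheme" (structure) and L :: "('k, 'a, 'z) lie_alg_scheme" (structure) +
  assumes bracket_closed:
      "\<lbrakk>x \<in> carrier L; y \<in> carrier L\<rbrakk> \<Longrightarrow> lie_bracket L x y \<in> carrier L"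
    and bracket_add_left:
      "\<lbrakk>x \<in> carrier L; y \<in> carrier L; z \<in> carrier L\<rbrakk> \<Longrightarrow>
        lie_bracket L (x \<oplus>\<^bsub>L\<^esub> y) z = lie_bracket L x z \<oplus>\<^bsub>L\<^esub> lie_bracket L y z"
    and bracket_add_right:
      "\<lbrakk>x \<in> carrier L; y \<in> carrier L; z \<in> carrier L\<rbrakk> \<Longrightarrow>
        lie_bracket L x (y \<oplus>\<^bsub>L\<^esub> z) = lie_bracket L x y \<oplus>\<^bsub>L\<^esub> lie_bracket L x z"
    and bracket_smult_left:
      "\<lbrakk>c \<in> carrier K; x \<in> carrier L; y \<in> carrier L\<rbrakk> \<Longrightarrow>
        lie_bracket L (c \<odot>\<^bsub>L\<^esub> x) y = c \<odot>\<^bsub>L\<^esub> lie_bracket L x y"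
    and bracket_smult_right:
      "\<lbrakk>c \<in> carrier K; x \<in> carrier L; y \<in> carrier L\<rbrakk> \<Longrightarrow>
        lie_bracket L x (c \<odot>\<^bsub>L\<^esub> y) = c \<odot>\<^bsub>L\<^esub> lie_bracket L x y"
    and bracket_self:
      "x \<in> carrier L \<Longrightarrow> lie_bracket L x x = \<zero>\<^bsub>L\<^esub>"
    and jacobi:
      "\<lbrakk>x \<in> carrier L; y \<in> carrier L; z \<in> carrier L\<rbrakk> \<Longrightarrow>
        lie_bracket L x (lie_bracket L y z) \<oplus>\<^bsub>L\<^esub> lie_bracket L y (lie_bracket L z x)
          \<oplus>\<^bsub>L\<^esub> lie_bracket L z (lie_bracket L x y) = \<zero>\<^bsub>L\<^esub>"

definition lie_ideal :: "('k, 'm) ring_scheme \<Rightarrow> ('k, 'a, 'z) lie_alg_scheme \<Rightarrow> 'a set \<Rightarrow> bool" where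
  "lie_ideal K L I \<longleftrightarrow> subspace K I L \<and> (\<forall>x\<in>carrier L. \<forall>y\<in>I. lie_bracket L x y \<in> I)"

definition lie_center :: "('k, 'a, 'z) lie_alg_scheme \<Rightarrow> 'a set" where
  "lie_center L = {z \<in> carrier L. \<forall>x\<in>carrier L. lie_bracket L z x = \<zero>\<^bsub>L\<^esub>}"

definition commutator ::
  "('k, 'm) ring_scheme \<Rightarrow> ('k, 'a, 'z) lie_alg_scheme \<Rightarrow> 'a set \<Rightarrow> 'a set \<Rightarrow> 'a set" where
  "commutator K L A B = module.span K L {lie_bracket L x y | x y. x \<in> A \<and> y \<in> B}"

definition lie_quot :: "('k, 'a, 'z) lie_alg_scheme \<Rightarrow> 'a set \<Rightarrow> ('k, 'a set) lie_alg" where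
  "lie_quot L N =
    \<lparr>carrier = a_rcosets\<^bsub>L\<^esub> N, mult = undefined, one = undefined,
     zero = N, add = set_add L, smult = quot_smult L N,
     lie_bracket = (\<lambda>X Y. \<Union>x\<in>X. \<Union>y\<in>Y. N +>\<^bsub>L\<^esub> lie_bracket L x y)\<rparr>"

text \<open>The image \<open>(S + N) / N\<close> of \<open>S\<close> in \<open>L / N\<close>.\<close>

definition quot_image :: "('k, 'a, 'z) lie_alg_scheme \<Rightarrow> 'a set \<Rightarrow> 'a set \<Rightarrow> 'a set set" where
  "quot_image L N S = a_r_coset L N ` S"


section \<open>Chain complexes, homology and mapping cones\<close>

text \<open>\<open>bdry C n\<close> is the differential from degree \<open>n\<close> to degree \<open>n - 1\<close>.\<close>

record ('k, 'c) chain_complex =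
  chain :: "int \<Rightarrow> ('k, 'c) module"
  bdry :: "int \<Rightarrow> 'c \<Rightarrow> 'c"

definition homology :: "('k, 'c) chain_complex \<Rightarrow> int \<Rightarrow> ('k, 'c set) module" where
  "homology C n =
    quot_space
      ((chain C n)\<lparr>carrier := a_kernel (chain C n) (chain C (n - 1)) (bdry C n)\<rparr>)
      (bdry C (n + 1) ` carrier (chain C (n + 1)))"

text \<open>The mapping cone of \<open>f : C \<rightarrow> D\<close>, with sign convention \<open>d (c, d) = (- \<partial> c, \<partial> d - f c)\<close>.\<close>

definition mapping_cone ::
  "('k, 'c) chain_complex \<Rightarrow> ('k, 'd) chain_complex \<Rightarrow> (int \<Rightarrow> 'c \<Rightarrow> 'd) \<Rightarrow> ('k, 'c \<times> 'd) chain_complex" where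
  "mapping_cone C D f =
    \<lparr>chain = (\<lambda>n. direct_sum (chain C (n - 1)) (chain D n)),
     bdry = (\<lambda>n (c, d). (\<ominus>\<^bsub>chain C (n - 2)\<^esub> bdry C (n - 1) c,
                         bdry D n d \<ominus>\<^bsub>chain D (n - 1)\<^esub> f (n - 1) c))\<rparr>"


section \<open>Schur multipliers of Lie algebras, pairs and triples\<close>

text \<open>\<open>\<partial> (x\<^sub>1 \<and> \<dots> \<and> x\<^sub>k) = \<Sum>\<^bsub>i<j\<^esub> (-1)\<^bsup>i+j\<^esup> [x\<^sub>i, x\<^sub>j] \<and> x\<^sub>1 \<and> \<dots> \<and> x\<^sub>k\<close> with \<open>x\<^sub>i\<close>, \<open>x\<^sub>j\<close> omitted from the
  tail; numbering the entries from 0 does not affect the sign.\<close>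

definition ce_bdry_gen ::
  "('k, 'm) ring_scheme \<Rightarrow> ('k, 'a, 'z) lie_alg_scheme \<Rightarrow> int \<Rightarrow> 'a list \<Rightarrow> ('a list \<Rightarrow> 'k) set" where
  "ce_bdry_gen K L k xs =
    (\<Oplus>\<^bsub>ext_pow K L (k - 1)\<^esub>p\<in>{(i, j). i < j \<and> j < length xs}.
       ((\<ominus>\<^bsub>K\<^esub> \<one>\<^bsub>K\<^esub>) [^]\<^bsub>K\<^esub> (fst p + snd p)) \<odot>\<^bsub>ext_pow K L (k - 1)\<^esub>
         wedge K L (lie_bracket L (xs ! fst p) (xs ! snd p) # nths xs (- {fst p, snd p})))"

definition ce_complex ::
  "('k, 'm) ring_scheme \<Rightarrow> ('k, 'a, 'z) lie_alg_scheme \<Rightarrow> ('k, ('a list \<Rightarrow> 'k) set) chain_complex" where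
  "ce_complex K L =
    \<lparr>chain = ext_pow K L,
     bdry = (\<lambda>k. ext_lift K (ext_pow K L (k - 1)) (ce_bdry_gen K L k))\<rparr>"

definition pair_complex ::
  "('k, 'm) ring_scheme \<Rightarrow> ('k, 'a, 'z) lie_alg_scheme \<Rightarrow> 'a set
    \<Rightarrow> ('k, ('a list \<Rightarrow> 'k) set \<times> ('a set list \<Rightarrow> 'k) set) chain_complex" where
  "pair_complex K L N =
    mapping_cone (ce_complex K L) (ce_complex K (lie_quot L N)) (ext_map K (lie_quot L N) (a_r_coset L N))"

text \<open>The canonical map \<open>L/J \<rightarrow> (L/I) / ((I+J)/I)\<close>, constant on each coset \<open>X\<close> of \<open>J\<close>.\<close>

definition quot_quot_map ::
  "('k, 'a, 'z) lie_alg_scheme \<Rightarrow> 'a set \<Rightarrow> 'a set \<Rightarrow> 'a set \<Rightarrow> 'a set set" where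
  "quot_quot_map L I J X =
    the_elem ((\<lambda>x. quot_image L I (I <+>\<^bsub>L\<^esub> J) +>\<^bsub>lie_quot L I\<^esub> (I +>\<^bsub>L\<^esub> x)) ` X)"

definition triple_map ::
  "('k, 'm) ring_scheme \<Rightarrow> ('k, 'a, 'z) lie_alg_scheme \<Rightarrow> 'a set \<Rightarrow> 'a set \<Rightarrow> int
    \<Rightarrow> ('a list \<Rightarrow> 'k) set \<times> ('a set list \<Rightarrow> 'k) set
    \<Rightarrow> ('a set list \<Rightarrow> 'k) set \<times> ('a set set list \<Rightarrow> 'k) set" where
  "triple_map K L I J n =
    map_prod
      (ext_map K (lie_quot L I) (a_r_coset L I) (n - 1))
      (ext_map K (lie_quot (lie_quot L I) (quot_image L I (I <+>\<^bsub>L\<^esub> J))) (quot_quot_map L I J) n)"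

definition triple_complex where
  "triple_complex K L I J =
    mapping_cone (pair_complex K L J)
      (pair_complex K (lie_quot L I) (quot_image L I (I <+>\<^bsub>L\<^esub> J))) (triple_map K L I J)"

definition schur_multiplier where
  "schur_multiplier K L = homology (ce_complex K L) 2"

definition schur_multiplier_pair where
  "schur_multiplier_pair K L N = homology (pair_complex K L N) 3"

definition schur_multiplier_triple where
  "schur_multiplier_triple K L I J = homology (triple_complex K L I J) 4"

end

theory Submission
  imports Defs
begin

text \<open>Write \<open>R\<^sub>k\<close> for the kernel of \<open>\<Lambda>\<^sup>k L \<rightarrow> \<Lambda>\<^sup>k (L/J)\<close>. Since \<open>C\<^sub>*(L) \<rightarrow> C\<^sub>*(L/J)\<close> is onto, its mapping cone has
  the homology of the kernel, one degree up (\<open>homology_cone_dim\<close>), so that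
  \<open>dim M(L,J) = dim R\<^sub>2 - dim \<partial>R\<^sub>2 - dim \<partial>R\<^sub>3\<close> (\<open>homology_pair_dim\<close>). All dimensions are finite, so
  every exact sequence can be replaced by a count of ranks of differentials.

  For the first claim, \<open>L = I + J\<close> turns the pair \<open>(L/I, (I+J)/I)\<close> into \<open>(L/I, L/I)\<close>, whose
  multiplier is \<open>M(L/I)\<close> because the quotient by the whole algebra contributes no exterior powers
  of positive degree (\<open>homology_pair_carrier_dim\<close>). As \<open>I \<inter> J = 0\<close>, the composite \<open>J \<rightarrow> L \<rightarrow> L/I\<close> is
  an isomorphism of Lie algebras. Its inverse, followed by the inclusion \<open>J \<rightarrow> L\<close>, is a section of
  \<open>L \<rightarrow> L/I\<close> with values in \<open>J\<close>, hence induces a section of the map of pair complexes. For a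
  chain map with a section the long exact sequence of the cone breaks up
  (\<open>homology_split_cone_dim\<close>), and \<open>dim M(L,I,J) + dim M(J) = dim M(L,J)\<close>
  (\<open>multiplier_triple_dim\<close>).

  For the second claim it therefore suffices to bound
  \<open>dim M(L,J) + dim (K \<inter> [L,J])\<close> for a central ideal \<open>K \<subseteq> J\<close>
  (\<open>multiplier_pair_central_bound\<close>). The projection \<open>\<pi> : L \<rightarrow> L/K\<close> maps \<open>R\<^sub>k\<close> onto its analogue for
  \<open>(L/K, J/K)\<close> (\<open>ce_ideal_quotient\<close>). Comparing the two dimension formulas by rank and nullity
  gives \<open>dim M(L,J) - dim M(L/K, J/K) = dim X - dim A - dim B\<close>, where \<open>X = ker \<Lambda>\<^sup>2\<pi>\<close> is spanned by
  the products \<open>z \<and> y\<close> with \<open>z \<in> K\<close> (\<open>ext_map_kernel_degree_2\<close>), and \<open>A\<close> and \<open>B\<close> are the kernels of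
  \<open>\<Lambda>\<^sup>1\<pi>\<close> on \<open>\<partial>R\<^sub>2\<close> and of \<open>\<Lambda>\<^sup>2\<pi>\<close> on \<open>\<partial>R\<^sub>3\<close>. Now \<open>\<partial>(x \<and> y) = -[x,y]\<close> shows that \<open>A\<close> contains a copy of
  \<open>K \<inter> [L,J]\<close>, and for central \<open>z\<close> the formula \<open>\<partial>(z \<and> x \<and> y) = z \<and> [x,y]\<close> shows that \<open>B\<close> contains
  \<open>K \<and> L\<^sup>2\<close>. Modulo \<open>B\<close>, the space \<open>X\<close> is spanned by the image of \<open>\<Lambda>\<^sup>2 K\<close>, where
  \<open>dim \<Lambda>\<^sup>2 K = dim M(K)\<close> since \<open>K\<close> is abelian, together with the products of a basis of \<open>K\<close> with
  representatives of a basis of \<open>L/(L\<^sup>2+K)\<close>; this is the remaining bound (\<open>central_kernel_dim\<close>).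

  Everything rests on the Chevalley-Eilenberg differential being well defined and squaring to zero.
  Both follow by induction on the degree from the recursion
  \<open>\<partial>(x \<and> \<omega>) = -(x \<and> \<partial>\<omega> + \<theta>\<^sub>x \<omega>)\<close>, where \<open>\<theta>\<^sub>x\<close> is the derivation of the exterior algebra that
  extends \<open>[x, _]\<close> (\<open>ce_bdry_gen_eq\<close>, \<open>ce_bdry_lwedge\<close>).\<close>

section \<open>Linear maps, subspaces and dimensions\<close>

text \<open>A subspace is a mere set here, while dimension is an attribute of records.\<close>

abbreviation (input) sdim where "sdim K V S \<equiv> vectorspace.dim K (V\<lparr>carrier := S\<rparr>)"

lemma vectorspace_neg_zero:
  assumes "vectorspace K V"
  shows "\<ominus>\<^bsub>V\<^esub> \<zero>\<^bsub>V\<^esub> = \<zero>\<^bsub>V\<^esub>"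
proof -
  interpret V: vectorspace K V by fact
  show ?thesis by (rule V.M.minus_equality) simp_all
qed

lemma linear_mapI:
  assumes "vectorspace K V" "vectorspace K W"
    and "\<And>x. x \<in> carrier V \<Longrightarrow> T x \<in> carrier W"
    and "\<And>x y. \<lbrakk>x \<in> carrier V; y \<in> carrier V\<rbrakk> \<Longrightarrow> T (x \<oplus>\<^bsub>V\<^esub> y) = T x \<oplus>\<^bsub>W\<^esub> T y"
    and "\<And>c x. \<lbrakk>c \<in> carrier K; x \<in> carrier V\<rbrakk> \<Longrightarrow> T (c \<odot>\<^bsub>V\<^esub> x) = c \<odot>\<^bsub>W\<^esub> T x"
  shows "linear_map K V W T"
  using assms unfolding linear_map_def mod_hom_def mod_hom_axioms_def LinearCombinations.module_hom_def vectorspace_def by auto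

lemma linear_mapD:
  assumes "linear_map K V W T"
  shows "vectorspace K V" "vectorspace K W"
    and "\<And>x. x \<in> carrier V \<Longrightarrow> T x \<in> carrier W"
    and "\<And>x y. \<lbrakk>x \<in> carrier V; y \<in> carrier V\<rbrakk> \<Longrightarrow> T (x \<oplus>\<^bsub>V\<^esub> y) = T x \<oplus>\<^bsub>W\<^esub> T y"
    and "\<And>c x. \<lbrakk>c \<in> carrier K; x \<in> carrier V\<rbrakk> \<Longrightarrow> T (c \<odot>\<^bsub>V\<^esub> x) = c \<odot>\<^bsub>W\<^esub> T x"
    and "T \<zero>\<^bsub>V\<^esub> = \<zero>\<^bsub>W\<^esub>"
    and "\<And>x. x \<in> carrier V \<Longrightarrow> T (\<ominus>\<^bsub>V\<^esub> x) = \<ominus>\<^bsub>W\<^esub> T x"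
    and "\<And>x y. \<lbrakk>x \<in> carrier V; y \<in> carrier V\<rbrakk> \<Longrightarrow> T (x \<ominus>\<^bsub>V\<^esub> y) = T x \<ominus>\<^bsub>W\<^esub> T y"
proof -
  interpret linear_map K V W T by fact
  show "vectorspace K V" "vectorspace K W" by unfold_locales
  show "T x \<in> carrier W" if "x \<in> carrier V" for x using that by (rule T_im)
  show "T (x \<oplus>\<^bsub>V\<^esub> y) = T x \<oplus>\<^bsub>W\<^esub> T y" if "x \<in> carrier V" "y \<in> carrier V" for x y
    using that by (rule T_add)
  show "T (c \<odot>\<^bsub>V\<^esub> x) = c \<odot>\<^bsub>W\<^esub> T x" if "c \<in> carrier K" "x \<in> carrier V" for c x
    using that by (rule T_smult)
  show "T \<zero>\<^bsub>V\<^esub> = \<zero>\<^bsub>W\<^esub>" by (rule T0_is_0)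
  show "T (\<ominus>\<^bsub>V\<^esub> x) = \<ominus>\<^bsub>W\<^esub> T x" if "x \<in> carrier V" for x using that by (rule T_neg)
  show "T (x \<ominus>\<^bsub>V\<^esub> y) = T x \<ominus>\<^bsub>W\<^esub> T y" if "x \<in> carrier V" "y \<in> carrier V" for x y
    using that by (rule T_minus)
qed

lemma subspaceI:
  assumes "vectorspace K V" "S \<subseteq> carrier V" "\<zero>\<^bsub>V\<^esub> \<in> S"
    and "\<And>x y. \<lbrakk>x \<in> S; y \<in> S\<rbrakk> \<Longrightarrow> x \<oplus>\<^bsub>V\<^esub> y \<in> S"
    and "\<And>c x. \<lbrakk>c \<in> carrier K; x \<in> S\<rbrakk> \<Longrightarrow> c \<odot>\<^bsub>V\<^esub> x \<in> S"
  shows "subspace K S V"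
  using assms unfolding subspace_def LinearCombinations.submodule_def vectorspace_def by auto

lemma subspaceD:
  assumes "subspace K S V"
  shows "vectorspace K V" "S \<subseteq> carrier V" "\<zero>\<^bsub>V\<^esub> \<in> S"
    and "\<And>x y. \<lbrakk>x \<in> S; y \<in> S\<rbrakk> \<Longrightarrow> x \<oplus>\<^bsub>V\<^esub> y \<in> S"
    and "\<And>c x. \<lbrakk>c \<in> carrier K; x \<in> S\<rbrakk> \<Longrightarrow> c \<odot>\<^bsub>V\<^esub> x \<in> S"
    and "vectorspace K (V\<lparr>carrier := S\<rparr>)"
    and "\<And>x. x \<in> S \<Longrightarrow> \<ominus>\<^bsub>V\<^esub> x \<in> S"
    and "\<And>x y. \<lbrakk>x \<in> S; y \<in> S\<rbrakk> \<Longrightarrow> x \<ominus>\<^bsub>V\<^esub> y \<in> S"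
    and "submodule K S V"
proof -
  show 1: "vectorspace K V" and 2: "S \<subseteq> carrier V" and "\<zero>\<^bsub>V\<^esub> \<in> S" and "submodule K S V"
    and add: "\<And>x y. \<lbrakk>x \<in> S; y \<in> S\<rbrakk> \<Longrightarrow> x \<oplus>\<^bsub>V\<^esub> y \<in> S"
    and smult: "\<And>c x. \<lbrakk>c \<in> carrier K; x \<in> S\<rbrakk> \<Longrightarrow> c \<odot>\<^bsub>V\<^esub> x \<in> S"
    using assms unfolding subspace_def LinearCombinations.submodule_def by auto
  interpret vectorspace K V by fact
  show "vectorspace K (V\<lparr>carrier := S\<rparr>)" by (rule subspace_is_vs[OF assms])
  show neg: "\<ominus>\<^bsub>V\<^esub> x \<in> S" if "x \<in> S" for x
    using smult[of "\<ominus>\<^bsub>K\<^esub> \<one>\<^bsub>K\<^esub>" x] that 2 by (auto simp: smult_minus_1)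
  show "x \<ominus>\<^bsub>V\<^esub> y \<in> S" if "x \<in> S" "y \<in> S" for x y
    unfolding a_minus_def using that neg add by auto
qed

lemma subspace_carrier: "vectorspace K V \<Longrightarrow> subspace K (carrier V) V"
proof -
  assume *: "vectorspace K V"
  interpret vectorspace K V by fact
  show ?thesis by (intro subspaceI) (auto simp: *)
qed

lemma subspace_zero: "vectorspace K V \<Longrightarrow> subspace K {\<zero>\<^bsub>V\<^esub>} V"
proof -
  assume *: "vectorspace K V"
  interpret vectorspace K V by fact
  show ?thesis by (intro subspaceI) (auto simp: *)
qed

lemma subspace_mem: "subspace K S V \<Longrightarrow> x \<in> S \<Longrightarrow> x \<in> carrier V"
  using subspaceD(2) by blast

lemma subspace_Int:
  assumes S: "subspace K S V" and T: "subspace K T V"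
  shows "subspace K (S \<inter> T) V"
  by (rule subspaceI) (auto simp: subspaceD(1,3-5)[OF S] subspaceD(3-5)[OF T] subspace_mem[OF S])

lemma subspace_preimage:
  assumes T: "linear_map K V W T" and A: "subspace K A V" and B: "subspace K B W"
  shows "subspace K {x \<in> A. T x \<in> B} V"
  by (rule subspaceI)
    (auto simp: subspaceD[OF A] subspaceD[OF B] linear_mapD[OF T] subspace_mem[OF A])

lemma subspace_kernel:
  assumes T: "linear_map K V W T" and "subspace K A V"
  shows "subspace K {x \<in> A. T x = \<zero>\<^bsub>W\<^esub>} V"
  using subspace_preimage[OF assms subspace_zero] linear_mapD(2)[OF T] by simp

lemma subspace_image:
  assumes T: "linear_map K V W T" and A: "subspace K A V"
  shows "subspace K (T ` A) W"
proof (rule subspaceI)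
  note [simp] = subspace_mem[OF A]
  note T' = linear_mapD[OF T] and A' = subspaceD[OF A]
  show "vectorspace K W" "T ` A \<subseteq> carrier W" using T' by auto
  show "\<zero>\<^bsub>W\<^esub> \<in> T ` A" using T'(6) A'(3) by (metis imageI)
  show "x \<oplus>\<^bsub>W\<^esub> y \<in> T ` A" if "x \<in> T ` A" "y \<in> T ` A" for x y
  proof -
    from that obtain u v where "u \<in> A" "v \<in> A" "x = T u" "y = T v" by blast
    thus ?thesis by (intro image_eqI[of _ _ "u \<oplus>\<^bsub>V\<^esub> v"]) (auto simp: T' A')
  qed
  show "c \<odot>\<^bsub>W\<^esub> x \<in> T ` A" if "c \<in> carrier K" "x \<in> T ` A" for c x
  proof -
    from that obtain u where "u \<in> A" "x = T u" by blast
    thus ?thesis using that by (intro image_eqI[of _ _ "c \<odot>\<^bsub>V\<^esub> u"]) (auto simp: T' A')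
  qed
qed

lemma linear_map_domain:
  assumes T: "linear_map K V W T" and A: "subspace K A V"
  shows "linear_map K (V\<lparr>carrier := A\<rparr>) W T"
  by (rule linear_mapI) (auto simp: subspaceD[OF A] linear_mapD[OF T] subspace_mem[OF A])

lemma linear_map_comp:
  assumes "linear_map K U V S" "linear_map K V W T"
  shows "linear_map K U W (\<lambda>x. T (S x))"
  by (rule linear_mapI) (auto simp: linear_mapD[OF assms(1)] linear_mapD[OF assms(2)])

lemma linear_map_identity: "vectorspace K V \<Longrightarrow> linear_map K V V (\<lambda>x. x)"
  by (rule linear_mapI) simp_all

lemma linear_map_zero:
  assumes V: "vectorspace K V" and W: "vectorspace K W"
  shows "linear_map K V W (\<lambda>x. \<zero>\<^bsub>W\<^esub>)"
proof -
  interpret W: vectorspace K W by fact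
  show ?thesis by (rule linear_mapI[OF V W]) simp_all
qed

lemma linear_map_add:
  assumes S: "linear_map K V W S" and T: "linear_map K V W T"
  shows "linear_map K V W (\<lambda>x. S x \<oplus>\<^bsub>W\<^esub> T x)"
proof -
  note S' = linear_mapD[OF S] and T' = linear_mapD[OF T]
  interpret W: vectorspace K W by (rule S')
  show ?thesis
    by (rule linear_mapI[OF S'(1,2)]) (simp_all add: S' T' W.M.a_ac W.smult_r_distr)
qed

lemma linear_map_neg:
  assumes S: "linear_map K V W S"
  shows "linear_map K V W (\<lambda>x. \<ominus>\<^bsub>W\<^esub> S x)"
proof -
  note S' = linear_mapD[OF S]
  interpret W: vectorspace K W by (rule S')
  show ?thesis
    by (rule linear_mapI[OF S'(1,2)]) (simp_all add: S' W.M.minus_add W.smult_r_minus)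
qed

lemma linear_map_smult:
  assumes S: "linear_map K V W S" and c: "c \<in> carrier K"
  shows "linear_map K V W (\<lambda>x. c \<odot>\<^bsub>W\<^esub> S x)"
proof -
  note S' = linear_mapD[OF S]
  interpret W: vectorspace K W by (rule S')
  show ?thesis
  proof (rule linear_mapI[OF S'(1,2)])
    fix d x assume d: "d \<in> carrier K" "x \<in> carrier V"
    have "c \<odot>\<^bsub>W\<^esub> (d \<odot>\<^bsub>W\<^esub> S x) = (c \<otimes>\<^bsub>K\<^esub> d) \<odot>\<^bsub>W\<^esub> S x" using c d S' by (simp add: W.smult_assoc1)
    also have "\<dots> = (d \<otimes>\<^bsub>K\<^esub> c) \<odot>\<^bsub>W\<^esub> S x" using c d by (simp add: W.R.m_comm)
    also have "\<dots> = d \<odot>\<^bsub>W\<^esub> (c \<odot>\<^bsub>W\<^esub> S x)" using c d S' by (simp add: W.smult_assoc1)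
    finally show "c \<odot>\<^bsub>W\<^esub> S (d \<odot>\<^bsub>V\<^esub> x) = d \<odot>\<^bsub>W\<^esub> (c \<odot>\<^bsub>W\<^esub> S x)" using S'(5)[OF d] by simp
  qed (simp_all add: S' c W.smult_r_distr)
qed

lemma linear_map_finsum:
  assumes T: "linear_map K V W T" and A: "finite A" and f: "\<And>a. a \<in> A \<Longrightarrow> f a \<in> carrier V"
  shows "T (\<Oplus>\<^bsub>V\<^esub>a\<in>A. f a) = (\<Oplus>\<^bsub>W\<^esub>a\<in>A. T (f a))"
proof -
  note T' = linear_mapD[OF T]
  interpret V: vectorspace K V by (rule T')
  interpret W: vectorspace K W by (rule T')
  show ?thesis
    using A f
  proof (induction A rule: finite_induct)
    case empty
    show ?case by (simp add: T')
  next
    case (insert a A)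
    have "f \<in> A \<rightarrow> carrier V" "f a \<in> carrier V" "(\<lambda>a. T (f a)) \<in> A \<rightarrow> carrier W" "T (f a) \<in> carrier W"
      using insert.prems T'(3) by auto
    thus ?case using insert by (simp add: T')
  qed
qed

lemma linear_map_inv_into:
  assumes T: "linear_map K V W T" and bij: "bij_betw T (carrier V) (carrier W)"
  shows "linear_map K W V (inv_into (carrier V) T)"
proof -
  note T' = linear_mapD[OF T]
  interpret V: vectorspace K V by fact
  let ?S = "inv_into (carrier V) T"
  have cl: "?S y \<in> carrier V" and TS: "T (?S y) = y" if "y \<in> carrier W" for y
    using that bij by (auto simp: bij_betw_def f_inv_into_f inv_into_into)
  have ST: "?S (T x) = x" if "x \<in> carrier V" for x
    using that bij by (auto simp: bij_betw_def)
  show ?thesis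
  proof (rule linear_mapI)
    show "?S (x \<oplus>\<^bsub>W\<^esub> y) = ?S x \<oplus>\<^bsub>V\<^esub> ?S y" if "x \<in> carrier W" "y \<in> carrier W" for x y
      using ST[of "?S x \<oplus>\<^bsub>V\<^esub> ?S y"] that by (simp add: T' cl TS)
    show "?S (c \<odot>\<^bsub>W\<^esub> x) = c \<odot>\<^bsub>V\<^esub> ?S x" if "c \<in> carrier K" "x \<in> carrier W" for c x
      using ST[of "c \<odot>\<^bsub>V\<^esub> ?S x"] that by (simp add: T' cl TS)
  qed (use T' cl in auto)
qed

lemma linear_map_image_span:
  assumes T: "linear_map K V W T" and S: "subspace K S W"
    and G: "G \<subseteq> carrier V" "module.span K V G = carrier V"
    and GS: "\<And>x. x \<in> G \<Longrightarrow> T x \<in> S" and x: "x \<in> carrier V"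
  shows "T x \<in> S"
proof -
  interpret V: vectorspace K V by (rule linear_mapD[OF T])
  note P = subspace_preimage[OF T subspace_carrier[OF linear_mapD(1)[OF T]] S]
  have "G \<subseteq> {x \<in> carrier V. T x \<in> S}" using G(1) GS by blast
  from V.span_is_subset[OF this subspaceD(9)[OF P]] show ?thesis unfolding G(2) using x by blast
qed

lemma linear_map_inj_onI:
  assumes T: "linear_map K V W T" and A: "subspace K A V"
    and ker: "\<And>x. x \<in> A \<Longrightarrow> T x = \<zero>\<^bsub>W\<^esub> \<Longrightarrow> x = \<zero>\<^bsub>V\<^esub>"
  shows "inj_on T A"
proof (rule inj_onI)
  fix x y assume xy: "x \<in> A" "y \<in> A" and eq: "T x = T y"
  interpret V: vectorspace K V by (rule linear_mapD[OF T])
  interpret W: vectorspace K W by (rule linear_mapD[OF T])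
  have c: "x \<in> carrier V" "y \<in> carrier V" using xy subspace_mem[OF A] by blast+
  have "T (x \<ominus>\<^bsub>V\<^esub> y) = T y \<ominus>\<^bsub>W\<^esub> T y" using linear_mapD(8)[OF T c] eq by simp
  also have "\<dots> = \<zero>\<^bsub>W\<^esub>" using linear_mapD(3)[OF T c(2)] by simp
  finally have "x \<ominus>\<^bsub>V\<^esub> y = \<zero>\<^bsub>V\<^esub>" by (rule ker[OF subspaceD(8)[OF A xy]])
  thus "x = y" using c by simp
qed

text \<open>An independent subset of \<open>S\<close> is independent in \<open>V\<close>, which bounds its size by \<open>dim V\<close>; a maximal one
  spans \<open>S\<close>.\<close>

lemma fin_dim_subspace:
  assumes "vectorspace.fin_dim K V" "subspace K S V"
  shows "vectorspace.fin_dim K (V\<lparr>carrier := S\<rparr>)"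
proof -
  note S' = subspaceD[OF assms(2)]
  interpret V: vectorspace K V by fact
  interpret S: vectorspace K "V\<lparr>carrier := S\<rparr>" by fact
  have li: "S.lin_dep A \<longleftrightarrow> V.lin_dep A" if "A \<subseteq> S" for A
    using V.span_li_not_depend(2)[OF that S'(9)] .
  have P: "(\<lambda>A. A \<subseteq> S \<and> V.lin_indpt A) = (\<lambda>A. A \<subseteq> carrier (V\<lparr>carrier := S\<rparr>) \<and> S.lin_indpt A)"
    using li by fastforce
  have "\<exists>A. finite A \<and> maximal A (\<lambda>A. A \<subseteq> S \<and> V.lin_indpt A)"
  proof (rule maximal_exists[where N = V.dim and B = "{}"])
    show "finite A \<and> card A \<le> V.dim" if A: "A \<subseteq> S \<and> V.lin_indpt A" for A
      using V.li_le_dim[OF assms(1) subset_trans[OF conjunct1[OF A] S'(2)] conjunct2[OF A]] by blast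
    show "{} \<subseteq> S \<and> V.lin_indpt {}" unfolding V.lin_dep_def by blast
  qed
  then obtain A where A: "finite A" "maximal A (\<lambda>A. A \<subseteq> S \<and> V.lin_indpt A)" by blast
  from S.max_li_is_basis[OF A(2)[unfolded P]] have "S.basis A" .
  thus ?thesis unfolding S.fin_dim_def S.basis_def using A(1) by blast
qed

lemma sdim_mono:
  assumes "vectorspace.fin_dim K V" "subspace K S V" "subspace K T V" "S \<subseteq> T"
  shows "sdim K V S \<le> sdim K V T"
proof -
  note S' = subspaceD[OF assms(2)] and T' = subspaceD[OF assms(3)]
  interpret V: vectorspace K V by fact
  interpret S: vectorspace K "V\<lparr>carrier := S\<rparr>" by fact
  interpret T: vectorspace K "V\<lparr>carrier := T\<rparr>" by fact
  obtain B where B: "finite B" "S.basis B"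
    using S.finite_basis_exists[OF fin_dim_subspace[OF assms(1,2)]] by blast
  hence BS: "B \<subseteq> S" and "\<not> S.lin_dep B" unfolding S.basis_def by auto
  hence "\<not> T.lin_dep B"
    using V.span_li_not_depend(2)[OF BS S'(9)] V.span_li_not_depend(2)[OF _ T'(9), of B] assms(4) by auto
  from T.li_le_dim(2)[OF fin_dim_subspace[OF assms(1,3)] _ this] BS assms(4)
  show ?thesis using S.dim_basis[OF B] by auto
qed

lemma rank_nullity_on:
  assumes T: "linear_map K V W T" and fin: "vectorspace.fin_dim K V" and A: "subspace K A V"
  shows "sdim K V A = sdim K W (T ` A) + sdim K V {x \<in> A. T x = \<zero>\<^bsub>W\<^esub>}"
proof -
  interpret T: linear_map K "V\<lparr>carrier := A\<rparr>" W T by (rule linear_map_domain[OF T A])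
  show ?thesis
    using T.rank_nullity[OF fin_dim_subspace[OF fin A]] by (simp add: T.im_def T.ker_def)
qed

lemma rank_nullity_carrier:
  assumes T: "linear_map K V W T" and fin: "vectorspace.fin_dim K V"
  shows "vectorspace.dim K V = sdim K W (T ` carrier V) + sdim K V {x \<in> carrier V. T x = \<zero>\<^bsub>W\<^esub>}"
  using rank_nullity_on[OF T fin subspace_carrier] linear_mapD(1)[OF T] by simp

lemma sdim_zero:
  assumes "vectorspace K V"
  shows "sdim K V {\<zero>\<^bsub>V\<^esub>} = 0"
proof -
  interpret V: vectorspace K V by fact
  interpret Z: vectorspace K "V\<lparr>carrier := {\<zero>\<^bsub>V\<^esub>}\<rparr>"
    by (rule subspaceD(6)[OF subspace_zero[OF assms]])
  show ?thesis using Z.gen_ge_dim[of "{}"] by (simp add: Z.span_empty)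
qed

lemma sdim_image_inj:
  assumes T: "linear_map K V W T" and fin: "vectorspace.fin_dim K V" and A: "subspace K A V"
    and inj: "\<And>x. x \<in> A \<Longrightarrow> T x = \<zero>\<^bsub>W\<^esub> \<Longrightarrow> x = \<zero>\<^bsub>V\<^esub>"
  shows "sdim K W (T ` A) = sdim K V A"
proof -
  have "{x \<in> A. T x = \<zero>\<^bsub>W\<^esub>} = {\<zero>\<^bsub>V\<^esub>}"
    by (intro subset_antisym subsetI) (simp_all add: inj linear_mapD(6)[OF T] subspaceD(3)[OF A])
  thus ?thesis using rank_nullity_on[OF T fin A] sdim_zero[OF linear_mapD(1)[OF T]] by simp
qed

lemma fin_dim_image:
  assumes T: "linear_map K V W T" and fin: "vectorspace.fin_dim K V" and "T ` carrier V = carrier W"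
  shows "vectorspace.fin_dim K W"
  using linear_map.surj_fin_dim[OF T fin] assms(3) by blast

lemma sdim_span_le:
  assumes "vectorspace K V" "finite G" "G \<subseteq> carrier V"
  shows "sdim K V (module.span K V G) \<le> card G"
proof -
  interpret V: vectorspace K V by fact
  note S = subspaceD[OF V.span_is_subspace[OF assms(3)]]
  interpret S: vectorspace K "V\<lparr>carrier := V.span G\<rparr>" by (rule S(6))
  have G: "G \<subseteq> V.span G" by (rule V.in_own_span[OF assms(3)])
  show ?thesis
    using S.gen_ge_dim[of G] assms(2) G V.span_li_not_depend(1)[OF G S(9)] by auto
qed

lemma direct_sum_simps [simp]:
  "carrier (direct_sum V W) = carrier V \<times> carrier W"
  "\<zero>\<^bsub>direct_sum V W\<^esub> = (\<zero>\<^bsub>V\<^esub>, \<zero>\<^bsub>W\<^esub>)"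
  "(x, y) \<oplus>\<^bsub>direct_sum V W\<^esub> (x', y') = (x \<oplus>\<^bsub>V\<^esub> x', y \<oplus>\<^bsub>W\<^esub> y')"
  "c \<odot>\<^bsub>direct_sum V W\<^esub> (x, y) = (c \<odot>\<^bsub>V\<^esub> x, c \<odot>\<^bsub>W\<^esub> y)"
  by (simp_all add: direct_sum_def)

lemma direct_sum_maps:
  assumes V: "vectorspace K V" and W: "vectorspace K W"
  shows "linear_map K (direct_sum V W) V fst" "linear_map K (direct_sum V W) W snd"
    and "linear_map K V (direct_sum V W) (\<lambda>x. (x, \<zero>\<^bsub>W\<^esub>))"
    and "linear_map K W (direct_sum V W) (\<lambda>y. (\<zero>\<^bsub>V\<^esub>, y))"
proof -
  interpret V: vectorspace K V by fact
  interpret W: vectorspace K W by fact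
  note D = direct_sum_is_vs[OF V W]
  show "linear_map K (direct_sum V W) V fst" by (rule linear_mapI[OF D V]) auto
  show "linear_map K (direct_sum V W) W snd" by (rule linear_mapI[OF D W]) auto
  show "linear_map K V (direct_sum V W) (\<lambda>x. (x, \<zero>\<^bsub>W\<^esub>))" by (rule linear_mapI[OF V D]) auto
  show "linear_map K W (direct_sum V W) (\<lambda>y. (\<zero>\<^bsub>V\<^esub>, y))" by (rule linear_mapI[OF W D]) auto
qed

lemma direct_sum_dim:
  assumes V: "vectorspace K V" and W: "vectorspace K W"
    and finV: "vectorspace.fin_dim K V" and finW: "vectorspace.fin_dim K W"
  shows "vectorspace.fin_dim K (direct_sum V W)"
    and "vectorspace.dim K (direct_sum V W) = vectorspace.dim K V + vectorspace.dim K W"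
proof -
  interpret V: vectorspace K V by fact
  interpret W: vectorspace K W by fact
  interpret D: vectorspace K "direct_sum V W" by (rule direct_sum_is_vs[OF V W])
  note maps = direct_sum_maps[OF V W]
  obtain A B where A: "finite A" "A \<subseteq> carrier V" "V.span A = carrier V"
    and B: "finite B" "B \<subseteq> carrier W" "W.span B = carrier W"
    using finV finW unfolding V.fin_dim_def W.fin_dim_def by blast
  define G where "G = (\<lambda>x. (x, \<zero>\<^bsub>W\<^esub>)) ` A \<union> (\<lambda>y. (\<zero>\<^bsub>V\<^esub>, y)) ` B"
  have G: "finite G" "G \<subseteq> carrier (direct_sum V W)" using A B by (auto simp: G_def)
  note S = D.span_is_subspace[OF G(2)] and GS = D.in_own_span[OF G(2)]
  have 1: "(x, \<zero>\<^bsub>W\<^esub>) \<in> D.span G" if "x \<in> carrier V" for x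
    by (rule linear_map_image_span[OF maps(3) S A(2,3) _ that]) (use GS in \<open>unfold G_def, blast\<close>)
  have 2: "(\<zero>\<^bsub>V\<^esub>, y) \<in> D.span G" if "y \<in> carrier W" for y
    by (rule linear_map_image_span[OF maps(4) S B(2,3) _ that]) (use GS in \<open>unfold G_def, blast\<close>)
  have "carrier (direct_sum V W) \<subseteq> D.span G"
  proof
    fix p assume "p \<in> carrier (direct_sum V W)"
    then obtain x y where p: "p = (x, y)" "x \<in> carrier V" "y \<in> carrier W" by auto
    have "p = (x, \<zero>\<^bsub>W\<^esub>) \<oplus>\<^bsub>direct_sum V W\<^esub> (\<zero>\<^bsub>V\<^esub>, y)" using p by simp
    thus "p \<in> D.span G" using subspaceD(4)[OF S 1[OF p(2)] 2[OF p(3)]] by simp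
  qed
  hence "D.span G = carrier (direct_sum V W)" by (rule subset_antisym[OF subspaceD(2)[OF S]])
  thus fin: "D.fin_dim" unfolding D.fin_dim_def by (intro exI[of _ G] conjI G)
  have ker: "{p \<in> carrier (direct_sum V W). snd p = \<zero>\<^bsub>W\<^esub>} = (\<lambda>x. (x, \<zero>\<^bsub>W\<^esub>)) ` carrier V"
    by auto
  have "snd ` carrier (direct_sum V W) = carrier W" by force
  thus "D.dim = V.dim + W.dim"
    using rank_nullity_carrier[OF maps(2) fin] sdim_image_inj[OF maps(3) finV subspace_carrier[OF V], unfolded ker[symmetric]]
    by simp
qed

lemma subspace_Collect_sum:
  assumes A: "subspace K A V" and B: "subspace K B V"
  shows "subspace K {a \<oplus>\<^bsub>V\<^esub> b | a b. a \<in> A \<and> b \<in> B} V"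
    and "vectorspace.fin_dim K V \<Longrightarrow> sdim K V {a \<oplus>\<^bsub>V\<^esub> b | a b. a \<in> A \<and> b \<in> B} \<le> sdim K V A + sdim K V B"
proof -
  note A' = subspaceD[OF A] and B' = subspaceD[OF B]
  interpret V: vectorspace K V by (rule A')
  let ?D = "direct_sum (V\<lparr>carrier := A\<rparr>) (V\<lparr>carrier := B\<rparr>)"
  have eq: "{a \<oplus>\<^bsub>V\<^esub> b | a b. a \<in> A \<and> b \<in> B} = (\<lambda>v. fst v \<oplus>\<^bsub>V\<^esub> snd v) ` carrier ?D"
    by force
  note lin = V.sum_map_linear[OF A B]
  show "subspace K {a \<oplus>\<^bsub>V\<^esub> b | a b. a \<in> A \<and> b \<in> B} V"
    unfolding eq by (rule subspace_image[OF lin subspace_carrier[OF linear_mapD(1)[OF lin]]])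
  show "sdim K V {a \<oplus>\<^bsub>V\<^esub> b | a b. a \<in> A \<and> b \<in> B} \<le> sdim K V A + sdim K V B" if "V.fin_dim"
    unfolding eq using direct_sum_dim[OF A'(6) B'(6)] fin_dim_subspace[OF that] A B
      rank_nullity_carrier[OF lin] by simp
qed

lemma subspace_sum_upper:
  assumes A: "subspace K A V" and B: "subspace K B V"
  shows "A \<subseteq> {a \<oplus>\<^bsub>V\<^esub> b | a b. a \<in> A \<and> b \<in> B}" "B \<subseteq> {a \<oplus>\<^bsub>V\<^esub> b | a b. a \<in> A \<and> b \<in> B}"
proof -
  interpret V: vectorspace K V by (rule subspaceD[OF A])
  show "A \<subseteq> {a \<oplus>\<^bsub>V\<^esub> b | a b. a \<in> A \<and> b \<in> B}"
  proof
    fix a assume a: "a \<in> A"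
    have "a = a \<oplus>\<^bsub>V\<^esub> \<zero>\<^bsub>V\<^esub>" using subspace_mem[OF A a] by simp
    thus "a \<in> {a \<oplus>\<^bsub>V\<^esub> b | a b. a \<in> A \<and> b \<in> B}" using a subspaceD(3)[OF B] by blast
  qed
  show "B \<subseteq> {a \<oplus>\<^bsub>V\<^esub> b | a b. a \<in> A \<and> b \<in> B}"
  proof
    fix b assume b: "b \<in> B"
    have "b = \<zero>\<^bsub>V\<^esub> \<oplus>\<^bsub>V\<^esub> b" using subspace_mem[OF B b] by simp
    thus "b \<in> {a \<oplus>\<^bsub>V\<^esub> b | a b. a \<in> A \<and> b \<in> B}" using b subspaceD(3)[OF A] by blast
  qed
qed

text \<open>Choose one preimage for each vector of a basis of the target. Their span maps onto \<open>W\<close> and has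
  dimension at most \<open>dim W\<close>, so by rank and nullity \<open>T\<close> is injective on it and can be inverted there.\<close>

lemma linear_section:
  assumes T: "linear_map K V W T" and fin: "vectorspace.fin_dim K V"
    and surj: "T ` carrier V = carrier W"
  obtains S where "linear_map K W V S" "\<And>y. y \<in> carrier W \<Longrightarrow> T (S y) = y"
proof -
  note T' = linear_mapD[OF T]
  interpret V: vectorspace K V by fact
  interpret W: vectorspace K W by fact
  note finW = fin_dim_image[OF T fin surj]
  obtain B where B: "finite B" "W.basis B" using W.finite_basis_exists[OF finW] by blast
  hence BW: "B \<subseteq> carrier W" and spB: "W.span B = carrier W" unfolding W.basis_def by auto
  define C where "C = inv_into (carrier V) T ` B"
  have BT: "T (inv_into (carrier V) T b) = b" "inv_into (carrier V) T b \<in> carrier V" if "b \<in> B" for b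
  proof -
    have "b \<in> T ` carrier V" using that BW surj by blast
    thus "T (inv_into (carrier V) T b) = b" "inv_into (carrier V) T b \<in> carrier V"
      by (rule f_inv_into_f, rule inv_into_into)
  qed
  have C: "finite C" "C \<subseteq> carrier V" "card C \<le> card B" "T ` C = B"
  proof -
    show "finite C" "card C \<le> card B" using B(1) by (simp_all add: C_def card_image_le)
    show "C \<subseteq> carrier V" using BT(2) unfolding C_def by blast
    have "T ` C = (\<lambda>b. T (inv_into (carrier V) T b)) ` B" unfolding C_def image_image ..
    also have "\<dots> = (\<lambda>b. b) ` B" using BT(1) by (intro image_cong refl)
    finally show "T ` C = B" unfolding image_ident .
  qed
  let ?U = "V.span C"
  note U = V.span_is_subspace[OF C(2)]
  have TU: "T ` ?U = carrier W"
  proof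
    show "T ` ?U \<subseteq> carrier W" by (rule subspaceD(2)[OF subspace_image[OF T U]])
    have "B \<subseteq> T ` ?U" unfolding C(4)[symmetric] by (rule image_mono[OF V.in_own_span[OF C(2)]])
    from W.span_is_subset[OF this subspaceD(9)[OF subspace_image[OF T U]]]
    show "carrier W \<subseteq> T ` ?U" unfolding spB .
  qed
  let ?N = "{x \<in> ?U. T x = \<zero>\<^bsub>W\<^esub>}"
  note N = subspace_kernel[OF T U]
  have "sdim K V ?U \<le> W.dim" using sdim_span_le[OF T'(1) C(1,2)] C(3) W.dim_basis[OF B] by simp
  hence N0: "sdim K V ?N = 0" using rank_nullity_on[OF T fin U] TU by simp
  interpret N: vectorspace K "V\<lparr>carrier := ?N\<rparr>" by (rule subspaceD(6)[OF N])
  have "N.basis {}"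
  proof (rule N.dim_li_is_basis[OF fin_dim_subspace[OF fin N]])
    show "N.lin_indpt {}" unfolding N.lin_dep_def by blast
  qed (simp_all add: N0)
  hence "N.span {} = carrier (V\<lparr>carrier := ?N\<rparr>)" unfolding N.basis_def by blast
  hence "{\<zero>\<^bsub>V\<lparr>carrier := ?N\<rparr>\<^esub>} = carrier (V\<lparr>carrier := ?N\<rparr>)" unfolding N.span_empty .
  hence Nz: "carrier (V\<lparr>carrier := ?N\<rparr>) = {\<zero>\<^bsub>V\<lparr>carrier := ?N\<rparr>\<^esub>}" by (rule sym)
  have T2: "linear_map K (V\<lparr>carrier := ?U\<rparr>) W T"
    by (rule linear_map_domain[OF T U])
  have "inj_on T ?U"
  proof (rule linear_map_inj_onI[OF T U])
    fix x assume "x \<in> ?U" "T x = \<zero>\<^bsub>W\<^esub>"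
    hence "x \<in> carrier (V\<lparr>carrier := ?N\<rparr>)" by simp
    thus "x = \<zero>\<^bsub>V\<^esub>" unfolding Nz by simp
  qed
  hence bij: "bij_betw T (carrier (V\<lparr>carrier := ?U\<rparr>)) (carrier W)"
    unfolding bij_betw_def using TU by simp
  note S = linear_mapD[OF linear_map_inv_into[OF T2 bij]]
  show thesis
  proof (rule that[of "inv_into ?U T"])
    show "linear_map K W V (inv_into ?U T)"
      by (rule linear_mapI[OF T'(2,1)]) (use S subspace_mem[OF U] in auto)
    show "T (inv_into ?U T y) = y" if "y \<in> carrier W" for y
      using that TU by (simp add: f_inv_into_f)
  qed
qed

section \<open>Quotient spaces\<close>

lemma subspace_abelian_subgroup:
  assumes W: "subspace K W V"
  shows "abelian_subgroup W V"
proof -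
  note W' = subspaceD[OF W]
  interpret V: vectorspace K V by (rule W')
  show ?thesis
  proof (rule abelian_subgroupI3)
    show "additive_subgroup W V"
    proof (rule additive_subgroupI, rule group.subgroupI)
      show "W \<noteq> {}" using W'(3) by blast
      show "inv\<^bsub>add_monoid V\<^esub> a \<in> W" if "a \<in> W" for a
        using W'(7)[OF that] by (simp add: a_inv_def)
    qed (use W' in \<open>auto intro: V.M.a_group\<close>)
    show "abelian_group V" by (rule V.M.abelian_group_axioms)
  qed
qed

lemma coset_mem:
  assumes W: "subspace K W V" and x: "x \<in> carrier V"
  shows "y \<in> W +>\<^bsub>V\<^esub> x \<longleftrightarrow> y \<in> carrier V \<and> y \<ominus>\<^bsub>V\<^esub> x \<in> W"
proof -
  interpret W: abelian_subgroup W V by (rule subspace_abelian_subgroup[OF W])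
  have "W +>\<^bsub>V\<^esub> x \<subseteq> carrier V" by (rule W.a_r_coset_subset_G[OF W.a_subset x])
  thus ?thesis using W.a_rcos_module[OF x] unfolding a_minus_def by blast
qed

lemma coset_eq_iff:
  assumes W: "subspace K W V" and x: "x \<in> carrier V" and y: "y \<in> carrier V"
  shows "W +>\<^bsub>V\<^esub> x = W +>\<^bsub>V\<^esub> y \<longleftrightarrow> x \<ominus>\<^bsub>V\<^esub> y \<in> W"
proof -
  interpret W: abelian_subgroup W V by (rule subspace_abelian_subgroup[OF W])
  show ?thesis
    using W.a_repr_independence'[OF _ y, of x] W.a_rcos_self[OF x] coset_mem[OF W y, of x] x by metis
qed

lemma quot_smult_coset:
  assumes W: "subspace K W V" and x: "x \<in> carrier V" and c: "c \<in> carrier K"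
  shows "quot_smult V W c (W +>\<^bsub>V\<^esub> x) = W +>\<^bsub>V\<^esub> (c \<odot>\<^bsub>V\<^esub> x)"
proof -
  interpret V: vectorspace K V by (rule subspaceD[OF W])
  interpret W: abelian_subgroup W V by (rule subspace_abelian_subgroup[OF W])
  have "W +>\<^bsub>V\<^esub> (c \<odot>\<^bsub>V\<^esub> y) = W +>\<^bsub>V\<^esub> (c \<odot>\<^bsub>V\<^esub> x)" if "y \<in> W +>\<^bsub>V\<^esub> x" for y
  proof -
    have y: "y \<in> carrier V" "y \<ominus>\<^bsub>V\<^esub> x \<in> W" using that coset_mem[OF W x] by blast+
    have "c \<odot>\<^bsub>V\<^esub> y \<ominus>\<^bsub>V\<^esub> c \<odot>\<^bsub>V\<^esub> x = c \<odot>\<^bsub>V\<^esub> (y \<ominus>\<^bsub>V\<^esub> x)"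
      using x y(1) c by (simp add: a_minus_def V.smult_r_distr V.smult_r_minus)
    thus ?thesis using subspaceD(5)[OF W c y(2)] coset_eq_iff[OF W] x y(1) c by simp
  qed
  thus ?thesis unfolding quot_smult_def using W.a_rcos_self[OF x] by blast
qed

text \<open>The carrier of \<open>Q\<close> consists of cosets and its operations are set operations. Once these are known
  to be compatible with \<open>q\<close>, the axioms are inherited from \<open>V\<close> along \<open>q\<close>.\<close>

lemma surjective_image_vectorspace:
  assumes V: "vectorspace K V"
    and carrier: "carrier Q = q ` carrier V" and zero: "\<zero>\<^bsub>Q\<^esub> = q \<zero>\<^bsub>V\<^esub>"
    and add: "\<And>x y. \<lbrakk>x \<in> carrier V; y \<in> carrier V\<rbrakk> \<Longrightarrow> q x \<oplus>\<^bsub>Q\<^esub> q y = q (x \<oplus>\<^bsub>V\<^esub> y)"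
    and smult: "\<And>c x. \<lbrakk>c \<in> carrier K; x \<in> carrier V\<rbrakk> \<Longrightarrow> c \<odot>\<^bsub>Q\<^esub> q x = q (c \<odot>\<^bsub>V\<^esub> x)"
  shows "vectorspace K Q"
proof -
  interpret V: vectorspace K V by fact
  show ?thesis
  proof (rule vs_criteria)
    show "field K" by (rule V.field_axioms)
    show "\<forall>v\<in>carrier Q. \<exists>w\<in>carrier Q. v \<oplus>\<^bsub>Q\<^esub> w = \<zero>\<^bsub>Q\<^esub>"
    proof
      fix v assume "v \<in> carrier Q"
      then obtain x where x: "x \<in> carrier V" "v = q x" unfolding carrier by blast
      show "\<exists>w\<in>carrier Q. v \<oplus>\<^bsub>Q\<^esub> w = \<zero>\<^bsub>Q\<^esub>"
        by (rule bexI[of _ "q (\<ominus>\<^bsub>V\<^esub> x)"]) (simp_all add: x carrier zero add V.r_neg)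
    qed
  qed (auto simp: carrier zero add smult V.M.a_ac V.smult_assoc1 V.smult_l_distr V.smult_r_distr)
qed

text \<open>Both \<^const>\<open>quot_space\<close> and \<^const>\<open>lie_quot\<close> are records with these four fields, and the lemma covers
  both.\<close>

lemma quotient_map:
  assumes W: "subspace K W V"
    and Q: "carrier Q = a_rcosets\<^bsub>V\<^esub> W" "\<zero>\<^bsub>Q\<^esub> = W" "add Q = set_add V" "smult Q = quot_smult V W"
  shows "vectorspace K Q" "linear_map K V Q (a_r_coset V W)"
    and "a_r_coset V W ` carrier V = carrier Q"
    and "\<And>x. x \<in> carrier V \<Longrightarrow> a_r_coset V W x = \<zero>\<^bsub>Q\<^esub> \<longleftrightarrow> x \<in> W"
proof -
  note W' = subspaceD[OF W]
  interpret V: vectorspace K V by (rule W')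
  interpret W: abelian_subgroup W V by (rule subspace_abelian_subgroup[OF W])
  show surj: "a_r_coset V W ` carrier V = carrier Q"
    unfolding Q A_RCOSETS_def' by auto
  have zero: "\<zero>\<^bsub>Q\<^esub> = W +>\<^bsub>V\<^esub> \<zero>\<^bsub>V\<^esub>" unfolding Q by (rule W.a_rcos_const[OF W'(3), symmetric])
  have add: "(W +>\<^bsub>V\<^esub> x) \<oplus>\<^bsub>Q\<^esub> (W +>\<^bsub>V\<^esub> y) = W +>\<^bsub>V\<^esub> (x \<oplus>\<^bsub>V\<^esub> y)"
    if "x \<in> carrier V" "y \<in> carrier V" for x y
    unfolding Q by (rule W.a_rcos_sum[OF that])
  have smult: "c \<odot>\<^bsub>Q\<^esub> (W +>\<^bsub>V\<^esub> x) = W +>\<^bsub>V\<^esub> (c \<odot>\<^bsub>V\<^esub> x)"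
    if "c \<in> carrier K" "x \<in> carrier V" for c x
    unfolding Q by (rule quot_smult_coset[OF W that(2,1)])
  show VQ: "vectorspace K Q"
    by (rule surjective_image_vectorspace[OF W'(1) surj[symmetric] zero add smult])
  show "linear_map K V Q (a_r_coset V W)"
    by (rule linear_mapI[OF W'(1) VQ]) (auto simp: surj[symmetric] add smult)
  show "a_r_coset V W x = \<zero>\<^bsub>Q\<^esub> \<longleftrightarrow> x \<in> W" if x: "x \<in> carrier V" for x
  proof -
    have "x \<ominus>\<^bsub>V\<^esub> \<zero>\<^bsub>V\<^esub> = x" using x by (simp add: a_minus_def)
    thus ?thesis unfolding zero using coset_eq_iff[OF W x V.M.zero_closed] by simp
  qed
qed

lemma quot_space_map:
  assumes W: "subspace K W V"
  shows "vectorspace K (quot_space V W)" "linear_map K V (quot_space V W) (a_r_coset V W)"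
    and "a_r_coset V W ` carrier V = carrier (quot_space V W)"
    and "\<And>x. x \<in> carrier V \<Longrightarrow> a_r_coset V W x = \<zero>\<^bsub>quot_space V W\<^esub> \<longleftrightarrow> x \<in> W"
  by (rule quotient_map[OF W]; simp add: quot_space_def)+

lemma quot_space_dim:
  assumes W: "subspace K W V" and fin: "vectorspace.fin_dim K V"
  shows "vectorspace.dim K V = vectorspace.dim K (quot_space V W) + sdim K V W"
proof -
  note q = quot_space_map[OF W]
  have "{x \<in> carrier V. a_r_coset V W x = \<zero>\<^bsub>quot_space V W\<^esub>} = W"
    using q(4) subspaceD(2)[OF W] by blast
  thus ?thesis using rank_nullity_carrier[OF q(2) fin] q(3) by simp
qed

section \<open>Free vector spaces\<close>

lemma free_space_simps [simp]:
  "carrier (free_space K X) = {f. (\<forall>x. f x \<in> carrier K) \<and> (\<forall>x. x \<notin> X \<longrightarrow> f x = \<zero>\<^bsub>K\<^esub>) \<and> finite {x. f x \<noteq> \<zero>\<^bsub>K\<^esub>}}"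
  "\<zero>\<^bsub>free_space K X\<^esub> = (\<lambda>_. \<zero>\<^bsub>K\<^esub>)"
  "f \<oplus>\<^bsub>free_space K X\<^esub> g = (\<lambda>x. f x \<oplus>\<^bsub>K\<^esub> g x)"
  "c \<odot>\<^bsub>free_space K X\<^esub> f = (\<lambda>x. c \<otimes>\<^bsub>K\<^esub> f x)"
  by (simp_all add: free_space_def)

lemma free_space_vectorspace:
  fixes K :: "('k, 'm) ring_scheme" and X :: "'x set"
  assumes "field K"
  shows "vectorspace K (free_space K X)"
proof -
  interpret field K by fact
  have add: "finite {x. f x \<oplus>\<^bsub>K\<^esub> g x \<noteq> \<zero>\<^bsub>K\<^esub>}"
    if "finite {x. f x \<noteq> \<zero>\<^bsub>K\<^esub>}" "finite {x. g x \<noteq> \<zero>\<^bsub>K\<^esub>}" for f g :: "'x \<Rightarrow> 'k"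
    by (rule finite_subset[OF _ finite_UnI[OF that]]) auto
  have smult: "finite {x. c \<otimes>\<^bsub>K\<^esub> f x \<noteq> \<zero>\<^bsub>K\<^esub>}"
    if "finite {x. f x \<noteq> \<zero>\<^bsub>K\<^esub>}" "c \<in> carrier K" for c and f :: "'x \<Rightarrow> 'k"
    by (rule finite_subset[OF _ that(1)]) (use that(2) in auto)
  show ?thesis
  proof (rule vs_criteria)
    show "\<forall>v\<in>carrier (free_space K X). \<exists>w\<in>carrier (free_space K X). v \<oplus>\<^bsub>free_space K X\<^esub> w = \<zero>\<^bsub>free_space K X\<^esub>"
    proof
      fix f assume f: "f \<in> carrier (free_space K X)"
      have "finite {x. \<ominus>\<^bsub>K\<^esub> f x \<noteq> \<zero>\<^bsub>K\<^esub>}"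
        by (rule finite_subset[of _ "{x. f x \<noteq> \<zero>\<^bsub>K\<^esub>}"]) (use f in auto)
      thus "\<exists>w\<in>carrier (free_space K X). f \<oplus>\<^bsub>free_space K X\<^esub> w = \<zero>\<^bsub>free_space K X\<^esub>"
        using f by (intro bexI[of _ "\<lambda>x. \<ominus>\<^bsub>K\<^esub> f x"]) (auto simp: r_neg)
    qed
  qed (auto simp: assms add smult fun_eq_iff a_ac m_assoc l_distr r_distr)
qed

lemma free_gen_mem: "field K \<Longrightarrow> x \<in> X \<Longrightarrow> free_gen K x \<in> carrier (free_space K X)"
proof -
  assume "field K" "x \<in> X"
  interpret field K by fact
  show ?thesis using \<open>x \<in> X\<close> by (auto simp: free_gen_def)
qed

text \<open>The functions supported in a finite set \<open>A\<close> lie in \<open>S\<close> by induction on \<open>A\<close>: removing one point from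
  the support subtracts a multiple of a generator.\<close>

lemma free_space_subset:
  assumes S: "subspace K S (free_space K X)" and gen: "\<And>x. x \<in> X \<Longrightarrow> free_gen K x \<in> S"
  shows "carrier (free_space K X) \<subseteq> S"
proof
  note S' = subspaceD[OF S]
  interpret F: vectorspace K "free_space K X" by (rule S')
  have *: "f \<in> S" if "finite A" "f \<in> carrier (free_space K X)" "{x. f x \<noteq> \<zero>\<^bsub>K\<^esub>} \<subseteq> A" for A f
    using that
  proof (induction A arbitrary: f rule: finite_induct)
    case empty
    hence "f = \<zero>\<^bsub>free_space K X\<^esub>" by (auto simp: fun_eq_iff)
    thus ?case using S'(3) by simp
  next
    case (insert a A)
    define g where "g = (\<lambda>x. if x = a then \<zero>\<^bsub>K\<^esub> else f x)"
    have "finite {x. g x \<noteq> \<zero>\<^bsub>K\<^esub>}"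
      by (rule finite_subset[of _ "{x. f x \<noteq> \<zero>\<^bsub>K\<^esub>}"]) (use insert.prems in \<open>auto simp: g_def\<close>)
    hence "g \<in> carrier (free_space K X)" using insert.prems by (auto simp: g_def)
    hence g: "g \<in> S" by (rule insert.IH) (use insert.prems in \<open>auto simp: g_def\<close>)
    show ?case
    proof (cases "a \<in> X")
      case True
      have "f = g \<oplus>\<^bsub>free_space K X\<^esub> (f a \<odot>\<^bsub>free_space K X\<^esub> free_gen K a)"
        using insert.prems by (auto simp: fun_eq_iff g_def free_gen_def)
      moreover have "f a \<odot>\<^bsub>free_space K X\<^esub> free_gen K a \<in> S"
        by (rule S'(5)[OF _ gen[OF True]]) (use insert.prems in auto)
      ultimately show ?thesis using S'(4)[OF g] by metis
    next
      case False
      hence "f = g" using insert.prems by (auto simp: fun_eq_iff g_def)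
      thus ?thesis using g by simp
    qed
  qed
  show "f \<in> S" if "f \<in> carrier (free_space K X)" for f
    by (rule *[OF _ that order_refl]) (use that in simp)
qed

definition lin_ext :: "('k, 'm) ring_scheme \<Rightarrow> ('k, 'b, 'z) module_scheme \<Rightarrow> ('x \<Rightarrow> 'b) \<Rightarrow> ('x \<Rightarrow> 'k) \<Rightarrow> 'b" where
  "lin_ext K W \<phi> f = (\<Oplus>\<^bsub>W\<^esub>x\<in>{x. f x \<noteq> \<zero>\<^bsub>K\<^esub>}. f x \<odot>\<^bsub>W\<^esub> \<phi> x)"

text \<open>The support of \<open>f\<close> varies with \<open>f\<close>. Linearity of \<^const>\<open>lin_ext\<close> is proved by evaluating two
  functions over a common finite superset of their supports.\<close>

lemma lin_ext_eq:
  assumes W: "vectorspace K W" and \<phi>: "\<And>x. x \<in> X \<Longrightarrow> \<phi> x \<in> carrier W"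
    and A: "finite A" "A \<subseteq> X" "{x. f x \<noteq> \<zero>\<^bsub>K\<^esub>} \<subseteq> A" and f: "\<And>x. f x \<in> carrier K"
  shows "lin_ext K W \<phi> f = (\<Oplus>\<^bsub>W\<^esub>x\<in>A. f x \<odot>\<^bsub>W\<^esub> \<phi> x)"
proof -
  interpret W: vectorspace K W by fact
  have c: "f x \<odot>\<^bsub>W\<^esub> \<phi> x \<in> carrier W" if "x \<in> A" for x
    using that A(2) f \<phi> by blast
  show ?thesis unfolding lin_ext_def
    by (rule W.add.finprod_mono_neutral_cong_left) (use A c in \<open>auto intro!: W.lmult_0 \<phi>\<close>)
qed

lemma lin_ext_linear:
  assumes W: "vectorspace K W" and \<phi>: "\<And>x. x \<in> X \<Longrightarrow> \<phi> x \<in> carrier W"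
  shows "linear_map K (free_space K X) W (lin_ext K W \<phi>)"
proof -
  interpret W: vectorspace K W by fact
  have tm: "f x \<odot>\<^bsub>W\<^esub> \<phi> x \<in> carrier W" if "f \<in> carrier (free_space K X)" "x \<in> X" for f x
    using that \<phi> by simp
  have supp: "{x. f x \<noteq> \<zero>\<^bsub>K\<^esub>} \<subseteq> X" "finite {x. f x \<noteq> \<zero>\<^bsub>K\<^esub>}" "\<And>x. f x \<in> carrier K"
    if "f \<in> carrier (free_space K X)" for f
    using that by auto
  show ?thesis
  proof (rule linear_mapI[OF free_space_vectorspace[OF W.field_axioms] W])
    fix f assume f: "f \<in> carrier (free_space K X)"
    show "lin_ext K W \<phi> f \<in> carrier W"
      unfolding lin_ext_def using tm[OF f] supp(1)[OF f] by (intro W.finsum_closed) blast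
    fix c assume c: "c \<in> carrier K"
    have "lin_ext K W \<phi> (\<lambda>x. c \<otimes>\<^bsub>K\<^esub> f x) = (\<Oplus>\<^bsub>W\<^esub>x\<in>{x. f x \<noteq> \<zero>\<^bsub>K\<^esub>}. (c \<otimes>\<^bsub>K\<^esub> f x) \<odot>\<^bsub>W\<^esub> \<phi> x)"
      by (rule lin_ext_eq[OF W \<phi> supp(2)[OF f] supp(1)[OF f]]) (use c supp(3)[OF f] in auto)
    also have "\<dots> = (\<Oplus>\<^bsub>W\<^esub>x\<in>{x. f x \<noteq> \<zero>\<^bsub>K\<^esub>}. c \<odot>\<^bsub>W\<^esub> (f x \<odot>\<^bsub>W\<^esub> \<phi> x))"
      using supp(1)[OF f] supp(3)[OF f] c \<phi>
      by (intro W.add.finprod_cong' refl) (auto simp: W.smult_assoc1 subset_iff)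
    also have "\<dots> = c \<odot>\<^bsub>W\<^esub> lin_ext K W \<phi> f"
      unfolding lin_ext_def using tm[OF f] supp(1)[OF f]
      by (intro W.finsum_smult_ldistr[symmetric] supp(2)[OF f] c) blast
    finally show "lin_ext K W \<phi> (c \<odot>\<^bsub>free_space K X\<^esub> f) = c \<odot>\<^bsub>W\<^esub> lin_ext K W \<phi> f" by simp
  next
    fix f g assume f: "f \<in> carrier (free_space K X)" and g: "g \<in> carrier (free_space K X)"
    define A where "A = {x. f x \<noteq> \<zero>\<^bsub>K\<^esub>} \<union> {x. g x \<noteq> \<zero>\<^bsub>K\<^esub>}"
    have A: "finite A" "A \<subseteq> X" unfolding A_def using supp[OF f] supp[OF g] by blast+
    have "lin_ext K W \<phi> (\<lambda>x. f x \<oplus>\<^bsub>K\<^esub> g x) = (\<Oplus>\<^bsub>W\<^esub>x\<in>A. (f x \<oplus>\<^bsub>K\<^esub> g x) \<odot>\<^bsub>W\<^esub> \<phi> x)"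
      by (rule lin_ext_eq[OF W \<phi> A]) (use supp(3)[OF f] supp(3)[OF g] in \<open>auto simp: A_def\<close>)
    also have "\<dots> = (\<Oplus>\<^bsub>W\<^esub>x\<in>A. f x \<odot>\<^bsub>W\<^esub> \<phi> x \<oplus>\<^bsub>W\<^esub> g x \<odot>\<^bsub>W\<^esub> \<phi> x)"
      using A(2) tm[OF f] tm[OF g] supp(3)[OF f] supp(3)[OF g] \<phi>
      by (intro W.add.finprod_cong' refl) (auto simp: W.smult_l_distr subset_iff)
    also have "\<dots> = (\<Oplus>\<^bsub>W\<^esub>x\<in>A. f x \<odot>\<^bsub>W\<^esub> \<phi> x) \<oplus>\<^bsub>W\<^esub> (\<Oplus>\<^bsub>W\<^esub>x\<in>A. g x \<odot>\<^bsub>W\<^esub> \<phi> x)"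
      using A(2) tm[OF f] tm[OF g] by (intro W.finsum_addf) blast+
    also have "(\<Oplus>\<^bsub>W\<^esub>x\<in>A. f x \<odot>\<^bsub>W\<^esub> \<phi> x) = lin_ext K W \<phi> f"
      by (rule lin_ext_eq[OF W \<phi> A, symmetric]) (use supp(3)[OF f] in \<open>auto simp: A_def\<close>)
    also have "(\<Oplus>\<^bsub>W\<^esub>x\<in>A. g x \<odot>\<^bsub>W\<^esub> \<phi> x) = lin_ext K W \<phi> g"
      by (rule lin_ext_eq[OF W \<phi> A, symmetric]) (use supp(3)[OF g] in \<open>auto simp: A_def\<close>)
    finally show "lin_ext K W \<phi> (f \<oplus>\<^bsub>free_space K X\<^esub> g) = lin_ext K W \<phi> f \<oplus>\<^bsub>W\<^esub> lin_ext K W \<phi> g" by simp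
  qed
qed

lemma lin_ext_gen:
  assumes W: "vectorspace K W" and \<phi>: "\<phi> x \<in> carrier W"
  shows "lin_ext K W \<phi> (free_gen K x) = \<phi> x"
proof -
  interpret W: vectorspace K W by fact
  have "lin_ext K W \<phi> (free_gen K x) = (\<Oplus>\<^bsub>W\<^esub>y\<in>{x}. free_gen K x y \<odot>\<^bsub>W\<^esub> \<phi> y)"
    by (rule lin_ext_eq[OF W, of "{x}"]) (auto simp: \<phi> free_gen_def)
  also have "\<dots> = \<phi> x" using \<phi> by (simp add: free_gen_def)
  finally show ?thesis .
qed

declare free_space_simps [simp del]

section \<open>Multilinear and alternating maps\<close>

text \<open>The last conjunct covers \<open>k = 0\<close>, where no slot exists whose linearity would keep the value in \<open>W\<close>.\<close>

definition multilinear ::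
  "('k, 'm) ring_scheme \<Rightarrow> ('k, 'a, 'z) module_scheme \<Rightarrow> ('k, 'b, 'y) module_scheme \<Rightarrow> int \<Rightarrow> ('a list \<Rightarrow> 'b) \<Rightarrow> bool" where
  "multilinear K V W k \<phi> \<longleftrightarrow>
     (\<forall>us vs. set us \<subseteq> carrier V \<and> set vs \<subseteq> carrier V \<and> int (length us + length vs) + 1 = k \<longrightarrow>
        linear_map K V W (\<lambda>x. \<phi> (us @ x # vs))) \<and>
     (k = 0 \<longrightarrow> \<phi> [] \<in> carrier W)"

definition alternating ::
  "('k, 'm) ring_scheme \<Rightarrow> ('k, 'a, 'z) module_scheme \<Rightarrow> ('k, 'b, 'y) module_scheme \<Rightarrow> int \<Rightarrow> ('a list \<Rightarrow> 'b) \<Rightarrow> bool" where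
  "alternating K V W k \<phi> \<longleftrightarrow>
     multilinear K V W k \<phi> \<and> (\<forall>xs\<in>tuples V k. \<not> distinct xs \<longrightarrow> \<phi> xs = \<zero>\<^bsub>W\<^esub>)"

lemma multilinear_slot:
  assumes "multilinear K V W k \<phi>" "set us \<subseteq> carrier V" "set vs \<subseteq> carrier V"
    "int (length us + length vs) + 1 = k"
  shows "linear_map K V W (\<lambda>x. \<phi> (us @ x # vs))"
  using assms unfolding multilinear_def by blast

lemma multilinear_closed:
  assumes \<phi>: "multilinear K V W k \<phi>" and xs: "xs \<in> tuples V k"
  shows "\<phi> xs \<in> carrier W"
proof (cases xs)
  case Nil
  thus ?thesis using assms unfolding multilinear_def tuples_def by simp
next
  case (Cons x vs)
  have "linear_map K V W (\<lambda>x. \<phi> ([] @ x # vs))"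
    by (rule multilinear_slot[OF \<phi>]) (use xs Cons in \<open>auto simp: tuples_def\<close>)
  from linear_mapD(3)[OF this, of x] show ?thesis using xs Cons by (simp add: tuples_def)
qed

lemma alternatingD:
  assumes "alternating K V W k \<phi>"
  shows "multilinear K V W k \<phi>" "\<And>xs. xs \<in> tuples V k \<Longrightarrow> \<not> distinct xs \<Longrightarrow> \<phi> xs = \<zero>\<^bsub>W\<^esub>"
  using assms unfolding alternating_def by blast+

lemma multilinearI:
  assumes V: "vectorspace K V" and W: "vectorspace K W"
    and closed: "\<And>xs. xs \<in> tuples V k \<Longrightarrow> \<phi> xs \<in> carrier W"
    and add: "\<And>us x y vs. \<lbrakk>set us \<subseteq> carrier V; set vs \<subseteq> carrier V; int (length us + length vs) + 1 = k;
        x \<in> carrier V; y \<in> carrier V\<rbrakk> \<Longrightarrow>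
        \<phi> (us @ (x \<oplus>\<^bsub>V\<^esub> y) # vs) = \<phi> (us @ x # vs) \<oplus>\<^bsub>W\<^esub> \<phi> (us @ y # vs)"
    and smult: "\<And>us c x vs. \<lbrakk>set us \<subseteq> carrier V; set vs \<subseteq> carrier V; int (length us + length vs) + 1 = k;
        c \<in> carrier K; x \<in> carrier V\<rbrakk> \<Longrightarrow>
        \<phi> (us @ (c \<odot>\<^bsub>V\<^esub> x) # vs) = c \<odot>\<^bsub>W\<^esub> \<phi> (us @ x # vs)"
  shows "multilinear K V W k \<phi>"
  unfolding multilinear_def
proof (intro conjI allI impI)
  fix us vs
  assume "set us \<subseteq> carrier V \<and> set vs \<subseteq> carrier V \<and> int (length us + length vs) + 1 = k"
  hence *: "set us \<subseteq> carrier V" "set vs \<subseteq> carrier V" "int (length us + length vs) + 1 = k" by simp_all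
  show "linear_map K V W (\<lambda>x. \<phi> (us @ x # vs))"
    by (rule linear_mapI[OF V W closed add[OF *] smult[OF *]]) (use * in \<open>auto simp: tuples_def\<close>)
next
  show "\<phi> [] \<in> carrier W" if "k = 0" by (rule closed) (simp add: tuples_def that)
qed

text \<open>Polarisation: expand \<open>\<phi>(\<dots>, x + y, \<dots>, x + y, \<dots>) = 0\<close>.\<close>

lemma multilinear_swap:
  assumes \<phi>: "multilinear K V W k \<phi>"
    and xs: "set us \<subseteq> carrier V" "set ms \<subseteq> carrier V" "set vs \<subseteq> carrier V"
    and k: "int (length us + length ms + length vs) + 2 = k"
    and x: "x \<in> carrier V" and y: "y \<in> carrier V"
    and zero: "\<And>z. z \<in> carrier V \<Longrightarrow> \<phi> (us @ z # ms @ z # vs) = \<zero>\<^bsub>W\<^esub>"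
  shows "\<phi> (us @ x # ms @ y # vs) = \<ominus>\<^bsub>W\<^esub> \<phi> (us @ y # ms @ x # vs)"
proof -
  have lin1: "linear_map K V W (\<lambda>z. \<phi> (us @ z # ms @ u # vs))" if "u \<in> carrier V" for u
    by (rule multilinear_slot[OF \<phi>]) (use xs k that in auto)
  have lin2: "linear_map K V W (\<lambda>z. \<phi> (us @ u # ms @ z # vs))" if "u \<in> carrier V" for u
    using multilinear_slot[OF \<phi>, of "us @ u # ms" vs] xs k that by auto
  note l1 = linear_mapD[OF lin1] and l2 = linear_mapD[OF lin2]
  interpret V: vectorspace K V by (rule l1(1)[OF x])
  interpret W: vectorspace K W by (rule l1(2)[OF x])
  have c: "\<phi> (us @ u # ms @ w # vs) \<in> carrier W" if "u \<in> carrier V" "w \<in> carrier V" for u w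
    by (rule l1(3)[OF that(2,1)])
  have "\<zero>\<^bsub>W\<^esub> = \<phi> (us @ (x \<oplus>\<^bsub>V\<^esub> y) # ms @ (x \<oplus>\<^bsub>V\<^esub> y) # vs)"
    by (rule zero[symmetric]) (simp add: x y)
  also have "\<dots> = \<phi> (us @ x # ms @ y # vs) \<oplus>\<^bsub>W\<^esub> \<phi> (us @ y # ms @ x # vs)"
    by (simp add: l1(4) l2(4) x y zero[OF x] zero[OF y] c W.M.a_comm)
  finally show ?thesis using c[OF x y] c[OF y x] by (metis W.M.minus_equality)
qed

lemma alternating_swap:
  assumes \<phi>: "alternating K V W k \<phi>"
    and xs: "set us \<subseteq> carrier V" "set ms \<subseteq> carrier V" "set vs \<subseteq> carrier V"
    and k: "int (length us + length ms + length vs) + 2 = k"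
    and x: "x \<in> carrier V" and y: "y \<in> carrier V"
  shows "\<phi> (us @ x # ms @ y # vs) = \<ominus>\<^bsub>W\<^esub> \<phi> (us @ y # ms @ x # vs)"
  by (rule multilinear_swap[OF alternatingD(1)[OF \<phi>] xs k x y], rule alternatingD(2)[OF \<phi>])
    (use xs k in \<open>auto simp: tuples_def\<close>)

text \<open>By \<open>multilinear_swap\<close>, neighbouring entries may be exchanged at the cost of a sign; this moves one of
  two equal entries next to the other.\<close>

lemma alternatingI_adjacent:
  assumes \<phi>: "multilinear K V W k \<phi>"
    and adj: "\<And>us x vs. us @ x # x # vs \<in> tuples V k \<Longrightarrow> \<phi> (us @ x # x # vs) = \<zero>\<^bsub>W\<^esub>"
  shows "alternating K V W k \<phi>"
proof -
  have *: "\<phi> (us @ x # ms @ x # vs) = \<zero>\<^bsub>W\<^esub>" if "us @ x # ms @ x # vs \<in> tuples V k" for us x ms vs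
    using that
  proof (induction ms arbitrary: us)
    case Nil
    thus ?case using adj by simp
  next
    case (Cons m ms)
    hence m: "set us \<subseteq> carrier V" "set (ms @ x # vs) \<subseteq> carrier V" "x \<in> carrier V" "m \<in> carrier V"
      and k: "int (length us + length (ms @ x # vs)) + 2 = k"
      by (auto simp: tuples_def)
    interpret W: vectorspace K W
      by (rule linear_mapD(2)[OF multilinear_slot[OF \<phi>, of us "m # ms @ x # vs"]]) (use m k in auto)
    have "\<phi> (us @ x # [] @ m # (ms @ x # vs)) = \<ominus>\<^bsub>W\<^esub> \<phi> (us @ m # [] @ x # (ms @ x # vs))"
    proof (rule multilinear_swap[OF \<phi> m(1) _ m(2) _ m(3,4)])
      show "\<phi> (us @ z # [] @ z # ms @ x # vs) = \<zero>\<^bsub>W\<^esub>" if "z \<in> carrier V" for z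
        using adj[of us z "ms @ x # vs"] m k that by (auto simp: tuples_def)
    qed (use k in auto)
    also have "\<phi> (us @ m # [] @ x # (ms @ x # vs)) = \<zero>\<^bsub>W\<^esub>"
      using Cons.IH[of "us @ [m]"] Cons.prems by (simp add: tuples_def)
    finally show ?case by simp
  qed
  show ?thesis unfolding alternating_def
  proof (intro conjI ballI impI \<phi>)
    fix xs assume xs: "xs \<in> tuples V k" "\<not> distinct xs"
    from not_distinct_decomp[OF xs(2)] obtain us ms vs x where "xs = us @ [x] @ ms @ [x] @ vs" by blast
    thus "\<phi> xs = \<zero>\<^bsub>W\<^esub>" using *[of us x ms vs] xs(1) by simp
  qed
qed

text \<open>Expand the entries in terms of \<open>B\<close> one at a time, from the last to the first.\<close>

lemma multilinear_image_span:
  assumes \<phi>: "multilinear K V W k \<phi>" and S: "subspace K S W"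
    and B: "B \<subseteq> carrier V" "module.span K V B = carrier V"
    and BS: "\<And>ys. set ys \<subseteq> B \<Longrightarrow> int (length ys) = k \<Longrightarrow> \<phi> ys \<in> S"
    and xs: "xs \<in> tuples V k"
  shows "\<phi> xs \<in> S"
proof -
  have "\<phi> (us @ vs) \<in> S" if "set us \<subseteq> carrier V" "set vs \<subseteq> B" "int (length us + length vs) = k" for us vs
    using that
  proof (induction us arbitrary: vs rule: rev_induct)
    case Nil
    thus ?case using BS by simp
  next
    case (snoc x us)
    have "linear_map K V W (\<lambda>x. \<phi> (us @ x # vs))"
      by (rule multilinear_slot[OF \<phi>]) (use snoc.prems B(1) in auto)
    from linear_map_image_span[OF this S B, of x] have "\<phi> (us @ x # vs) \<in> S"
      using snoc.IH[of "_ # vs"] snoc.prems by auto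
    thus ?case by simp
  qed
  from this[of xs "[]"] show ?thesis using xs by (simp add: tuples_def)
qed

section \<open>The universal property of exterior powers\<close>

lemma ext_gens_cases:
  assumes "f \<in> ext_gens K V k"
  obtains (add) us x y vs where "us @ x # vs \<in> tuples V k" "y \<in> carrier V"
      "f = free_gen K (us @ (x \<oplus>\<^bsub>V\<^esub> y) # vs) \<ominus>\<^bsub>free_space K (tuples V k)\<^esub>
        (free_gen K (us @ x # vs) \<oplus>\<^bsub>free_space K (tuples V k)\<^esub> free_gen K (us @ y # vs))"
  | (smult) us c x vs where "us @ x # vs \<in> tuples V k" "c \<in> carrier K"
      "f = free_gen K (us @ (c \<odot>\<^bsub>V\<^esub> x) # vs) \<ominus>\<^bsub>free_space K (tuples V k)\<^esub>
        (c \<odot>\<^bsub>free_space K (tuples V k)\<^esub> free_gen K (us @ x # vs))"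
  | (rep) xs where "xs \<in> tuples V k" "\<not> distinct xs" "f = free_gen K xs"
  using assms unfolding ext_gens_def Let_def by blast

lemma ext_gens_subset:
  assumes "vectorspace K V"
  shows "ext_gens K V k \<subseteq> carrier (free_space K (tuples V k))"
proof
  interpret V: vectorspace K V by fact
  let ?T = "free_space K (tuples V k)"
  interpret T: vectorspace K ?T by (rule free_space_vectorspace[OF V.field_axioms])
  have g: "free_gen K xs \<in> carrier ?T" if "xs \<in> tuples V k" for xs
    by (rule free_gen_mem[OF V.field_axioms that])
  fix f assume "f \<in> ext_gens K V k"
  thus "f \<in> carrier ?T"
  proof (cases rule: ext_gens_cases)
    case (add us x y vs)
    show ?thesis unfolding add(3)
      by (intro T.M.minus_closed T.M.a_closed g) (use add in \<open>auto simp: tuples_def\<close>)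
  next
    case (smult us c x vs)
    show ?thesis unfolding smult(3)
      by (intro T.M.minus_closed T.smult_closed g) (use smult in \<open>auto simp: tuples_def\<close>)
  next
    case (rep xs)
    thus ?thesis using g by blast
  qed
qed

lemma ext_rel_subspace:
  assumes "vectorspace K V"
  shows "subspace K (ext_rel K V k) (free_space K (tuples V k))"
proof -
  interpret V: vectorspace K V by fact
  interpret T: vectorspace K "free_space K (tuples V k)" by (rule free_space_vectorspace[OF V.field_axioms])
  show ?thesis unfolding ext_rel_def by (rule T.span_is_subspace[OF ext_gens_subset[OF assms]])
qed

lemma ext_gens_rel:
  assumes "vectorspace K V"
  shows "ext_gens K V k \<subseteq> ext_rel K V k"
proof -
  interpret V: vectorspace K V by fact
  interpret T: vectorspace K "free_space K (tuples V k)" by (rule free_space_vectorspace[OF V.field_axioms])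
  show ?thesis unfolding ext_rel_def by (rule T.in_own_span[OF ext_gens_subset[OF assms]])
qed

lemma ext_proj:
  assumes "vectorspace K V"
  shows "vectorspace K (ext_pow K V k)"
    and "linear_map K (free_space K (tuples V k)) (ext_pow K V k) (a_r_coset (free_space K (tuples V k)) (ext_rel K V k))"
    and "a_r_coset (free_space K (tuples V k)) (ext_rel K V k) ` carrier (free_space K (tuples V k)) = carrier (ext_pow K V k)"
    and "\<And>f. f \<in> carrier (free_space K (tuples V k)) \<Longrightarrow>
      a_r_coset (free_space K (tuples V k)) (ext_rel K V k) f = \<zero>\<^bsub>ext_pow K V k\<^esub> \<longleftrightarrow> f \<in> ext_rel K V k"
  unfolding ext_pow_def by (rule quot_space_map[OF ext_rel_subspace[OF assms]]; assumption?)+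

lemmas ext_pow_vectorspace = ext_proj(1)

lemma wedge_proj:
  assumes "xs \<in> tuples V k"
  shows "wedge K V xs = a_r_coset (free_space K (tuples V k)) (ext_rel K V k) (free_gen K xs)"
  using assms unfolding wedge_def tuples_def by auto

lemma wedge_closed:
  assumes V: "vectorspace K V" and xs: "xs \<in> tuples V k"
  shows "wedge K V xs \<in> carrier (ext_pow K V k)"
proof -
  interpret V: vectorspace K V by fact
  show ?thesis unfolding wedge_proj[OF xs]
    by (rule linear_mapD(3)[OF ext_proj(2)[OF V] free_gen_mem[OF V.field_axioms xs]])
qed

text \<open>Each of the three families of generators of \<^const>\<open>ext_rel\<close> is one of the identities to be shown.\<close>

lemma wedge_alternating:
  assumes V: "vectorspace K V"
  shows "alternating K V (ext_pow K V k) k (wedge K V)"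
proof -
  interpret V: vectorspace K V by fact
  let ?T = "free_space K (tuples V k)" and ?q = "a_r_coset (free_space K (tuples V k)) (ext_rel K V k)"
  interpret T: vectorspace K ?T by (rule free_space_vectorspace[OF V.field_axioms])
  interpret E: vectorspace K "ext_pow K V k" by (rule ext_proj(1)[OF V])
  note q = linear_mapD[OF ext_proj(2)[OF V, of k]]
  have gen: "free_gen K xs \<in> carrier ?T" if "xs \<in> tuples V k" for xs
    by (rule free_gen_mem[OF V.field_axioms that])
  have q0: "?q f = \<zero>\<^bsub>ext_pow K V k\<^esub>" if "f \<in> ext_gens K V k" for f
    using ext_proj(4)[OF V] ext_gens_rel[OF V] ext_gens_subset[OF V] that by blast
  show ?thesis unfolding alternating_def
  proof (intro conjI ballI impI)
    show "multilinear K V (ext_pow K V k) k (wedge K V)"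
    proof (rule multilinearI[OF V E.vectorspace_axioms wedge_closed[OF V]])
      fix us vs x y
      assume *: "set us \<subseteq> carrier V" "set vs \<subseteq> carrier V" "int (length us + length vs) + 1 = k"
        "x \<in> carrier V" "y \<in> carrier V"
      have t: "us @ (x \<oplus>\<^bsub>V\<^esub> y) # vs \<in> tuples V k" "us @ x # vs \<in> tuples V k" "us @ y # vs \<in> tuples V k"
        using * by (auto simp: tuples_def)
      have "free_gen K (us @ (x \<oplus>\<^bsub>V\<^esub> y) # vs) \<ominus>\<^bsub>?T\<^esub> (free_gen K (us @ x # vs) \<oplus>\<^bsub>?T\<^esub> free_gen K (us @ y # vs))
          \<in> ext_gens K V k" (is "?a \<ominus>\<^bsub>?T\<^esub> (?b \<oplus>\<^bsub>?T\<^esub> ?c) \<in> _")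
        unfolding ext_gens_def Let_def using t(2) *(5) by blast
      from q0[OF this] have "?q ?a \<ominus>\<^bsub>ext_pow K V k\<^esub> (?q ?b \<oplus>\<^bsub>ext_pow K V k\<^esub> ?q ?c) = \<zero>\<^bsub>ext_pow K V k\<^esub>"
        using q(4,8) gen[OF t(1)] gen[OF t(2)] gen[OF t(3)] T.M.a_closed by metis
      thus "wedge K V (us @ (x \<oplus>\<^bsub>V\<^esub> y) # vs)
          = wedge K V (us @ x # vs) \<oplus>\<^bsub>ext_pow K V k\<^esub> wedge K V (us @ y # vs)"
        unfolding t[THEN wedge_proj]
        using q(3)[OF gen[OF t(1)]] q(3)[OF gen[OF t(2)]] q(3)[OF gen[OF t(3)]] by simp
    next
      fix us vs c x
      assume *: "set us \<subseteq> carrier V" "set vs \<subseteq> carrier V" "int (length us + length vs) + 1 = k"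
        "c \<in> carrier K" "x \<in> carrier V"
      have t: "us @ (c \<odot>\<^bsub>V\<^esub> x) # vs \<in> tuples V k" "us @ x # vs \<in> tuples V k"
        using * by (auto simp: tuples_def)
      have "free_gen K (us @ (c \<odot>\<^bsub>V\<^esub> x) # vs) \<ominus>\<^bsub>?T\<^esub> (c \<odot>\<^bsub>?T\<^esub> free_gen K (us @ x # vs))
          \<in> ext_gens K V k" (is "?a \<ominus>\<^bsub>?T\<^esub> (c \<odot>\<^bsub>?T\<^esub> ?b) \<in> _")
        unfolding ext_gens_def Let_def using t(2) *(4) by blast
      from q0[OF this] have "?q ?a \<ominus>\<^bsub>ext_pow K V k\<^esub> (c \<odot>\<^bsub>ext_pow K V k\<^esub> ?q ?b) = \<zero>\<^bsub>ext_pow K V k\<^esub>"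
        using q(5,8) gen[OF t(1)] gen[OF t(2)] *(4) T.smult_closed by metis
      thus "wedge K V (us @ (c \<odot>\<^bsub>V\<^esub> x) # vs) = c \<odot>\<^bsub>ext_pow K V k\<^esub> wedge K V (us @ x # vs)"
        unfolding t[THEN wedge_proj]
        using q(3)[OF gen[OF t(1)]] q(3)[OF gen[OF t(2)]] *(4) by simp
    qed
    show "wedge K V xs = \<zero>\<^bsub>ext_pow K V k\<^esub>" if "xs \<in> tuples V k" "\<not> distinct xs" for xs
      unfolding wedge_proj[OF that(1)] by (rule q0) (use that in \<open>auto simp: ext_gens_def Let_def\<close>)
  qed
qed

text \<open>The wedges span \<open>\<Lambda>\<^sup>k V\<close>, being the images of the generators of the free space.\<close>

lemma ext_pow_subset:
  assumes V: "vectorspace K V" and S: "subspace K S (ext_pow K V k)"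
    and gen: "\<And>xs. xs \<in> tuples V k \<Longrightarrow> wedge K V xs \<in> S"
  shows "carrier (ext_pow K V k) \<subseteq> S"
proof -
  interpret V: vectorspace K V by fact
  let ?T = "free_space K (tuples V k)" and ?q = "a_r_coset (free_space K (tuples V k)) (ext_rel K V k)"
  note T = free_space_vectorspace[OF V.field_axioms, of "tuples V k"]
  have "carrier ?T \<subseteq> {f \<in> carrier ?T. ?q f \<in> S}"
  proof (rule free_space_subset[OF subspace_preimage[OF ext_proj(2)[OF V] subspace_carrier[OF T] S]])
    fix xs assume xs: "xs \<in> tuples V k"
    show "free_gen K xs \<in> {f \<in> carrier ?T. ?q f \<in> S}"
      using free_gen_mem[OF V.field_axioms xs] gen[OF xs] wedge_proj[OF xs, of K] by simp
  qed
  hence "?q ` carrier ?T \<subseteq> S" by blast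
  thus ?thesis unfolding ext_proj(3)[OF V] .
qed

lemma ext_pow_eqI:
  assumes V: "vectorspace K V"
    and S: "linear_map K (ext_pow K V k) W S" and T: "linear_map K (ext_pow K V k) W T"
    and eq: "\<And>xs. xs \<in> tuples V k \<Longrightarrow> S (wedge K V xs) = T (wedge K V xs)"
    and t: "t \<in> carrier (ext_pow K V k)"
  shows "S t = T t"
proof -
  note S' = linear_mapD[OF S] and T' = linear_mapD[OF T]
  have "subspace K {t \<in> carrier (ext_pow K V k). S t = T t} (ext_pow K V k)"
    by (rule subspaceI[OF S'(1)]) (auto simp: S'(4-6) T'(4-6) subspaceD(3-5)[OF subspace_carrier[OF S'(1)]])
  from ext_pow_subset[OF V this] show ?thesis using eq wedge_closed[OF V] t by blast
qed

text \<open>The linear extension of \<open>\<phi>\<close> kills the generators of \<^const>\<open>ext_rel\<close> precisely because \<open>\<phi>\<close> is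
  multilinear and alternating. It is then constant on cosets, so \<^const>\<open>the_elem\<close> selects its value.\<close>

lemma ext_lift_proj:
  assumes V: "vectorspace K V" and W: "vectorspace K W" and \<phi>: "alternating K V W k \<phi>"
    and f: "f \<in> carrier (free_space K (tuples V k))"
  shows "ext_lift K W \<phi> (a_r_coset (free_space K (tuples V k)) (ext_rel K V k) f) = lin_ext K W \<phi> f"
proof -
  interpret V: vectorspace K V by fact
  interpret W: vectorspace K W by fact
  let ?T = "free_space K (tuples V k)"
  interpret T: vectorspace K ?T by (rule free_space_vectorspace[OF V.field_axioms])
  note m = alternatingD(1)[OF \<phi>]
  have lin: "linear_map K ?T W (lin_ext K W \<phi>)"
    by (rule lin_ext_linear[OF W]) (rule multilinear_closed[OF m])
  note l = linear_mapD[OF lin]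
  have gen: "lin_ext K W \<phi> (free_gen K xs) = \<phi> xs" "free_gen K xs \<in> carrier ?T" "\<phi> xs \<in> carrier W"
    if "xs \<in> tuples V k" for xs
    by (rule lin_ext_gen[where \<phi> = \<phi> and x = xs, OF W multilinear_closed[OF m that]], rule free_gen_mem[OF V.field_axioms that],
        rule multilinear_closed[OF m that])
  have ker: "ext_rel K V k \<subseteq> {f \<in> carrier ?T. lin_ext K W \<phi> f = \<zero>\<^bsub>W\<^esub>}"
    unfolding ext_rel_def
  proof (rule T.span_is_subset[OF _ subspaceD(9)[OF subspace_kernel[OF lin subspace_carrier[OF l(1)]]]], rule subsetI)
    fix f assume f: "f \<in> ext_gens K V k"
    hence fT: "f \<in> carrier ?T" using ext_gens_subset[OF V] by blast
    from f have "lin_ext K W \<phi> f = \<zero>\<^bsub>W\<^esub>"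
    proof (cases rule: ext_gens_cases)
      case (add us x y vs)
      have t: "us @ (x \<oplus>\<^bsub>V\<^esub> y) # vs \<in> tuples V k" "us @ x # vs \<in> tuples V k" "us @ y # vs \<in> tuples V k"
        using add by (auto simp: tuples_def)
      have "linear_map K V W (\<lambda>x. \<phi> (us @ x # vs))"
        by (rule multilinear_slot[OF m]) (use t in \<open>auto simp: tuples_def\<close>)
      from linear_mapD(4)[OF this, of x y]
      have eq: "\<phi> (us @ (x \<oplus>\<^bsub>V\<^esub> y) # vs) = \<phi> (us @ x # vs) \<oplus>\<^bsub>W\<^esub> \<phi> (us @ y # vs)"
        using t add by (auto simp: tuples_def)
      show ?thesis unfolding add(3)
        using l(8)[OF gen(2)[OF t(1)] T.M.a_closed[OF gen(2)[OF t(2)] gen(2)[OF t(3)]]]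
          l(4)[OF gen(2)[OF t(2)] gen(2)[OF t(3)]] gen(1)[OF t(1)] gen(1)[OF t(2)] gen(1)[OF t(3)]
          gen(3)[OF t(2)] gen(3)[OF t(3)] eq W.M.a_closed W.M.minus_other_side by metis
    next
      case (smult us c x vs)
      have t: "us @ (c \<odot>\<^bsub>V\<^esub> x) # vs \<in> tuples V k" "us @ x # vs \<in> tuples V k"
        using smult by (auto simp: tuples_def)
      have "linear_map K V W (\<lambda>x. \<phi> (us @ x # vs))"
        by (rule multilinear_slot[OF m]) (use t in \<open>auto simp: tuples_def\<close>)
      from linear_mapD(5)[OF this, of c x]
      have eq: "\<phi> (us @ (c \<odot>\<^bsub>V\<^esub> x) # vs) = c \<odot>\<^bsub>W\<^esub> \<phi> (us @ x # vs)"
        using t smult by (auto simp: tuples_def)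
      show ?thesis unfolding smult(3)
        using l(8)[OF gen(2)[OF t(1)] T.smult_closed[OF smult(2) gen(2)[OF t(2)]]]
          l(5)[OF smult(2) gen(2)[OF t(2)]] gen(1)[OF t(1)] gen(1)[OF t(2)]
          gen(3)[OF t(2)] eq smult(2) W.smult_closed W.M.minus_other_side by metis
    next
      case (rep xs)
      thus ?thesis using gen(1) alternatingD(2)[OF \<phi>] by simp
    qed
    with fT show "f \<in> {f \<in> carrier ?T. lin_ext K W \<phi> f = \<zero>\<^bsub>W\<^esub>}" by blast
  qed
  have const: "lin_ext K W \<phi> g = lin_ext K W \<phi> f" if "g \<in> a_r_coset ?T (ext_rel K V k) f" for g
  proof -
    have g: "g \<in> carrier ?T" "g \<ominus>\<^bsub>?T\<^esub> f \<in> ext_rel K V k"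
      using that coset_mem[OF ext_rel_subspace[OF V] f] by blast+
    have "lin_ext K W \<phi> (g \<ominus>\<^bsub>?T\<^esub> f) = \<zero>\<^bsub>W\<^esub>" using ker g(2) by blast
    thus ?thesis using l(8)[OF g(1) f] l(3)[OF g(1)] l(3)[OF f] W.M.minus_other_side by metis
  qed
  have "f \<in> a_r_coset ?T (ext_rel K V k) f"
    by (rule abelian_subgroup.a_rcos_self[OF subspace_abelian_subgroup[OF ext_rel_subspace[OF V]] f])
  hence "lin_ext K W \<phi> ` (a_r_coset ?T (ext_rel K V k) f) = {lin_ext K W \<phi> f}" using const by blast
  thus ?thesis unfolding ext_lift_def lin_ext_def by simp
qed

lemma ext_lift_linear:
  assumes V: "vectorspace K V" and W: "vectorspace K W" and \<phi>: "alternating K V W k \<phi>"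
  shows "linear_map K (ext_pow K V k) W (ext_lift K W \<phi>)"
proof -
  interpret V: vectorspace K V by fact
  let ?T = "free_space K (tuples V k)" and ?q = "a_r_coset (free_space K (tuples V k)) (ext_rel K V k)"
  interpret T: vectorspace K ?T by (rule free_space_vectorspace[OF V.field_axioms])
  have "linear_map K ?T W (lin_ext K W \<phi>)"
    by (rule lin_ext_linear[OF W]) (rule multilinear_closed[OF alternatingD(1)[OF \<phi>]])
  note l = linear_mapD[OF this]
  note q = linear_mapD[OF ext_proj(2)[OF V, of k]] and lift = ext_lift_proj[OF V W \<phi>]
  have rep: "\<exists>f \<in> carrier ?T. X = ?q f" if "X \<in> carrier (ext_pow K V k)" for X
    using that unfolding ext_proj(3)[OF V, symmetric] by blast
  show ?thesis
  proof (rule linear_mapI[OF ext_proj(1)[OF V] W])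
    fix X assume "X \<in> carrier (ext_pow K V k)"
    then obtain f where f: "f \<in> carrier ?T" "X = ?q f" using rep by blast
    show "ext_lift K W \<phi> X \<in> carrier W" unfolding f(2) lift[OF f(1)] by (rule l(3)[OF f(1)])
    fix c assume c: "c \<in> carrier K"
    show "ext_lift K W \<phi> (c \<odot>\<^bsub>ext_pow K V k\<^esub> X) = c \<odot>\<^bsub>W\<^esub> ext_lift K W \<phi> X"
      unfolding f(2) q(5)[OF c f(1), symmetric] lift[OF f(1)] lift[OF T.smult_closed[OF c f(1)]] by (rule l(5)[OF c f(1)])
  next
    fix X Y assume "X \<in> carrier (ext_pow K V k)" "Y \<in> carrier (ext_pow K V k)"
    then obtain f g where f: "f \<in> carrier ?T" "X = ?q f" and g: "g \<in> carrier ?T" "Y = ?q g" using rep by meson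
    show "ext_lift K W \<phi> (X \<oplus>\<^bsub>ext_pow K V k\<^esub> Y) = ext_lift K W \<phi> X \<oplus>\<^bsub>W\<^esub> ext_lift K W \<phi> Y"
      unfolding f(2) g(2) q(4)[OF f(1) g(1), symmetric] lift[OF f(1)] lift[OF g(1)] lift[OF T.M.a_closed[OF f(1) g(1)]]
      by (rule l(4)[OF f(1) g(1)])
  qed
qed

lemma ext_lift_wedge:
  assumes V: "vectorspace K V" and W: "vectorspace K W" and \<phi>: "alternating K V W k \<phi>"
    and xs: "xs \<in> tuples V k"
  shows "ext_lift K W \<phi> (wedge K V xs) = \<phi> xs"
proof -
  interpret V: vectorspace K V by fact
  show ?thesis
    unfolding wedge_proj[OF xs] ext_lift_proj[OF V W \<phi> free_gen_mem[OF V.field_axioms xs]]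
    by (rule lin_ext_gen[where \<phi> = \<phi> and x = xs, OF W multilinear_closed[OF alternatingD(1)[OF \<phi>] xs]])
qed

section \<open>Functoriality of exterior powers\<close>

lemma map_tuples: "\<lbrakk>xs \<in> tuples V k; \<And>x. x \<in> carrier V \<Longrightarrow> h x \<in> carrier W\<rbrakk> \<Longrightarrow> map h xs \<in> tuples W k"
  unfolding tuples_def by auto

lemma wedge_slot:
  assumes "vectorspace K V" "set us \<subseteq> carrier V" "set vs \<subseteq> carrier V"
    "int (length us + length vs) + 1 = k"
  shows "linear_map K V (ext_pow K V k) (\<lambda>x. wedge K V (us @ x # vs))"
  by (rule multilinear_slot[OF alternatingD(1)[OF wedge_alternating] assms(2-4)]) fact

lemma alternating_map:
  assumes h: "linear_map K V W h" and \<phi>: "alternating K W U k \<phi>" and U: "vectorspace K U"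
  shows "alternating K V U k (\<lambda>xs. \<phi> (map h xs))"
  unfolding alternating_def
proof (intro conjI ballI impI)
  note h' = linear_mapD[OF h]
  note slot = multilinear_slot[OF alternatingD(1)[OF \<phi>]]
  show "multilinear K V U k (\<lambda>xs. \<phi> (map h xs))"
    unfolding multilinear_def
  proof (intro conjI allI impI)
    fix us vs
    assume *: "set us \<subseteq> carrier V \<and> set vs \<subseteq> carrier V \<and> int (length us + length vs) + 1 = k"
    have "linear_map K W U (\<lambda>y. \<phi> (map h us @ y # map h vs))"
      by (rule slot) (use * h'(3) in auto)
    from linear_map_comp[OF h this] show "linear_map K V U (\<lambda>x. \<phi> (map h (us @ x # vs)))" by simp
  next
    show "\<phi> (map h []) \<in> carrier U" if "k = 0"
      using alternatingD(1)[OF \<phi>] that unfolding multilinear_def by simp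
  qed
  show "\<phi> (map h xs) = \<zero>\<^bsub>U\<^esub>" if "xs \<in> tuples V k" "\<not> distinct xs" for xs
    by (rule alternatingD(2)[OF \<phi> map_tuples[OF that(1) h'(3)]]) (use that(2) in \<open>simp_all add: distinct_map\<close>)
qed

lemma ext_map_alternating:
  assumes "linear_map K V W h"
  shows "alternating K V (ext_pow K W k) k (\<lambda>xs. wedge K W (map h xs))"
  by (rule alternating_map[OF assms wedge_alternating ext_pow_vectorspace]) (rule linear_mapD(2)[OF assms])+

lemma ext_map_linear:
  assumes "linear_map K V W h"
  shows "linear_map K (ext_pow K V k) (ext_pow K W k) (ext_map K W h k)"
  unfolding ext_map_def
  by (rule ext_lift_linear[OF _ ext_pow_vectorspace ext_map_alternating[OF assms]]) (rule linear_mapD[OF assms])+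

lemma ext_map_wedge:
  assumes "linear_map K V W h" "xs \<in> tuples V k"
  shows "ext_map K W h k (wedge K V xs) = wedge K W (map h xs)"
  unfolding ext_map_def
  by (rule ext_lift_wedge[OF _ ext_pow_vectorspace ext_map_alternating[OF assms(1)] assms(2)]) (rule linear_mapD[OF assms(1)])+

lemma ext_map_comp:
  assumes g: "linear_map K U V g" and h: "linear_map K V W h" and f: "linear_map K U W f"
    and eq: "\<And>x. x \<in> carrier U \<Longrightarrow> h (g x) = f x" and t: "t \<in> carrier (ext_pow K U k)"
  shows "ext_map K W h k (ext_map K V g k t) = ext_map K W f k t"
proof (rule ext_pow_eqI[OF linear_mapD(1)[OF g] linear_map_comp[OF ext_map_linear[OF g] ext_map_linear[OF h]] ext_map_linear[OF f] _ t])
  fix xs assume xs: "xs \<in> tuples U k"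
  have gxs: "map g xs \<in> tuples V k" by (rule map_tuples[OF xs linear_mapD(3)[OF g]])
  have "map h (map g xs) = map f xs" using xs eq by (auto simp: tuples_def)
  thus "ext_map K W h k (ext_map K V g k (wedge K U xs)) = ext_map K W f k (wedge K U xs)"
    unfolding ext_map_wedge[OF g xs] ext_map_wedge[OF f xs] ext_map_wedge[OF h gxs]
    by (rule arg_cong)
qed

lemma ext_map_identity:
  assumes h: "linear_map K V V h" and id: "\<And>x. x \<in> carrier V \<Longrightarrow> h x = x" and t: "t \<in> carrier (ext_pow K V k)"
  shows "ext_map K V h k t = t"
proof (rule ext_pow_eqI[OF linear_mapD(1)[OF h] ext_map_linear[OF h] linear_map_identity _ t])
  show "vectorspace K (ext_pow K V k)" by (rule ext_pow_vectorspace[OF linear_mapD(1)[OF h]])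
  fix xs assume xs: "xs \<in> tuples V k"
  have "map h xs = xs" using xs id by (intro map_idI) (auto simp: tuples_def)
  thus "ext_map K V h k (wedge K V xs) = wedge K V xs" unfolding ext_map_wedge[OF h xs] by (rule arg_cong)
qed

lemma ext_map_inverse:
  assumes g: "linear_map K V W g" and h: "linear_map K W V h"
    and id: "\<And>x. x \<in> carrier V \<Longrightarrow> h (g x) = x" and t: "t \<in> carrier (ext_pow K V k)"
  shows "ext_map K V h k (ext_map K W g k t) = t"
  using ext_map_comp[OF g h linear_map_identity[OF linear_mapD(1)[OF g]] id t]
    ext_map_identity[OF linear_map_identity[OF linear_mapD(1)[OF g]] refl t] by simp

lemma ext_map_surj:
  assumes h: "linear_map K V W h" and surj: "h ` carrier V = carrier W"
  shows "ext_map K W h k ` carrier (ext_pow K V k) = carrier (ext_pow K W k)"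
proof
  note h' = linear_mapD[OF h]
  note E = ext_map_linear[OF h, of k]
  note im = subspace_image[OF E subspace_carrier[OF linear_mapD(1)[OF E]]]
  show "ext_map K W h k ` carrier (ext_pow K V k) \<subseteq> carrier (ext_pow K W k)"
    by (rule subspaceD(2)[OF im])
  show "carrier (ext_pow K W k) \<subseteq> ext_map K W h k ` carrier (ext_pow K V k)"
  proof (rule ext_pow_subset[OF h'(2) im])
    fix ys assume ys: "ys \<in> tuples W k"
    hence "set ys \<subseteq> h ` carrier V" unfolding surj by (simp add: tuples_def)
    hence "\<forall>y \<in> set ys. \<exists>x \<in> carrier V. h x = y" by blast
    then obtain s where s: "\<forall>y \<in> set ys. s y \<in> carrier V \<and> h (s y) = y" by metis
    hence xs: "map s ys \<in> tuples V k" using ys by (auto simp: tuples_def)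
    have "map h (map s ys) = ys" using s by (simp add: map_idI)
    hence "wedge K W ys = ext_map K W h k (wedge K V (map s ys))" unfolding ext_map_wedge[OF h xs] by simp
    thus "wedge K W ys \<in> ext_map K W h k ` carrier (ext_pow K V k)" using wedge_closed[OF h'(1) xs] by blast
  qed
qed

lemma ext_pow_spanned_by_basis:
  assumes V: "vectorspace K V" and B: "B \<subseteq> carrier V" "module.span K V B = carrier V"
  shows "module.span K (ext_pow K V k) (wedge K V ` {xs. set xs \<subseteq> B \<and> int (length xs) = k}) = carrier (ext_pow K V k)"
    (is "module.span K _ ?G = _")
proof
  interpret E: vectorspace K "ext_pow K V k" by (rule ext_pow_vectorspace[OF V])
  have G: "?G \<subseteq> carrier (ext_pow K V k)" using B(1) wedge_closed[OF V] by (auto simp: tuples_def)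
  note S = E.span_is_subspace[OF G]
  show "E.span ?G \<subseteq> carrier (ext_pow K V k)" by (rule subspaceD(2)[OF S])
  show "carrier (ext_pow K V k) \<subseteq> E.span ?G"
  proof (rule ext_pow_subset[OF V S])
    fix xs assume xs: "xs \<in> tuples V k"
    show "wedge K V xs \<in> E.span ?G"
      by (rule multilinear_image_span[OF alternatingD(1)[OF wedge_alternating[OF V]] S B _ xs])
        (use E.in_own_span[OF G] in blast)
  qed
qed

lemma ext_pow_fin_dim:
  assumes V: "vectorspace K V" and fin: "vectorspace.fin_dim K V"
  shows "vectorspace.fin_dim K (ext_pow K V k)"
proof -
  interpret V: vectorspace K V by fact
  interpret E: vectorspace K "ext_pow K V k" by (rule ext_pow_vectorspace[OF V])
  obtain B where B: "finite B" "B \<subseteq> carrier V" "V.span B = carrier V"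
    using fin unfolding V.fin_dim_def by blast
  let ?G = "wedge K V ` {xs. set xs \<subseteq> B \<and> int (length xs) = k}"
  have "{xs. set xs \<subseteq> B \<and> int (length xs) = k} \<subseteq> {xs. set xs \<subseteq> B \<and> length xs = nat k}" by auto
  from finite_subset[OF this finite_lists_length_eq[OF B(1)]] have 1: "finite ?G" by (rule finite_imageI)
  have 2: "?G \<subseteq> carrier (ext_pow K V k)" using B(2) wedge_closed[OF V] by (auto simp: tuples_def)
  show ?thesis unfolding E.fin_dim_def
    by (intro exI[of _ ?G] conjI 1 2 ext_pow_spanned_by_basis[OF V B(2,3)])
qed

lemma ext_pow_zero_space:
  assumes V: "vectorspace K V" and zero: "carrier V = {\<zero>\<^bsub>V\<^esub>}" and k: "1 \<le> k"
  shows "carrier (ext_pow K V k) = {\<zero>\<^bsub>ext_pow K V k\<^esub>}"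
proof
  note E = ext_pow_vectorspace[OF V, of k]
  show "carrier (ext_pow K V k) \<subseteq> {\<zero>\<^bsub>ext_pow K V k\<^esub>}"
  proof (rule ext_pow_subset[OF V subspace_zero[OF E]])
    fix xs assume xs: "xs \<in> tuples V k"
    with k obtain x vs where x: "xs = x # vs" by (cases xs) (auto simp: tuples_def)
    have "linear_map K V (ext_pow K V k) (\<lambda>x. wedge K V ([] @ x # vs))"
      by (rule wedge_slot[OF V]) (use xs x in \<open>auto simp: tuples_def\<close>)
    from linear_mapD(6)[OF this] show "wedge K V xs \<in> {\<zero>\<^bsub>ext_pow K V k\<^esub>}"
      using xs x zero by (auto simp: tuples_def)
  qed
  show "{\<zero>\<^bsub>ext_pow K V k\<^esub>} \<subseteq> carrier (ext_pow K V k)"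
    using subspaceD(3)[OF subspace_carrier[OF E]] by simp
qed

text \<open>Choose a linear section \<open>s\<close> of \<open>p\<close>. Since \<open>p' \<circ> s \<circ> p = p'\<close>, the map induced by \<open>p'\<close> factors through
  the one induced by \<open>p\<close>.\<close>

lemma ext_map_kernel_mono:
  assumes p: "linear_map K V W p" and p': "linear_map K V U p'" and fin: "vectorspace.fin_dim K V"
    and surj: "p ` carrier V = carrier W"
    and ker: "\<And>x. x \<in> carrier V \<Longrightarrow> p x = \<zero>\<^bsub>W\<^esub> \<Longrightarrow> p' x = \<zero>\<^bsub>U\<^esub>"
    and t: "t \<in> carrier (ext_pow K V k)" and zero: "ext_map K W p k t = \<zero>\<^bsub>ext_pow K W k\<^esub>"
  shows "ext_map K U p' k t = \<zero>\<^bsub>ext_pow K U k\<^esub>"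
proof -
  obtain s where s: "linear_map K W V s" and ps: "\<And>y. y \<in> carrier W \<Longrightarrow> p (s y) = y"
    using linear_section[OF p fin surj] by blast
  note P = linear_mapD[OF p] and P' = linear_mapD[OF p'] and S = linear_mapD[OF s]
  interpret V: vectorspace K V by (rule P)
  interpret U: vectorspace K U by (rule P')
  interpret W: vectorspace K W by (rule P)
  have eq: "p' (s (p x)) = p' x" if x: "x \<in> carrier V" for x
  proof -
    have c: "s (p x) \<in> carrier V" using x by (intro S(3) P(3))
    have "p (s (p x) \<ominus>\<^bsub>V\<^esub> x) = \<zero>\<^bsub>W\<^esub>" using P(8)[OF c x] ps[OF P(3)[OF x]] P(3)[OF x] by simp
    from ker[OF _ this] have "p' (s (p x) \<ominus>\<^bsub>V\<^esub> x) = \<zero>\<^bsub>U\<^esub>" using c x by simp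
    thus ?thesis using P'(8)[OF c x] P'(3)[OF c] P'(3)[OF x] by simp
  qed
  have "ext_map K U p' k t = ext_map K U p' k (ext_map K V (\<lambda>x. s (p x)) k t)"
    by (rule ext_map_comp[OF linear_map_comp[OF p s] p' p' eq t, symmetric])
  also have "ext_map K V (\<lambda>x. s (p x)) k t = ext_map K V s k (ext_map K W p k t)"
    by (rule ext_map_comp[OF p s linear_map_comp[OF p s] refl t, symmetric])
  also have "\<dots> = \<zero>\<^bsub>ext_pow K V k\<^esub>" unfolding zero by (rule linear_mapD(6)[OF ext_map_linear[OF s]])
  also have "ext_map K U p' k \<zero>\<^bsub>ext_pow K V k\<^esub> = \<zero>\<^bsub>ext_pow K U k\<^esub>" by (rule linear_mapD(6)[OF ext_map_linear[OF p']])
  finally show ?thesis .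
qed

lemma abelian_group_telescope:
  assumes "abelian_group G" "a \<in> carrier G" "b \<in> carrier G" "c \<in> carrier G"
  shows "(a \<ominus>\<^bsub>G\<^esub> b) \<oplus>\<^bsub>G\<^esub> (b \<ominus>\<^bsub>G\<^esub> c) = a \<ominus>\<^bsub>G\<^esub> c"
proof -
  interpret abelian_group G by fact
  show ?thesis using assms(2-4) by (simp add: a_minus_def a_assoc r_neg1)
qed

text \<open>With a section \<open>s\<close> of \<open>p\<close> and \<open>r = s \<circ> p\<close>, the difference
  \<open>x \<and> y - r x \<and> r y = (x - r x) \<and> y + r x \<and> (y - r y)\<close> lies in the span of \<open>ker p \<and> V\<close>. Hence so does
  \<open>t - \<Lambda>\<^sup>2r t\<close> for every \<open>t\<close>, and \<open>\<Lambda>\<^sup>2r t = \<Lambda>\<^sup>2s (\<Lambda>\<^sup>2p t)\<close> vanishes when \<open>t\<close> lies in the kernel.\<close>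

lemma ext_map_kernel_degree_2:
  assumes p: "linear_map K V W p" and fin: "vectorspace.fin_dim K V" and surj: "p ` carrier V = carrier W"
    and S: "subspace K S (ext_pow K V 2)"
    and gen: "\<And>x y. \<lbrakk>x \<in> carrier V; p x = \<zero>\<^bsub>W\<^esub>; y \<in> carrier V\<rbrakk> \<Longrightarrow> wedge K V [x, y] \<in> S"
    and t: "t \<in> carrier (ext_pow K V 2)" and zero: "ext_map K W p 2 t = \<zero>\<^bsub>ext_pow K W 2\<^esub>"
  shows "t \<in> S"
proof -
  obtain s where s: "linear_map K W V s" and ps: "\<And>y. y \<in> carrier W \<Longrightarrow> p (s y) = y"
    using linear_section[OF p fin surj] by blast
  note P = linear_mapD[OF p] and Sd = linear_mapD[OF s]
  note r = linear_map_comp[OF p s]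
  let ?r = "\<lambda>x. s (p x)" and ?E = "ext_pow K V 2"
  interpret V: vectorspace K V by (rule P)
  interpret W: vectorspace K W by (rule P)
  interpret E: vectorspace K ?E by (rule ext_pow_vectorspace[OF P(1)])
  have rc: "?r x \<in> carrier V" if "x \<in> carrier V" for x using that by (intro Sd(3) P(3))
  have pr: "p (x \<ominus>\<^bsub>V\<^esub> ?r x) = \<zero>\<^bsub>W\<^esub>" if "x \<in> carrier V" for x
    using P(8)[OF that rc[OF that]] ps[OF P(3)[OF that]] P(3)[OF that] by simp
  have R: "linear_map K ?E ?E (\<lambda>t. t \<ominus>\<^bsub>?E\<^esub> ext_map K V ?r 2 t)"
  proof (rule linear_mapI[OF E.vectorspace_axioms E.vectorspace_axioms])
    note e = linear_mapD[OF ext_map_linear[OF r, of 2]]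
    fix t assume t: "t \<in> carrier ?E"
    show "t \<ominus>\<^bsub>?E\<^esub> ext_map K V ?r 2 t \<in> carrier ?E" using e(3)[OF t] t by simp
    fix c assume c: "c \<in> carrier K"
    show "c \<odot>\<^bsub>?E\<^esub> t \<ominus>\<^bsub>?E\<^esub> ext_map K V ?r 2 (c \<odot>\<^bsub>?E\<^esub> t) = c \<odot>\<^bsub>?E\<^esub> (t \<ominus>\<^bsub>?E\<^esub> ext_map K V ?r 2 t)"
      using e(3)[OF t] e(5)[OF c t] t c by (simp add: a_minus_def E.smult_r_distr E.smult_r_minus)
  next
    note e = linear_mapD[OF ext_map_linear[OF r, of 2]]
    fix t u assume t: "t \<in> carrier ?E" "u \<in> carrier ?E"
    show "(t \<oplus>\<^bsub>?E\<^esub> u) \<ominus>\<^bsub>?E\<^esub> ext_map K V ?r 2 (t \<oplus>\<^bsub>?E\<^esub> u)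
        = (t \<ominus>\<^bsub>?E\<^esub> ext_map K V ?r 2 t) \<oplus>\<^bsub>?E\<^esub> (u \<ominus>\<^bsub>?E\<^esub> ext_map K V ?r 2 u)"
      using e(3)[OF t(1)] e(3)[OF t(2)] e(4)[OF t] t by (simp add: a_minus_def E.M.a_ac E.M.minus_add)
  qed
  have "carrier ?E \<subseteq> {t \<in> carrier ?E. t \<ominus>\<^bsub>?E\<^esub> ext_map K V ?r 2 t \<in> S}"
  proof (rule ext_pow_subset[OF P(1) subspace_preimage[OF R subspace_carrier[OF E.vectorspace_axioms] S]])
    fix xs assume xs: "xs \<in> tuples V 2"
    then obtain x y where xy: "xs = [x, y]" "x \<in> carrier V" "y \<in> carrier V"
      by (cases xs; cases "tl xs") (auto simp: tuples_def)
    have l: "linear_map K V ?E (\<lambda>u. wedge K V [u, v])" "linear_map K V ?E (\<lambda>u. wedge K V [v, u])"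
      if "v \<in> carrier V" for v
      using wedge_slot[OF P(1), of "[]" "[v]" 2] wedge_slot[OF P(1), of "[v]" "[]" 2] that by simp_all
    note l1 = linear_mapD[OF l(1)] and l2 = linear_mapD[OF l(2)]
    let ?x = "x \<ominus>\<^bsub>V\<^esub> ?r x" and ?y = "y \<ominus>\<^bsub>V\<^esub> ?r y"
    have c: "?x \<in> carrier V" "?y \<in> carrier V" using xy rc by simp_all
    have "wedge K V [?r x, ?y] = \<ominus>\<^bsub>?E\<^esub> wedge K V [?y, ?r x]"
      using alternating_swap[OF wedge_alternating[OF P(1)], of "[]" "[]" "[]" 2 "?r x" ?y] rc xy c by simp
    hence 1: "wedge K V [?r x, ?y] \<in> S"
      using subspaceD(7)[OF S] gen[OF c(2) pr[OF xy(3)] rc[OF xy(2)]] by simp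
    have 2: "wedge K V [?x, y] \<in> S" by (rule gen[OF c(1) pr[OF xy(2)] xy(3)])
    have "wedge K V [x, y] \<ominus>\<^bsub>?E\<^esub> wedge K V [?r x, ?r y]
      = (wedge K V [x, y] \<ominus>\<^bsub>?E\<^esub> wedge K V [?r x, y]) \<oplus>\<^bsub>?E\<^esub> (wedge K V [?r x, y] \<ominus>\<^bsub>?E\<^esub> wedge K V [?r x, ?r y])"
      by (rule abelian_group_telescope[symmetric, OF E.M.abelian_group_axioms])
        (rule l1(3); use xy rc in simp)+
    also have "\<dots> = wedge K V [?x, y] \<oplus>\<^bsub>?E\<^esub> wedge K V [?r x, ?y]"
      unfolding l1(8)[OF xy(3) xy(2) rc[OF xy(2)]] l2(8)[OF rc[OF xy(2)] xy(3) rc[OF xy(3)]] ..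
    also have "\<dots> \<in> S" by (rule subspaceD(4)[OF S 2 1])
    finally show "wedge K V xs \<in> {t \<in> carrier ?E. t \<ominus>\<^bsub>?E\<^esub> ext_map K V ?r 2 t \<in> S}"
      using wedge_closed[OF P(1) xs] ext_map_wedge[OF r xs] xy by simp
  qed
  hence "t \<ominus>\<^bsub>?E\<^esub> ext_map K V ?r 2 t \<in> S" using t by blast
  moreover have "ext_map K V ?r 2 t = \<zero>\<^bsub>?E\<^esub>"
    using ext_map_comp[OF p s r refl t] linear_mapD(6)[OF ext_map_linear[OF s]] zero by simp
  moreover have "t \<ominus>\<^bsub>?E\<^esub> \<zero>\<^bsub>?E\<^esub> = t" using t E.M.add.inv_one by (simp add: a_minus_def)
  ultimately show ?thesis by simp
qed

text \<open>Injectivity comes from the universal property: \<^const>\<open>hd\<close> is alternating in degree 1 and lifts to a left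
  inverse.\<close>

lemma wedge_singleton:
  assumes V: "vectorspace K V"
  shows "linear_map K V (ext_pow K V 1) (\<lambda>x. wedge K V [x])"
    and "\<And>x. \<lbrakk>x \<in> carrier V; wedge K V [x] = \<zero>\<^bsub>ext_pow K V 1\<^esub>\<rbrakk> \<Longrightarrow> x = \<zero>\<^bsub>V\<^esub>"
proof -
  show "linear_map K V (ext_pow K V 1) (\<lambda>x. wedge K V [x])"
    using wedge_slot[OF V, of "[]" "[]" 1] by simp
  have hd: "alternating K V V 1 hd"
    unfolding alternating_def multilinear_def
  proof (intro conjI allI ballI impI)
    fix us vs
    assume "set us \<subseteq> carrier V \<and> set vs \<subseteq> carrier V \<and> int (length us + length vs) + 1 = 1"
    hence "length us = 0" by linarith
    thus "linear_map K V V (\<lambda>x. hd (us @ x # vs))" using linear_map_identity[OF V] by simp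
  next
    fix xs assume "xs \<in> tuples V 1" "\<not> distinct xs"
    thus "hd xs = \<zero>\<^bsub>V\<^esub>" by (cases xs) (auto simp: tuples_def)
  qed simp
  show "x = \<zero>\<^bsub>V\<^esub>" if x: "x \<in> carrier V" "wedge K V [x] = \<zero>\<^bsub>ext_pow K V 1\<^esub>" for x
  proof -
    have "[x] \<in> tuples V 1" using x by (simp add: tuples_def)
    from ext_lift_wedge[OF V V hd this] have "x = ext_lift K V hd \<zero>\<^bsub>ext_pow K V 1\<^esub>" using x(2) by simp
    also have "\<dots> = \<zero>\<^bsub>V\<^esub>" by (rule linear_mapD(6)[OF ext_lift_linear[OF V V hd]])
    finally show ?thesis .
  qed
qed

section \<open>Left multiplication in the exterior algebra\<close>

text \<open>Left multiplication \<open>x \<and> _ : \<Lambda>\<^sup>k\<^sup>-\<^sup>1 V \<rightarrow> \<Lambda>\<^sup>k V\<close>. The degree is that of the target.\<close>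

definition lwedge :: "('k, 'm) ring_scheme \<Rightarrow> ('k, 'a, 'z) module_scheme \<Rightarrow> int \<Rightarrow> 'a \<Rightarrow> ('a list \<Rightarrow> 'k) set \<Rightarrow> ('a list \<Rightarrow> 'k) set" where
  "lwedge K V k x = ext_lift K (ext_pow K V k) (\<lambda>xs. wedge K V (x # xs))"

lemma lwedge_alternating:
  assumes V: "vectorspace K V" and x: "x \<in> carrier V"
  shows "alternating K V (ext_pow K V k) (k - 1) (\<lambda>xs. wedge K V (x # xs))"
  unfolding alternating_def multilinear_def
proof (intro conjI allI ballI impI)
  fix us vs assume "set us \<subseteq> carrier V \<and> set vs \<subseteq> carrier V \<and> int (length us + length vs) + 1 = k - 1"
  thus "linear_map K V (ext_pow K V k) (\<lambda>z. wedge K V (x # us @ z # vs))"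
    using wedge_slot[OF V, of "x # us" vs k] x by simp
next
  show "wedge K V [x] \<in> carrier (ext_pow K V k)" if "k - 1 = 0"
    by (rule wedge_closed[OF V]) (use that x in \<open>simp add: tuples_def\<close>)
  show "wedge K V (x # xs) = \<zero>\<^bsub>ext_pow K V k\<^esub>" if "xs \<in> tuples V (k - 1)" "\<not> distinct xs" for xs
    by (rule alternatingD(2)[OF wedge_alternating[OF V]]) (use that x in \<open>auto simp: tuples_def\<close>)
qed

lemma lwedge_linear:
  assumes "vectorspace K V" "x \<in> carrier V"
  shows "linear_map K (ext_pow K V (k - 1)) (ext_pow K V k) (lwedge K V k x)"
  unfolding lwedge_def by (rule ext_lift_linear[OF assms(1) ext_pow_vectorspace[OF assms(1)] lwedge_alternating[OF assms]])

lemma lwedge_wedge: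
  assumes "vectorspace K V" "x \<in> carrier V" "xs \<in> tuples V (k - 1)"
  shows "lwedge K V k x (wedge K V xs) = wedge K V (x # xs)"
  unfolding lwedge_def
  by (rule ext_lift_wedge[OF assms(1) ext_pow_vectorspace[OF assms(1)] lwedge_alternating[OF assms(1,2)] assms(3)])

lemma tuples_Cons: "x # xs \<in> tuples V k \<longleftrightarrow> x \<in> carrier V \<and> xs \<in> tuples V (k - 1)"
  unfolding tuples_def by auto

lemma lwedge_vector_linear:
  assumes V: "vectorspace K V" and t: "t \<in> carrier (ext_pow K V (k - 1))"
  shows "linear_map K V (ext_pow K V k) (\<lambda>x. lwedge K V k x t)"
proof (rule linear_mapI[OF V ext_pow_vectorspace[OF V]])
  interpret V: vectorspace K V by fact
  note lin = lwedge_linear[OF V]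
  have slot: "linear_map K V (ext_pow K V k) (\<lambda>x. wedge K V (x # xs))" if "xs \<in> tuples V (k - 1)" for xs
    using wedge_slot[OF V, of "[]" xs k] that by (simp add: tuples_def)
  fix x assume x: "x \<in> carrier V"
  show "lwedge K V k x t \<in> carrier (ext_pow K V k)" by (rule linear_mapD(3)[OF lin[OF x] t])
  show "lwedge K V k (x \<oplus>\<^bsub>V\<^esub> y) t = lwedge K V k x t \<oplus>\<^bsub>ext_pow K V k\<^esub> lwedge K V k y t" if y: "y \<in> carrier V" for y
  proof (rule ext_pow_eqI[OF V lin[OF V.M.a_closed[OF x y]] linear_map_add[OF lin[OF x] lin[OF y]] _ t])
    fix xs assume xs: "xs \<in> tuples V (k - 1)"
    show "lwedge K V k (x \<oplus>\<^bsub>V\<^esub> y) (wedge K V xs)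
      = lwedge K V k x (wedge K V xs) \<oplus>\<^bsub>ext_pow K V k\<^esub> lwedge K V k y (wedge K V xs)"
      using linear_mapD(4)[OF slot[OF xs] x y] x y xs by (simp add: lwedge_wedge[OF V])
  qed
  show "lwedge K V k (c \<odot>\<^bsub>V\<^esub> x) t = c \<odot>\<^bsub>ext_pow K V k\<^esub> lwedge K V k x t" if c: "c \<in> carrier K" for c
  proof (rule ext_pow_eqI[OF V lin[OF V.smult_closed[OF c x]] linear_map_smult[OF lin[OF x] c] _ t])
    fix xs assume xs: "xs \<in> tuples V (k - 1)"
    show "lwedge K V k (c \<odot>\<^bsub>V\<^esub> x) (wedge K V xs) = c \<odot>\<^bsub>ext_pow K V k\<^esub> lwedge K V k x (wedge K V xs)"
      using linear_mapD(5)[OF slot[OF xs] c x] x c xs by (simp add: lwedge_wedge[OF V])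
  qed
qed

lemma lwedge_square:
  assumes V: "vectorspace K V" and x: "x \<in> carrier V" and t: "t \<in> carrier (ext_pow K V (k - 1 - 1))"
  shows "lwedge K V k x (lwedge K V (k - 1) x t) = \<zero>\<^bsub>ext_pow K V k\<^esub>"
proof (rule ext_pow_eqI[OF V linear_map_comp[OF lwedge_linear[OF V x] lwedge_linear[OF V x]]
      linear_map_zero[OF ext_pow_vectorspace[OF V] ext_pow_vectorspace[OF V]] _ t])
  fix xs assume xs: "xs \<in> tuples V (k - 1 - 1)"
  have "wedge K V (x # x # xs) = \<zero>\<^bsub>ext_pow K V k\<^esub>"
    by (rule alternatingD(2)[OF wedge_alternating[OF V]]) (use x xs in \<open>simp_all add: tuples_Cons\<close>)
  thus "lwedge K V k x (lwedge K V (k - 1) x (wedge K V xs)) = \<zero>\<^bsub>ext_pow K V k\<^esub>"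
    using x xs by (simp add: lwedge_wedge[OF V] tuples_Cons)
qed

text \<open>Induction on the degree for families of linear maps: \<open>\<Lambda>\<^sup>k V\<close> is spanned by the products \<open>x \<and> u\<close> with
  \<open>u\<close> of degree \<open>k - 1\<close>, and it is enough to treat those \<open>u\<close> on which the two maps already agree.\<close>

lemma ext_pow_induct_eq:
  assumes V: "vectorspace K V"
    and S: "\<And>k. linear_map K (ext_pow K V k) (W k) (S k)" and T: "\<And>k. linear_map K (ext_pow K V k) (W k) (T k)"
    and nil: "S 0 (wedge K V []) = T 0 (wedge K V [])"
    and step: "\<And>k x u. \<lbrakk>x \<in> carrier V; u \<in> carrier (ext_pow K V (k - 1)); S (k - 1) u = T (k - 1) u\<rbrakk> \<Longrightarrow>
      S k (lwedge K V k x u) = T k (lwedge K V k x u)"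
    and t: "t \<in> carrier (ext_pow K V k)"
  shows "S k t = T k t"
proof (rule ext_pow_eqI[OF V S T _ t])
  show "S k (wedge K V xs) = T k (wedge K V xs)" if "xs \<in> tuples V k" for xs
    using that
  proof (induction xs arbitrary: k)
    case Nil
    thus ?case using nil by (simp add: tuples_def)
  next
    case (Cons x xs)
    hence *: "x \<in> carrier V" "xs \<in> tuples V (k - 1)" by (simp_all add: tuples_Cons)
    from step[OF *(1) wedge_closed[OF V *(2)] Cons.IH[OF *(2)]] show ?case
      by (simp add: lwedge_wedge[OF V *])
  qed
qed

section \<open>The action of a Lie algebra on its exterior powers\<close>

lemma lie_algebra_vs: "lie_algebra K L \<Longrightarrow> vectorspace K L"
  by (rule lie_algebra.axioms)

lemma bracket_linear_right:
  assumes "lie_algebra K L" "x \<in> carrier L"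
  shows "linear_map K L L (\<lambda>y. lie_bracket L x y)"
proof -
  interpret lie_algebra K L by fact
  show ?thesis by (rule linear_mapI) (unfold_locales, simp_all add: bracket_closed bracket_add_right bracket_smult_right assms(2))
qed

lemma bracket_linear_left:
  assumes "lie_algebra K L" "x \<in> carrier L"
  shows "linear_map K L L (\<lambda>y. lie_bracket L y x)"
proof -
  interpret lie_algebra K L by fact
  show ?thesis by (rule linear_mapI) (unfold_locales, simp_all add: bracket_closed bracket_add_left bracket_smult_left assms(2))
qed

text \<open>The value on \<open>y\<^sub>1 \<and> \<dots> \<and> y\<^sub>k\<close> of the derivation extending \<open>[x, _]\<close>, defined by the Leibniz rule for the
  first factor.\<close>

fun ad_wedge :: "('k, 'm) ring_scheme \<Rightarrow> ('k, 'a, 'z) lie_alg_scheme \<Rightarrow> int \<Rightarrow> 'a \<Rightarrow> 'a list \<Rightarrow> ('a list \<Rightarrow> 'k) set" where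
  "ad_wedge K L k x [] = \<zero>\<^bsub>ext_pow K L k\<^esub>"
| "ad_wedge K L k x (y # ys) =
     wedge K L (lie_bracket L x y # ys) \<oplus>\<^bsub>ext_pow K L k\<^esub> lwedge K L k y (ad_wedge K L (k - 1) x ys)"

lemma ad_wedge_closed:
  assumes L: "lie_algebra K L" and x: "x \<in> carrier L" and ys: "ys \<in> tuples L k"
  shows "ad_wedge K L k x ys \<in> carrier (ext_pow K L k)"
  using ys
proof (induction ys arbitrary: k)
  case Nil
  interpret E: vectorspace K "ext_pow K L k" by (rule ext_pow_vectorspace[OF lie_algebra_vs[OF L]])
  show ?case by simp
next
  case (Cons y ys)
  interpret lie_algebra K L by fact
  interpret E: vectorspace K "ext_pow K L k" by (rule ext_pow_vectorspace[OF lie_algebra_vs[OF L]])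
  from Cons.prems have *: "y \<in> carrier L" "ys \<in> tuples L (k - 1)" by (simp_all add: tuples_Cons)
  show ?case using linear_mapD(3)[OF lwedge_linear[OF vectorspace_axioms *(1)] Cons.IH[OF *(2)]]
      wedge_closed[OF vectorspace_axioms, of "lie_bracket L x y # ys" k] bracket_closed[OF x *(1)] *
    by (simp add: tuples_Cons)
qed

lemma ad_wedge_vector_linear:
  assumes L: "lie_algebra K L" and ys: "ys \<in> tuples L k"
  shows "linear_map K L (ext_pow K L k) (\<lambda>x. ad_wedge K L k x ys)"
  using ys
proof (induction ys arbitrary: k)
  case Nil
  show ?case by (simp add: linear_map_zero lie_algebra_vs[OF L] ext_pow_vectorspace)
next
  case (Cons y ys)
  from Cons.prems have *: "y \<in> carrier L" "ys \<in> tuples L (k - 1)" by (simp_all add: tuples_Cons)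
  note V = lie_algebra_vs[OF L]
  have "linear_map K L (ext_pow K L k) (\<lambda>z. wedge K L (z # ys))"
    using wedge_slot[OF V, of "[]" ys k] *(2) by (simp add: tuples_def)
  from linear_map_add[OF linear_map_comp[OF bracket_linear_left[OF L *(1)] this]
      linear_map_comp[OF Cons.IH[OF *(2)] lwedge_linear[OF V *(1)]]]
  show ?case by simp
qed

text \<open>For a repeated pair at the front, the Leibniz rule produces \<open>[x,z] \<and> z \<and> \<omega> + z \<and> [x,z] \<and> \<omega>\<close> plus terms
  containing \<open>z \<and> z\<close>; longer prefixes reduce to this case by induction.\<close>

lemma ad_wedge_alternating:
  assumes L: "lie_algebra K L" and x: "x \<in> carrier L"
  shows "alternating K L (ext_pow K L k) k (ad_wedge K L k x)"
proof (rule alternatingI_adjacent)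
  note V = lie_algebra_vs[OF L]
  interpret lie_algebra K L by fact
  have slot: "linear_map K L (ext_pow K L k) (\<lambda>z. ad_wedge K L k x (us @ z # vs))"
    if "set us \<subseteq> carrier L" "set vs \<subseteq> carrier L" "int (length us + length vs) + 1 = k" for us vs k
    using that
  proof (induction us arbitrary: k)
    case Nil
    hence vs: "vs \<in> tuples L (k - 1)" by (simp add: tuples_def)
    have "linear_map K L (ext_pow K L k) (\<lambda>z. wedge K L (z # vs))"
      using wedge_slot[OF V, of "[]" vs k] Nil by simp
    from linear_map_add[OF linear_map_comp[OF bracket_linear_right[OF L x] this]
        lwedge_vector_linear[OF V ad_wedge_closed[OF L x vs]]]
    show ?case by simp
  next
    case (Cons u us)
    have IH: "linear_map K L (ext_pow K L (k - 1)) (\<lambda>z. ad_wedge K L (k - 1) x (us @ z # vs))"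
      by (rule Cons.IH) (use Cons.prems in auto)
    have "linear_map K L (ext_pow K L k) (\<lambda>z. wedge K L ((lie_bracket L x u # us) @ z # vs))"
      by (rule wedge_slot[OF V]) (use Cons.prems bracket_closed[OF x] in auto)
    from linear_map_add[OF this linear_map_comp[OF IH lwedge_linear[OF V]], of u] Cons.prems
    show ?case by simp
  qed
  show "multilinear K L (ext_pow K L k) k (ad_wedge K L k x)"
    unfolding multilinear_def using slot ad_wedge_closed[OF L x, of "[]" k] by (auto simp: tuples_def)
  have "ad_wedge K L k x (us @ z # z # vs) = \<zero>\<^bsub>ext_pow K L k\<^esub>" if "us @ z # z # vs \<in> tuples L k" for us z vs k
    using that
  proof (induction us arbitrary: k)
    case Nil
    interpret E: vectorspace K "ext_pow K L k" by (rule ext_pow_vectorspace[OF V])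
    interpret E': vectorspace K "ext_pow K L (k - 1)" by (rule ext_pow_vectorspace[OF V])
    from Nil have z: "z \<in> carrier L" and vs: "vs \<in> tuples L (k - 1 - 1)" by (simp_all add: tuples_Cons)
    define b where "b = lie_bracket L x z"
    have b: "b \<in> carrier L" unfolding b_def by (rule bracket_closed[OF x z])
    note lin = linear_mapD[OF lwedge_linear[OF V z]]
    note a = ad_wedge_closed[OF L x vs]
    have 1: "wedge K L (b # vs) \<in> carrier (ext_pow K L (k - 1))"
      by (rule wedge_closed[OF V]) (use b vs in \<open>simp add: tuples_Cons\<close>)
    have 2: "lwedge K L (k - 1) z (ad_wedge K L (k - 1 - 1) x vs) \<in> carrier (ext_pow K L (k - 1))"
      by (rule lin(3)[OF a])
    have 3: "wedge K L (z # b # vs) \<in> carrier (ext_pow K L k)"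
      by (rule wedge_closed[OF V]) (use b z vs in \<open>simp add: tuples_Cons\<close>)
    have sw: "wedge K L (b # z # vs) = \<ominus>\<^bsub>ext_pow K L k\<^esub> wedge K L (z # b # vs)"
      using alternating_swap[OF wedge_alternating[OF V], of "[]" "[]" vs k b z] b z vs by (simp add: tuples_def)
    have "lwedge K L k z (ad_wedge K L (k - 1) x (z # vs)) = wedge K L (z # b # vs)"
      using lin(4)[OF 1 2] lwedge_square[OF V z a] 3 b vs
      by (simp add: b_def[symmetric] lwedge_wedge[OF V z] tuples_Cons)
    thus ?case using sw 3 by (simp add: b_def[symmetric] E.M.l_neg del: ad_wedge.simps add: ad_wedge.simps(2)[of _ _ k])
  next
    case (Cons u us)
    interpret E: vectorspace K "ext_pow K L k" by (rule ext_pow_vectorspace[OF V])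
    from Cons.prems have u: "u \<in> carrier L" and vs: "us @ z # z # vs \<in> tuples L (k - 1)" by (simp_all add: tuples_Cons)
    have "wedge K L (lie_bracket L x u # us @ z # z # vs) = \<zero>\<^bsub>ext_pow K L k\<^esub>"
      by (rule alternatingD(2)[OF wedge_alternating[OF V]]) (use vs bracket_closed[OF x u] in \<open>auto simp: tuples_Cons\<close>)
    thus ?case using Cons.IH[OF vs] linear_mapD(6)[OF lwedge_linear[OF V u]] by simp
  qed
  thus "ad_wedge K L k x (us @ z # z # vs) = \<zero>\<^bsub>ext_pow K L k\<^esub>" if "us @ z # z # vs \<in> tuples L k" for us z vs
    using that .
qed

text \<open>The operator \<open>\<theta>\<^sub>x\<close> by which \<open>x\<close> acts on \<open>\<Lambda>\<^sup>k L\<close>.\<close>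

definition lie_der :: "('k, 'm) ring_scheme \<Rightarrow> ('k, 'a, 'z) lie_alg_scheme \<Rightarrow> int \<Rightarrow> 'a \<Rightarrow> ('a list \<Rightarrow> 'k) set \<Rightarrow> ('a list \<Rightarrow> 'k) set" where
  "lie_der K L k x = ext_lift K (ext_pow K L k) (ad_wedge K L k x)"

lemma lie_der_linear:
  assumes "lie_algebra K L" "x \<in> carrier L"
  shows "linear_map K (ext_pow K L k) (ext_pow K L k) (lie_der K L k x)"
  unfolding lie_der_def
  by (rule ext_lift_linear[OF lie_algebra_vs[OF assms(1)] ext_pow_vectorspace[OF lie_algebra_vs[OF assms(1)]] ad_wedge_alternating[OF assms]])

lemma lie_der_wedge:
  assumes "lie_algebra K L" "x \<in> carrier L" "xs \<in> tuples L k"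
  shows "lie_der K L k x (wedge K L xs) = ad_wedge K L k x xs"
  unfolding lie_der_def
  by (rule ext_lift_wedge[OF lie_algebra_vs[OF assms(1)] ext_pow_vectorspace[OF lie_algebra_vs[OF assms(1)]] ad_wedge_alternating[OF assms(1,2)] assms(3)])

lemma lie_der_nil:
  assumes "lie_algebra K L" "x \<in> carrier L"
  shows "lie_der K L 0 x (wedge K L []) = \<zero>\<^bsub>ext_pow K L 0\<^esub>"
  using lie_der_wedge[OF assms, of "[]" 0] by (simp add: tuples_def)

lemma lie_der_lwedge:
  assumes L: "lie_algebra K L" and x: "x \<in> carrier L" and y: "y \<in> carrier L" and t: "t \<in> carrier (ext_pow K L (k - 1))"
  shows "lie_der K L k x (lwedge K L k y t)
    = lwedge K L k (lie_bracket L x y) t \<oplus>\<^bsub>ext_pow K L k\<^esub> lwedge K L k y (lie_der K L (k - 1) x t)"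
proof -
  interpret lie_algebra K L by fact
  note V = vectorspace_axioms and b = bracket_closed[OF x y]
  show ?thesis
  proof (rule ext_pow_eqI[OF V linear_map_comp[OF lwedge_linear[OF V y] lie_der_linear[OF L x]]
        linear_map_add[OF lwedge_linear[OF V b] linear_map_comp[OF lie_der_linear[OF L x] lwedge_linear[OF V y]]] _ t])
    fix xs assume xs: "xs \<in> tuples L (k - 1)"
    hence "y # xs \<in> tuples L k" using y by (simp add: tuples_Cons)
    thus "lie_der K L k x (lwedge K L k y (wedge K L xs)) = lwedge K L k (lie_bracket L x y) (wedge K L xs)
        \<oplus>\<^bsub>ext_pow K L k\<^esub> lwedge K L k y (lie_der K L (k - 1) x (wedge K L xs))"
      using lie_der_wedge[OF L x] xs by (simp add: lwedge_wedge[OF V y] lwedge_wedge[OF V b])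
  qed
qed

section \<open>A recursion for the Chevalley-Eilenberg differential\<close>

text \<open>The differential, computed by the recursion \<open>\<partial>(x \<and> \<omega>) = -(x \<and> \<partial>\<omega> + \<theta>\<^sub>x \<omega>)\<close>. Unlike the sum over pairs
  of positions, this form lends itself to induction on the degree.\<close>

fun ce_wedge :: "('k, 'm) ring_scheme \<Rightarrow> ('k, 'a, 'z) lie_alg_scheme \<Rightarrow> int \<Rightarrow> 'a list \<Rightarrow> ('a list \<Rightarrow> 'k) set" where
  "ce_wedge K L k [] = \<zero>\<^bsub>ext_pow K L (k - 1)\<^esub>"
| "ce_wedge K L k (x # xs) = \<ominus>\<^bsub>ext_pow K L (k - 1)\<^esub>
     (lwedge K L (k - 1) x (ce_wedge K L (k - 1) xs) \<oplus>\<^bsub>ext_pow K L (k - 1)\<^esub> ad_wedge K L (k - 1) x xs)"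

lemma ce_wedge_closed:
  assumes L: "lie_algebra K L" and xs: "xs \<in> tuples L k"
  shows "ce_wedge K L k xs \<in> carrier (ext_pow K L (k - 1))"
  using xs
proof (induction xs arbitrary: k)
  case Nil
  interpret E: vectorspace K "ext_pow K L (k - 1)" by (rule ext_pow_vectorspace[OF lie_algebra_vs[OF L]])
  show ?case by simp
next
  case (Cons x xs)
  interpret E: vectorspace K "ext_pow K L (k - 1)" by (rule ext_pow_vectorspace[OF lie_algebra_vs[OF L]])
  from Cons.prems have *: "x \<in> carrier L" "xs \<in> tuples L (k - 1)" by (simp_all add: tuples_Cons)
  show ?case
    using linear_mapD(3)[OF lwedge_linear[OF lie_algebra_vs[OF L] *(1)] Cons.IH[OF *(2)]] ad_wedge_closed[OF L *] by simp
qed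

text \<open>For two equal entries \<open>z\<close> at the front, the recursion applied twice gives
  \<open>z \<and> (z \<and> \<partial>\<omega> + \<theta>\<^sub>z \<omega>) - ([z,z] \<and> \<omega> + z \<and> \<theta>\<^sub>z \<omega>)\<close>, and everything cancels.\<close>

lemma ce_wedge_alternating:
  assumes L: "lie_algebra K L"
  shows "alternating K L (ext_pow K L (k - 1)) k (ce_wedge K L k)"
proof (rule alternatingI_adjacent)
  note V = lie_algebra_vs[OF L]
  interpret lie_algebra K L by fact
  have slot: "linear_map K L (ext_pow K L (k - 1)) (\<lambda>z. ce_wedge K L k (us @ z # vs))"
    if "set us \<subseteq> carrier L" "set vs \<subseteq> carrier L" "int (length us + length vs) + 1 = k" for us vs k
    using that
  proof (induction us arbitrary: k)
    case Nil
    hence vs: "vs \<in> tuples L (k - 1)" by (simp add: tuples_def)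
    from linear_map_neg[OF linear_map_add[OF lwedge_vector_linear[OF V ce_wedge_closed[OF L vs]] ad_wedge_vector_linear[OF L vs]]]
    show ?case by simp
  next
    case (Cons u us)
    have u: "u \<in> carrier L" using Cons.prems by simp
    have IH: "linear_map K L (ext_pow K L (k - 1 - 1)) (\<lambda>z. ce_wedge K L (k - 1) (us @ z # vs))"
      by (rule Cons.IH) (use Cons.prems in auto)
    have "linear_map K L (ext_pow K L (k - 1)) (\<lambda>z. ad_wedge K L (k - 1) u (us @ z # vs))"
      by (rule multilinear_slot[OF alternatingD(1)[OF ad_wedge_alternating[OF L u]]]) (use Cons.prems in auto)
    from linear_map_neg[OF linear_map_add[OF linear_map_comp[OF IH lwedge_linear[OF V u]] this]]
    show ?case by simp
  qed
  show "multilinear K L (ext_pow K L (k - 1)) k (ce_wedge K L k)"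
    unfolding multilinear_def using slot ce_wedge_closed[OF L, of "[]" k] by (auto simp: tuples_def)
  have "ce_wedge K L k (us @ z # z # vs) = \<zero>\<^bsub>ext_pow K L (k - 1)\<^esub>" if "us @ z # z # vs \<in> tuples L k" for us z vs k
    using that
  proof (induction us arbitrary: k)
    case Nil
    let ?E = "ext_pow K L (k - 1)" and ?E' = "ext_pow K L (k - 1 - 1)"
    interpret E: vectorspace K ?E by (rule ext_pow_vectorspace[OF V])
    interpret E': vectorspace K ?E' by (rule ext_pow_vectorspace[OF V])
    from Nil have z: "z \<in> carrier L" and vs: "vs \<in> tuples L (k - 1 - 1)" by (simp_all add: tuples_Cons)
    define a where "a = lwedge K L (k - 1 - 1) z (ce_wedge K L (k - 1 - 1) vs)"
    define b where "b = ad_wedge K L (k - 1 - 1) z vs"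
    note lin = linear_mapD[OF lwedge_linear[OF V z]]
    have a: "a \<in> carrier ?E'" unfolding a_def by (rule lin(3)[OF ce_wedge_closed[OF L vs]])
    have b: "b \<in> carrier ?E'" unfolding b_def by (rule ad_wedge_closed[OF L z vs])
    have la: "lwedge K L (k - 1) z a = \<zero>\<^bsub>?E\<^esub>" unfolding a_def by (rule lwedge_square[OF V z ce_wedge_closed[OF L vs]])
    have lb: "lwedge K L (k - 1) z b \<in> carrier ?E" by (rule lin(3)[OF b])
    have "linear_map K L ?E (\<lambda>z. wedge K L (z # vs))"
      using wedge_slot[OF V, of "[]" vs "k - 1"] vs by (simp add: tuples_def)
    hence w0: "wedge K L (lie_bracket L z z # vs) = \<zero>\<^bsub>?E\<^esub>" unfolding bracket_self[OF z] by (rule linear_mapD(6))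
    have "lwedge K L (k - 1) z (\<ominus>\<^bsub>?E'\<^esub> (a \<oplus>\<^bsub>?E'\<^esub> b)) = \<ominus>\<^bsub>?E\<^esub> lwedge K L (k - 1) z b"
      using lin(7)[OF E'.M.a_closed[OF a b]] lin(4)[OF a b] la lb by simp
    moreover have "ce_wedge K L k ([] @ z # z # vs) = \<ominus>\<^bsub>?E\<^esub> (lwedge K L (k - 1) z (\<ominus>\<^bsub>?E'\<^esub> (a \<oplus>\<^bsub>?E'\<^esub> b))
        \<oplus>\<^bsub>?E\<^esub> (wedge K L (lie_bracket L z z # vs) \<oplus>\<^bsub>?E\<^esub> lwedge K L (k - 1) z b))"
      unfolding a_def b_def append_Nil ce_wedge.simps ad_wedge.simps ..
    ultimately show ?case using w0 lb by (simp add: E.M.l_neg)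
  next
    case (Cons u us)
    interpret E: vectorspace K "ext_pow K L (k - 1)" by (rule ext_pow_vectorspace[OF V])
    from Cons.prems have u: "u \<in> carrier L" and vs: "us @ z # z # vs \<in> tuples L (k - 1)" by (simp_all add: tuples_Cons)
    have "ad_wedge K L (k - 1) u (us @ z # z # vs) = \<zero>\<^bsub>ext_pow K L (k - 1)\<^esub>"
      by (rule alternatingD(2)[OF ad_wedge_alternating[OF L u] vs]) simp
    thus ?case using Cons.IH[OF vs] linear_mapD(6)[OF lwedge_linear[OF V u, of "k - 1"]] by simp
  qed
  thus "ce_wedge K L k (us @ z # z # vs) = \<zero>\<^bsub>ext_pow K L (k - 1)\<^esub>" if "us @ z # z # vs \<in> tuples L k" for us z vs
    using that .
qed

lemma nths_minus_1: "j < length xs \<Longrightarrow> nths xs (- {j}) = take j xs @ drop (Suc j) xs"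
proof (induction xs arbitrary: j)
  case (Cons x xs)
  have all: "nths ys (- {0}) = drop 1 ys" for ys :: "'a list"
  proof (cases ys)
    case (Cons y zs)
    have "{j. Suc j \<in> - {0}} = UNIV" by auto
    thus ?thesis by (simp add: Cons nths_Cons nths_all)
  qed simp
  show ?case
  proof (cases j)
    case 0
    thus ?thesis using all[of "x # xs"] by simp
  next
    case (Suc i)
    have "{j. Suc j \<in> - {Suc i}} = - {i}" by auto
    thus ?thesis using Cons.IH[of i] Cons.prems Suc by (simp add: nths_Cons)
  qed
qed simp

lemma length_nths_minus_2:
  assumes "i < j" "j < length xs"
  shows "int (length (nths xs (- {i, j}))) = int (length xs) - 2"
proof -
  have "{a. a < length xs \<and> a \<in> - {i, j}} = {..<length xs} - {i, j}" by auto
  moreover have "card ({..<length xs} - {i, j}) = length xs - 2" using assms by (subst card_Diff_subset) auto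
  ultimately have "length (nths xs (- {i, j})) = length xs - 2" unfolding length_nths by simp
  thus ?thesis using assms by simp
qed

text \<open>Moving an entry past \<open>length us\<close> others costs one sign for each of them.\<close>

lemma wedge_move:
  assumes V: "vectorspace K V" and xs: "ws @ b # us @ vs \<in> tuples V k"
  shows "wedge K V (ws @ b # us @ vs) = ((\<ominus>\<^bsub>K\<^esub> \<one>\<^bsub>K\<^esub>) [^]\<^bsub>K\<^esub> length us) \<odot>\<^bsub>ext_pow K V k\<^esub> wedge K V (ws @ us @ b # vs)"
  using xs
proof (induction us arbitrary: ws)
  case Nil
  interpret E: vectorspace K "ext_pow K V k" by (rule ext_pow_vectorspace[OF V])
  show ?case using wedge_closed[OF V Nil] by simp
next
  case (Cons u us)
  interpret E: vectorspace K "ext_pow K V k" by (rule ext_pow_vectorspace[OF V])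
  let ?w = "wedge K V (ws @ u # us @ b # vs)" and ?e = "(\<ominus>\<^bsub>K\<^esub> \<one>\<^bsub>K\<^esub>) [^]\<^bsub>K\<^esub> length us"
  have e: "?e \<in> carrier K" by simp
  have w: "?w \<in> carrier (ext_pow K V k)" by (rule wedge_closed[OF V]) (use Cons.prems in \<open>auto simp: tuples_def\<close>)
  have "wedge K V (ws @ b # [] @ u # (us @ vs)) = \<ominus>\<^bsub>ext_pow K V k\<^esub> wedge K V (ws @ u # [] @ b # (us @ vs))"
    by (rule alternating_swap[OF wedge_alternating[OF V]]) (use Cons.prems in \<open>auto simp: tuples_def\<close>)
  also have "wedge K V (ws @ u # [] @ b # (us @ vs)) = ?e \<odot>\<^bsub>ext_pow K V k\<^esub> ?w"
    using Cons.IH[of "ws @ [u]"] Cons.prems by (simp add: tuples_def)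
  also have "\<ominus>\<^bsub>ext_pow K V k\<^esub> (?e \<odot>\<^bsub>ext_pow K V k\<^esub> ?w) = (?e \<otimes>\<^bsub>K\<^esub> \<ominus>\<^bsub>K\<^esub> \<one>\<^bsub>K\<^esub>) \<odot>\<^bsub>ext_pow K V k\<^esub> ?w"
    using e w by (simp add: E.smult_assoc1 E.smult_minus_1 E.smult_r_minus)
  finally show ?case by simp
qed

text \<open>The Leibniz rule written out: bracket \<open>x\<close> with each entry in turn, leaving it in its place.\<close>

lemma ad_wedge_sum:
  assumes L: "lie_algebra K L" and x: "x \<in> carrier L" and ys: "ys \<in> tuples L k"
  shows "ad_wedge K L k x ys = (\<Oplus>\<^bsub>ext_pow K L k\<^esub>j\<in>{..<length ys}. wedge K L (ys[j := lie_bracket L x (ys ! j)]))"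
  using ys
proof (induction ys arbitrary: k)
  case Nil
  interpret E: vectorspace K "ext_pow K L k" by (rule ext_pow_vectorspace[OF lie_algebra_vs[OF L]])
  show ?case by simp
next
  case (Cons y ys)
  note V = lie_algebra_vs[OF L]
  interpret lie_algebra K L by fact
  interpret E: vectorspace K "ext_pow K L k" by (rule ext_pow_vectorspace[OF V])
  from Cons.prems have y: "y \<in> carrier L" and ys: "ys \<in> tuples L (k - 1)" by (simp_all add: tuples_Cons)
  let ?f = "\<lambda>ys j. wedge K L (ys[j := lie_bracket L x (ys ! j)])"
  have upd: "zs[j := lie_bracket L x (zs ! j)] \<in> tuples L m" if "zs \<in> tuples L m" "j < length zs" for zs j m
  proof -
    have "lie_bracket L x (zs ! j) \<in> carrier L" by (rule bracket_closed[OF x]) (use that nth_mem in \<open>auto simp: tuples_def\<close>)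
    thus ?thesis using that set_update_subset_insert[of zs j] by (auto simp: tuples_def)
  qed
  have c0: "wedge K L (lie_bracket L x y # ys) \<in> carrier (ext_pow K L k)"
    by (rule wedge_closed[OF V]) (use ys bracket_closed[OF x y] in \<open>simp add: tuples_Cons\<close>)
  have cS: "wedge K L (y # ys[j := lie_bracket L x (ys ! j)]) \<in> carrier (ext_pow K L k)" if "j < length ys" for j
    by (rule wedge_closed[OF V]) (use y upd[OF ys that] in \<open>simp add: tuples_Cons\<close>)
  have "{..<Suc (length ys)} = {0} \<union> Suc ` {..<length ys}" using lessThan_Suc_eq_insert_0 by auto
  hence "(\<Oplus>\<^bsub>ext_pow K L k\<^esub>j\<in>{..<Suc (length ys)}. ?f (y # ys) j)
    = (\<Oplus>\<^bsub>ext_pow K L k\<^esub>j\<in>{0} \<union> Suc ` {..<length ys}. ?f (y # ys) j)" by simp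
  also have "\<dots> = (\<Oplus>\<^bsub>ext_pow K L k\<^esub>j\<in>{0}. ?f (y # ys) j) \<oplus>\<^bsub>ext_pow K L k\<^esub> (\<Oplus>\<^bsub>ext_pow K L k\<^esub>j\<in>Suc ` {..<length ys}. ?f (y # ys) j)"
    by (rule E.M.finsum_Un_disjoint) (use c0 cS in auto)
  also have "(\<Oplus>\<^bsub>ext_pow K L k\<^esub>j\<in>Suc ` {..<length ys}. ?f (y # ys) j) = (\<Oplus>\<^bsub>ext_pow K L k\<^esub>j\<in>{..<length ys}. ?f (y # ys) (Suc j))"
    by (rule E.M.finsum_reindex) (use cS in auto)
  also have "\<dots> = (\<Oplus>\<^bsub>ext_pow K L k\<^esub>j\<in>{..<length ys}. lwedge K L k y (?f ys j))"
  proof (rule E.M.add.finprod_cong'[OF refl])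
    show "(\<lambda>j. lwedge K L k y (?f ys j)) \<in> {..<length ys} \<rightarrow> carrier (ext_pow K L k)"
      using linear_mapD(3)[OF lwedge_linear[OF V y]] wedge_closed[OF V upd[OF ys]] by blast
    show "?f (y # ys) (Suc j) = lwedge K L k y (?f ys j)" if "j \<in> {..<length ys}" for j
      using lwedge_wedge[OF V y upd[OF ys]] that by simp
  qed
  also have "\<dots> = lwedge K L k y (\<Oplus>\<^bsub>ext_pow K L (k - 1)\<^esub>j\<in>{..<length ys}. ?f ys j)"
    by (rule linear_map_finsum[OF lwedge_linear[OF V y], symmetric]) (use wedge_closed[OF V upd[OF ys]] in auto)
  also have "\<dots> = lwedge K L k y (ad_wedge K L (k - 1) x ys)" unfolding Cons.IH[OF ys] ..
  also have "(\<Oplus>\<^bsub>ext_pow K L k\<^esub>j\<in>{0}. ?f (y # ys) j) = wedge K L (lie_bracket L x y # ys)"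
    using c0 by simp
  finally show ?case by simp
qed

text \<open>Split the pairs \<open>i < j\<close> according to whether \<open>i = 0\<close>. The pairs \<open>(0, j+1)\<close> bracket \<open>x\<close> with \<open>x\<^sub>j\<close>;
  moving the bracket back to position \<open>j\<close> contributes \<open>(-1)\<^sup>j\<close> against the sign \<open>(-1)\<^sup>j\<^sup>+\<^sup>1\<close>, whence
  \<open>-\<theta>\<^sub>x\<close>. The pairs \<open>(i+1, j+1)\<close> carry the sign of \<open>(i, j)\<close>, and exchanging the bracket with \<open>x\<close> gives
  \<open>-x \<and> \<partial>\<close>.\<close>

lemma ce_bdry_gen_eq:
  assumes L: "lie_algebra K L" and xs: "xs \<in> tuples L k"
  shows "ce_bdry_gen K L k xs = ce_wedge K L k xs"
  using xs
proof (induction xs arbitrary: k)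
  case Nil
  interpret E: vectorspace K "ext_pow K L (k - 1)" by (rule ext_pow_vectorspace[OF lie_algebra_vs[OF L]])
  show ?case by (simp add: ce_bdry_gen_def)
next
  case (Cons x xs)
  note V = lie_algebra_vs[OF L]
  interpret lie_algebra K L by fact
  let ?E = "ext_pow K L (k - 1)" and ?E' = "ext_pow K L (k - 1 - 1)"
  interpret E: vectorspace K ?E by (rule ext_pow_vectorspace[OF V])
  interpret E': vectorspace K ?E' by (rule ext_pow_vectorspace[OF V])
  from Cons.prems have x: "x \<in> carrier L" and xs: "xs \<in> tuples L (k - 1)" by (simp_all add: tuples_Cons)
  let ?P = "\<lambda>n. {(i, j). i < j \<and> j < (n::nat)}" and ?n = "length xs"
  let ?l = "\<lambda>xs p. lie_bracket L (xs ! fst p) (xs ! snd p) # nths xs (- {fst p, snd p})"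
  let ?s = "\<lambda>p. (\<ominus>\<^bsub>K\<^esub> \<one>\<^bsub>K\<^esub>) [^]\<^bsub>K\<^esub> (fst p + snd p :: nat)"
  let ?t = "\<lambda>p. ?s p \<odot>\<^bsub>?E\<^esub> wedge K L (?l (x # xs) p)"
  have l: "?l zs p \<in> tuples L (m - 1)" if "zs \<in> tuples L m" "p \<in> ?P (length zs)" for zs p m
  proof -
    have "lie_bracket L (zs ! fst p) (zs ! snd p) \<in> carrier L"
      by (rule bracket_closed) (use that nth_mem in \<open>auto simp: tuples_def\<close>)
    moreover have "set (nths zs (- {fst p, snd p})) \<subseteq> set zs" by (rule set_nths_subset)
    ultimately show ?thesis using that length_nths_minus_2[of "fst p" "snd p" zs] by (auto simp: tuples_def)
  qed
  have s: "?s p \<in> carrier K" for p by simp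
  have c: "?t p \<in> carrier ?E" if "p \<in> ?P (Suc ?n)" for p
    using wedge_closed[OF V l[OF Cons.prems, of p]] s that by simp
  have fin: "finite (?P n)" for n by (rule finite_subset[of _ "{..<n} \<times> {..<n}"]) auto
  \<comment> \<open>\<open>?A\<close> and \<open>?B\<close> are the pairs with \<open>i = 0\<close> and with \<open>i > 0\<close>\<close>
  let ?A = "(\<lambda>j. (0, Suc j)) ` {..<?n}" and ?B = "(\<lambda>p. (Suc (fst p), Suc (snd p))) ` ?P ?n"
  have split: "?P (Suc ?n) = ?A \<union> ?B"
  proof (intro subset_antisym subsetI)
    fix p assume "p \<in> ?P (Suc ?n)"
    then obtain i j where p: "p = (i, j)" "i < j" "j < Suc ?n" by auto
    from p(2) obtain j' where j': "j = Suc j'" by (cases j) simp_all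
    show "p \<in> ?A \<union> ?B"
    proof (cases i)
      case 0
      thus ?thesis using p j' by auto
    next
      case (Suc i')
      hence "(i', j') \<in> ?P ?n" using p j' by auto
      hence "(\<lambda>p. (Suc (fst p), Suc (snd p))) (i', j') \<in> ?B" by (rule imageI)
      thus ?thesis using p(1) j' Suc by simp
    qed
  qed auto
  have "(\<Oplus>\<^bsub>?E\<^esub>p\<in>?A. ?t p) = (\<Oplus>\<^bsub>?E\<^esub>j\<in>{..<?n}. ?t (0, Suc j))"
    by (rule E.M.finsum_reindex) (use c split in \<open>auto intro: inj_onI\<close>)
  also have "\<dots> = (\<Oplus>\<^bsub>?E\<^esub>j\<in>{..<?n}. \<ominus>\<^bsub>?E\<^esub> wedge K L (xs[j := lie_bracket L x (xs ! j)]))"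
  proof (rule E.M.add.finprod_cong'[OF refl])
    have upd: "wedge K L (xs[j := lie_bracket L x (xs ! j)]) \<in> carrier ?E" if "j < ?n" for j
    proof (rule wedge_closed[OF V])
      have "lie_bracket L x (xs ! j) \<in> carrier L" by (rule bracket_closed[OF x]) (use xs that nth_mem in \<open>auto simp: tuples_def\<close>)
      thus "xs[j := lie_bracket L x (xs ! j)] \<in> tuples L (k - 1)"
        using xs set_update_subset_insert[of xs j] by (auto simp: tuples_def)
    qed
    show "(\<lambda>j. \<ominus>\<^bsub>?E\<^esub> wedge K L (xs[j := lie_bracket L x (xs ! j)])) \<in> {..<?n} \<rightarrow> carrier ?E"
      using upd by simp
    fix j assume "j \<in> {..<?n}"
    hence j: "j < ?n" by simp
    let ?b = "lie_bracket L x (xs ! j)" and ?e = "(\<ominus>\<^bsub>K\<^esub> \<one>\<^bsub>K\<^esub>) [^]\<^bsub>K\<^esub> j" and ?w = "wedge K L (xs[j := lie_bracket L x (xs ! j)])"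
    have e: "?e \<in> carrier K" by simp
    have ee: "?e \<otimes>\<^bsub>K\<^esub> ?e = \<one>\<^bsub>K\<^esub>"
    proof -
      have "?e \<otimes>\<^bsub>K\<^esub> ?e = ((\<ominus>\<^bsub>K\<^esub> \<one>\<^bsub>K\<^esub>) \<otimes>\<^bsub>K\<^esub> (\<ominus>\<^bsub>K\<^esub> \<one>\<^bsub>K\<^esub>)) [^]\<^bsub>K\<^esub> j" by (rule R.pow_mult_distrib[symmetric]) (simp_all add: R.m_comm)
      thus ?thesis by (simp add: R.l_minus)
    qed
    have "{i. Suc i \<in> - {0, Suc j}} = - {j}" by auto
    hence n: "nths (x # xs) (- {0, Suc j}) = take j xs @ drop (Suc j) xs"
      using nths_minus_1[OF j] by (simp add: nths_Cons)
    have "[] @ ?b # take j xs @ drop (Suc j) xs \<in> tuples L (k - 1)"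
      using l[OF Cons.prems, of "(0, Suc j)"] j n by simp
    from wedge_move[OF V this] have "wedge K L (?b # take j xs @ drop (Suc j) xs) = ?e \<odot>\<^bsub>?E\<^esub> ?w"
      using j by (simp add: upd_conv_take_nth_drop)
    hence "?t (0, Suc j) = (?e \<otimes>\<^bsub>K\<^esub> \<ominus>\<^bsub>K\<^esub> \<one>\<^bsub>K\<^esub>) \<odot>\<^bsub>?E\<^esub> (?e \<odot>\<^bsub>?E\<^esub> ?w)" using n by simp
    also have "\<dots> = (?e \<otimes>\<^bsub>K\<^esub> \<ominus>\<^bsub>K\<^esub> \<one>\<^bsub>K\<^esub> \<otimes>\<^bsub>K\<^esub> ?e) \<odot>\<^bsub>?E\<^esub> ?w" using e upd[OF j] by (simp add: E.smult_assoc1)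
    also have "?e \<otimes>\<^bsub>K\<^esub> \<ominus>\<^bsub>K\<^esub> \<one>\<^bsub>K\<^esub> \<otimes>\<^bsub>K\<^esub> ?e = \<ominus>\<^bsub>K\<^esub> \<one>\<^bsub>K\<^esub>" using e ee by (simp add: R.l_minus R.r_minus)
    also have "\<ominus>\<^bsub>K\<^esub> \<one>\<^bsub>K\<^esub> \<odot>\<^bsub>?E\<^esub> ?w = \<ominus>\<^bsub>?E\<^esub> ?w" using upd[OF j] by (rule E.smult_minus_1)
    finally show "?t (0, Suc j) = \<ominus>\<^bsub>?E\<^esub> ?w" .
  qed
  also have "\<dots> = \<ominus>\<^bsub>?E\<^esub> (\<Oplus>\<^bsub>?E\<^esub>j\<in>{..<?n}. wedge K L (xs[j := lie_bracket L x (xs ! j)]))"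
  proof (rule linear_map_finsum[OF linear_map_neg[OF linear_map_identity[OF E.vectorspace_axioms]], symmetric])
    fix j assume "j \<in> {..<?n}"
    hence "lie_bracket L x (xs ! j) \<in> carrier L" by (intro bracket_closed[OF x]) (use xs nth_mem in \<open>auto simp: tuples_def\<close>)
    hence "xs[j := lie_bracket L x (xs ! j)] \<in> tuples L (k - 1)"
      using xs set_update_subset_insert[of xs j] by (auto simp: tuples_def)
    thus "wedge K L (xs[j := lie_bracket L x (xs ! j)]) \<in> carrier ?E" by (rule wedge_closed[OF V])
  qed simp
  also have "\<dots> = \<ominus>\<^bsub>?E\<^esub> ad_wedge K L (k - 1) x xs" unfolding ad_wedge_sum[OF L x xs] ..
  finally have 1: "(\<Oplus>\<^bsub>?E\<^esub>p\<in>?A. ?t p) = \<ominus>\<^bsub>?E\<^esub> ad_wedge K L (k - 1) x xs" .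
  note T = linear_map_neg[OF lwedge_linear[OF V x, of "k - 1"]] and lin = linear_mapD[OF lwedge_linear[OF V x, of "k - 1"]]
  have "(\<Oplus>\<^bsub>?E\<^esub>p\<in>?B. ?t p) = (\<Oplus>\<^bsub>?E\<^esub>p\<in>?P ?n. ?t (Suc (fst p), Suc (snd p)))"
    by (rule E.M.finsum_reindex) (use c split in \<open>auto intro!: inj_onI\<close>)
  also have "\<dots> = (\<Oplus>\<^bsub>?E\<^esub>p\<in>?P ?n. \<ominus>\<^bsub>?E\<^esub> lwedge K L (k - 1) x (?s p \<odot>\<^bsub>?E'\<^esub> wedge K L (?l xs p)))"
  proof (rule E.M.add.finprod_cong'[OF refl])
    have w: "wedge K L (?l xs p) \<in> carrier ?E'" if "p \<in> ?P ?n" for p by (rule wedge_closed[OF V l[OF xs that]])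
    show "(\<lambda>p. \<ominus>\<^bsub>?E\<^esub> lwedge K L (k - 1) x (?s p \<odot>\<^bsub>?E'\<^esub> wedge K L (?l xs p))) \<in> ?P ?n \<rightarrow> carrier ?E"
      by (rule Pi_I, rule E.M.a_inv_closed, rule lin(3), rule E'.smult_closed[OF s w])
    fix p assume p: "p \<in> ?P ?n"
    let ?b = "lie_bracket L (xs ! fst p) (xs ! snd p)" and ?N = "nths xs (- {fst p, snd p})"
    have "{i. Suc i \<in> - {Suc (fst p), Suc (snd p)}} = - {fst p, snd p}" by auto
    hence n: "nths (x # xs) (- {Suc (fst p), Suc (snd p)}) = x # ?N" by (simp add: nths_Cons)
    have bN: "?b \<in> carrier L" "?N \<in> tuples L (k - 1 - 1 - 1)" using l[OF xs p] by (simp_all add: tuples_Cons)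
    have wx: "wedge K L (x # ?b # ?N) \<in> carrier ?E"
      by (rule wedge_closed[OF V]) (use x bN in \<open>simp add: tuples_Cons\<close>)
    have sw: "wedge K L ([] @ ?b # [] @ x # ?N) = \<ominus>\<^bsub>?E\<^esub> wedge K L ([] @ x # [] @ ?b # ?N)"
      by (rule alternating_swap[OF wedge_alternating[OF V]]) (use x bN in \<open>auto simp: tuples_def\<close>)
    have s2: "?s (Suc (fst p), Suc (snd p)) = ?s p" using s[of p] by (simp add: R.m_assoc R.l_minus R.r_minus)
    have "?t (Suc (fst p), Suc (snd p)) = ?s p \<odot>\<^bsub>?E\<^esub> wedge K L (?b # x # ?N)"
      using n s2 by simp
    also have "\<dots> = \<ominus>\<^bsub>?E\<^esub> (?s p \<odot>\<^bsub>?E\<^esub> wedge K L (x # ?b # ?N))"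
      using sw s[of p] wx by (simp add: E.smult_r_minus)
    also have "?s p \<odot>\<^bsub>?E\<^esub> wedge K L (x # ?b # ?N) = lwedge K L (k - 1) x (?s p \<odot>\<^bsub>?E'\<^esub> wedge K L (?l xs p))"
      unfolding lin(5)[OF s w[OF p]] lwedge_wedge[OF V x l[OF xs p]] ..
    finally show "?t (Suc (fst p), Suc (snd p)) = \<ominus>\<^bsub>?E\<^esub> lwedge K L (k - 1) x (?s p \<odot>\<^bsub>?E'\<^esub> wedge K L (?l xs p))" .
  qed
  also have "\<dots> = \<ominus>\<^bsub>?E\<^esub> lwedge K L (k - 1) x (ce_bdry_gen K L (k - 1) xs)"
    unfolding ce_bdry_gen_def
  proof (rule linear_map_finsum[OF T fin, symmetric])
    show "?s p \<odot>\<^bsub>?E'\<^esub> wedge K L (?l xs p) \<in> carrier ?E'" if "p \<in> ?P ?n" for p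
      by (rule E'.smult_closed[OF s wedge_closed[OF V l[OF xs that]]])
  qed
  finally have 2: "(\<Oplus>\<^bsub>?E\<^esub>p\<in>?B. ?t p) = \<ominus>\<^bsub>?E\<^esub> lwedge K L (k - 1) x (ce_wedge K L (k - 1) xs)"
    unfolding Cons.IH[OF xs] .
  have finA: "finite ?A" by (rule finite_imageI[OF finite_lessThan])
  have finB: "finite ?B" by (rule finite_imageI[OF fin])
  have disj: "?A \<inter> ?B = {}" by auto
  have tA: "?t \<in> ?A \<rightarrow> carrier ?E" by (rule Pi_I, rule c, unfold split, rule UnI1)
  have tB: "?t \<in> ?B \<rightarrow> carrier ?E" by (rule Pi_I, rule c, unfold split, rule UnI2)
  have "ce_bdry_gen K L k (x # xs) = (\<Oplus>\<^bsub>?E\<^esub>p\<in>?A \<union> ?B. ?t p)"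
    unfolding ce_bdry_gen_def split[symmetric] by simp
  also have "\<dots> = (\<Oplus>\<^bsub>?E\<^esub>p\<in>?A. ?t p) \<oplus>\<^bsub>?E\<^esub> (\<Oplus>\<^bsub>?E\<^esub>p\<in>?B. ?t p)"
    by (rule E.M.finsum_Un_disjoint[OF finA finB disj tA tB])
  also have "\<dots> = ce_wedge K L k (x # xs)"
    unfolding 1 2 using ad_wedge_closed[OF L x xs] lin(3)[OF ce_wedge_closed[OF L xs]] by (simp add: E.M.minus_add E.M.a_comm)
  finally show ?case .
qed

section \<open>Homology of mapping cones\<close>

definition fd_complex :: "('k, 'm) ring_scheme \<Rightarrow> ('k, 'c) chain_complex \<Rightarrow> bool" where
  "fd_complex K C \<longleftrightarrow> (\<forall>n. vectorspace.fin_dim K (chain C n) \<and>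
     linear_map K (chain C n) (chain C (n - 1)) (bdry C n) \<and>
     (\<forall>c\<in>carrier (chain C n). bdry C (n - 1) (bdry C n c) = \<zero>\<^bsub>chain C (n - 1 - 1)\<^esub>))"

definition chain_map :: "('k, 'm) ring_scheme \<Rightarrow> ('k, 'c) chain_complex \<Rightarrow> ('k, 'd) chain_complex \<Rightarrow> (int \<Rightarrow> 'c \<Rightarrow> 'd) \<Rightarrow> bool" where
  "chain_map K C D f \<longleftrightarrow> (\<forall>n. linear_map K (chain C n) (chain D n) (f n) \<and>
     (\<forall>c\<in>carrier (chain C n). f (n - 1) (bdry C n c) = bdry D n (f n c)))"

definition bdry_rank :: "('k, 'm) ring_scheme \<Rightarrow> ('k, 'c) chain_complex \<Rightarrow> int \<Rightarrow> nat" where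
  "bdry_rank K C n = sdim K (chain C (n - 1)) (bdry C n ` carrier (chain C n))"

definition map_kernel :: "('k, 'c) chain_complex \<Rightarrow> ('k, 'd) chain_complex \<Rightarrow> (int \<Rightarrow> 'c \<Rightarrow> 'd) \<Rightarrow> int \<Rightarrow> 'c set" where
  "map_kernel C D f n = {c \<in> carrier (chain C n). f n c = \<zero>\<^bsub>chain D n\<^esub>}"

lemma fd_complexD:
  assumes "fd_complex K C"
  shows "vectorspace.fin_dim K (chain C n)" "linear_map K (chain C n) (chain C (n - 1)) (bdry C n)"
    "vectorspace K (chain C n)"
    "c \<in> carrier (chain C n) \<Longrightarrow> bdry C (n - 1) (bdry C n c) = \<zero>\<^bsub>chain C (n - 1 - 1)\<^esub>"
  using assms linear_mapD(1) unfolding fd_complex_def by blast+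

lemma chain_mapD:
  assumes "chain_map K C D f"
  shows "linear_map K (chain C n) (chain D n) (f n)"
    "c \<in> carrier (chain C n) \<Longrightarrow> f (n - 1) (bdry C n c) = bdry D n (f n c)"
  using assms unfolding chain_map_def by blast+

lemma map_kernel_subspace:
  assumes f: "chain_map K C D f"
  shows "subspace K (map_kernel C D f n) (chain C n)"
  unfolding map_kernel_def
  by (rule subspace_kernel[OF chain_mapD(1)[OF f] subspace_carrier[OF linear_mapD(1)[OF chain_mapD(1)[OF f]]]])

lemma bdry_image_subspace:
  assumes "fd_complex K C"
  shows "subspace K (bdry C n ` carrier (chain C n)) (chain C (n - 1))"
  by (rule subspace_image[OF fd_complexD(2)[OF assms] subspace_carrier[OF fd_complexD(3)[OF assms]]])

text \<open>Rank and nullity for \<open>\<partial>\<^sub>n\<close>, followed by division of its kernel by the image of \<open>\<partial>\<^sub>n\<^sub>+\<^sub>1\<close>.\<close>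

lemma homology_dim:
  assumes C: "fd_complex K C"
  shows "vectorspace.dim K (homology C n) + bdry_rank K C n + bdry_rank K C (n + 1) = vectorspace.dim K (chain C n)"
proof -
  note c = fd_complexD[OF C]
  let ?Z = "{x \<in> carrier (chain C n). bdry C n x = \<zero>\<^bsub>chain C (n - 1)\<^esub>}"
  let ?B = "bdry C (n + 1) ` carrier (chain C (n + 1))"
  have Zeq: "a_kernel (chain C n) (chain C (n - 1)) (bdry C n) = ?Z" unfolding a_kernel_def' ..
  have Z: "subspace K ?Z (chain C n)" by (rule subspace_kernel[OF c(2) subspace_carrier[OF c(3)]])
  have B: "subspace K ?B (chain C n)" using bdry_image_subspace[OF C, of "n + 1"] by simp
  have BZ: "?B \<subseteq> ?Z"
    using c(4)[of _ "n + 1"] subspaceD(2)[OF B] by auto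
  have BZ': "subspace K ?B (chain C n\<lparr>carrier := ?Z\<rparr>)"
    by (rule subspaceI[OF subspaceD(6)[OF Z]]) (use BZ subspaceD[OF B] in auto)
  have "vectorspace.dim K (chain C n\<lparr>carrier := ?Z\<rparr>) = vectorspace.dim K (homology C n) + sdim K (chain C n) ?B"
    using quot_space_dim[OF BZ' fin_dim_subspace[OF c(1) Z]] unfolding homology_def Zeq by simp
  moreover have "vectorspace.dim K (chain C n) = bdry_rank K C n + sdim K (chain C n) ?Z"
    unfolding bdry_rank_def by (rule rank_nullity_carrier[OF c(2) c(1)])
  moreover have "bdry_rank K C (n + 1) = sdim K (chain C n) ?B" unfolding bdry_rank_def by simp
  ultimately show ?thesis by simp
qed

text \<open>The target degree \<open>n - 2\<close> is written as \<open>n - 1 - 1\<close>, the form in which two successive differentials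
  produce it.\<close>

lemma mapping_cone_simps:
  "chain (mapping_cone C D f) n = direct_sum (chain C (n - 1)) (chain D n)"
  "bdry (mapping_cone C D f) n (c, d) =
     (\<ominus>\<^bsub>chain C (n - 1 - 1)\<^esub> bdry C (n - 1) c, bdry D n d \<ominus>\<^bsub>chain D (n - 1)\<^esub> f (n - 1) c)"
  unfolding mapping_cone_def by simp_all

lemma fd_complex_mapping_cone:
  assumes C: "fd_complex K C" and D: "fd_complex K D" and f: "chain_map K C D f"
  shows "fd_complex K (mapping_cone C D f)"
  unfolding fd_complex_def
proof (intro allI conjI ballI)
  fix n
  note c = fd_complexD[OF C] and d = fd_complexD[OF D] and F = chain_mapD[OF f]
  note cl = linear_mapD[OF c(2)] and dl = linear_mapD[OF d(2)] and fl = linear_mapD[OF F(1)]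
  let ?M = "mapping_cone C D f"
  have vs: "vectorspace K (chain ?M n)" for n
    unfolding mapping_cone_simps by (rule direct_sum_is_vs[OF c(3) d(3)])
  show "vectorspace.fin_dim K (chain ?M n)"
    unfolding mapping_cone_simps by (rule direct_sum_dim(1)[OF c(3) d(3) c(1) d(1)])
  note maps = direct_sum_maps[OF c(3) d(3)]
  interpret C2: vectorspace K "chain C (n - 1 - 1)" by (rule c(3))
  interpret C3: vectorspace K "chain C (n - 1 - 1 - 1)" by (rule c(3))
  interpret D1: vectorspace K "chain D (n - 1)" by (rule d(3))
  interpret D2: vectorspace K "chain D (n - 1 - 1)" by (rule d(3))
  interpret C2': vectorspace K "chain C (n - 2)" by (rule c(3))
  interpret C3': vectorspace K "chain C (n - 3)" by (rule c(3))
  interpret D2': vectorspace K "chain D (n - 2)" by (rule d(3))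
  show "linear_map K (chain ?M n) (chain ?M (n - 1)) (bdry ?M n)"
  proof (rule linear_mapI[OF vs vs])
    fix p assume "p \<in> carrier (chain ?M n)"
    then obtain x y where p: "p = (x, y)" "x \<in> carrier (chain C (n - 1))" "y \<in> carrier (chain D n)"
      unfolding mapping_cone_simps by auto
    show "bdry ?M n p \<in> carrier (chain ?M (n - 1))"
      unfolding p(1) mapping_cone_simps using cl(3)[OF p(2)] dl(3)[OF p(3)] fl(3)[OF p(2)] by simp
    fix a assume a: "a \<in> carrier K"
    show "bdry ?M n (a \<odot>\<^bsub>chain ?M n\<^esub> p) = a \<odot>\<^bsub>chain ?M (n - 1)\<^esub> bdry ?M n p"
      unfolding p(1) mapping_cone_simps direct_sum_simps cl(5)[OF a p(2)] dl(5)[OF a p(3)] fl(5)[OF a p(2)]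
      using cl(3)[OF p(2)] dl(3)[OF p(3)] fl(3)[OF p(2)] a
      by (simp add: C2'.smult_r_minus a_minus_def D1.smult_r_distr D1.smult_r_minus)
  next
    fix p q assume "p \<in> carrier (chain ?M n)" "q \<in> carrier (chain ?M n)"
    then obtain x y x' y' where p: "p = (x, y)" "x \<in> carrier (chain C (n - 1))" "y \<in> carrier (chain D n)"
      and q: "q = (x', y')" "x' \<in> carrier (chain C (n - 1))" "y' \<in> carrier (chain D n)"
      unfolding mapping_cone_simps by auto
    show "bdry ?M n (p \<oplus>\<^bsub>chain ?M n\<^esub> q) = bdry ?M n p \<oplus>\<^bsub>chain ?M (n - 1)\<^esub> bdry ?M n q"
      unfolding p(1) q(1) mapping_cone_simps direct_sum_simps cl(4)[OF p(2) q(2)] dl(4)[OF p(3) q(3)] fl(4)[OF p(2) q(2)]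
      using cl(3)[OF p(2)] dl(3)[OF p(3)] fl(3)[OF p(2)] cl(3)[OF q(2)] dl(3)[OF q(3)] fl(3)[OF q(2)]
      by (simp add: C2'.M.minus_add a_minus_def D1.M.minus_add D1.M.a_ac)
  qed
  fix p assume "p \<in> carrier (chain ?M n)"
  then obtain x y where p: "p = (x, y)" "x \<in> carrier (chain C (n - 1))" "y \<in> carrier (chain D n)"
    unfolding mapping_cone_simps by auto
  have 1: "bdry C (n - 1 - 1) (\<ominus>\<^bsub>chain C (n - 1 - 1)\<^esub> bdry C (n - 1) x) = \<zero>\<^bsub>chain C (n - 1 - 1 - 1)\<^esub>"
    unfolding cl(7)[OF cl(3)[OF p(2)]] c(4)[OF p(2)] by (rule vectorspace_neg_zero[OF c(3)])
  have "bdry D (n - 1) (bdry D n y \<ominus>\<^bsub>chain D (n - 1)\<^esub> f (n - 1) x) = \<ominus>\<^bsub>chain D (n - 1 - 1)\<^esub> f (n - 1 - 1) (bdry C (n - 1) x)"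
    unfolding dl(8)[OF dl(3)[OF p(3)] fl(3)[OF p(2)]] d(4)[OF p(3)] F(2)[OF p(2)]
    using dl(3)[OF fl(3)[OF p(2)]] by (simp add: a_minus_def)
  also have "\<dots> = f (n - 1 - 1) (\<ominus>\<^bsub>chain C (n - 1 - 1)\<^esub> bdry C (n - 1) x)"
    by (rule fl(7)[OF cl(3)[OF p(2)], symmetric])
  finally have 2: "bdry D (n - 1) (bdry D n y \<ominus>\<^bsub>chain D (n - 1)\<^esub> f (n - 1) x)
      = f (n - 1 - 1) (\<ominus>\<^bsub>chain C (n - 1 - 1)\<^esub> bdry C (n - 1) x)" .
  have 3: "f (n - 1 - 1) (\<ominus>\<^bsub>chain C (n - 1 - 1)\<^esub> bdry C (n - 1) x) \<in> carrier (chain D (n - 1 - 1))"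
    by (rule fl(3)[OF C2.M.a_inv_closed[OF cl(3)[OF p(2)]]])
  show "bdry ?M (n - 1) (bdry ?M n p) = \<zero>\<^bsub>chain ?M (n - 1 - 1)\<^esub>"
    unfolding p(1) mapping_cone_simps 1 2 direct_sum_simps using 3 vectorspace_neg_zero[OF c(3)] by simp
qed

text \<open>Project the image of the differential of the cone to \<open>D\<^sub>n\<^sub>-\<^sub>1\<close>. This is onto, already through \<open>f\<close>. If
  \<open>(-\<partial>x, \<partial>y - f x)\<close> projects to zero, write \<open>y = f z\<close>; then \<open>\<partial>z - x\<close> lies in the kernel of \<open>f\<close> and has
  boundary \<open>-\<partial>x\<close>. So the kernel of the projection is \<open>\<partial>(ker f\<^sub>n\<^sub>-\<^sub>1)\<close>.\<close>

lemma bdry_rank_cone: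
  assumes C: "fd_complex K C" and D: "fd_complex K D" and f: "chain_map K C D f"
    and surj: "\<And>n. f n ` carrier (chain C n) = carrier (chain D n)"
  shows "bdry_rank K (mapping_cone C D f) n =
    vectorspace.dim K (chain D (n - 1)) + sdim K (chain C (n - 1 - 1)) (bdry C (n - 1) ` map_kernel C D f (n - 1))"
proof -
  note c = fd_complexD[OF C] and d = fd_complexD[OF D] and F = chain_mapD[OF f]
  note cl = linear_mapD[OF c(2)] and dl = linear_mapD[OF d(2)] and fl = linear_mapD[OF F(1)]
  let ?M = "mapping_cone C D f" and ?C2 = "chain C (n - 1 - 1)" and ?D1 = "chain D (n - 1)"
  note M = fd_complexD[OF fd_complex_mapping_cone[OF C D f]]
  interpret C1: vectorspace K "chain C (n - 1)" by (rule c(3))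
  interpret C2: vectorspace K ?C2 by (rule c(3))
  interpret C2': vectorspace K "chain C (n - 2)" by (rule c(3))
  interpret D0: vectorspace K "chain D n" by (rule d(3))
  interpret D1: vectorspace K ?D1 by (rule d(3))
  note maps = direct_sum_maps[OF c(3)[of "n - 1 - 1"] d(3)[of "n - 1"]]
  let ?I = "bdry ?M n ` carrier (chain ?M n)" and ?N = "bdry C (n - 1) ` map_kernel C D f (n - 1)"
  have I: "subspace K ?I (direct_sum ?C2 ?D1)"
    using bdry_image_subspace[OF fd_complex_mapping_cone[OF C D f], of n] by (simp only: mapping_cone_simps)
  have finM: "vectorspace.fin_dim K (direct_sum ?C2 ?D1)" by (rule direct_sum_dim(1)[OF c(3) d(3) c(1) d(1)])
  have val: "(\<ominus>\<^bsub>?C2\<^esub> bdry C (n - 1) x, bdry D n y \<ominus>\<^bsub>?D1\<^esub> f (n - 1) x) \<in> ?I"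
    if "x \<in> carrier (chain C (n - 1))" "y \<in> carrier (chain D n)" for x y
    using imageI[of "(x, y)" "carrier (chain ?M n)" "bdry ?M n"] that by (simp add: mapping_cone_simps)
  have I_cases: "\<exists>x\<in>carrier (chain C (n - 1)). \<exists>y\<in>carrier (chain D n).
      p = (\<ominus>\<^bsub>?C2\<^esub> bdry C (n - 1) x, bdry D n y \<ominus>\<^bsub>?D1\<^esub> f (n - 1) x)" if "p \<in> ?I" for p
    using that by (force simp: mapping_cone_simps)
  have sndI: "snd ` ?I = carrier ?D1"
  proof (intro subset_antisym subsetI)
    fix z assume "z \<in> snd ` ?I"
    thus "z \<in> carrier ?D1" using subspaceD(2)[OF I] by auto
  next
    fix z assume z: "z \<in> carrier ?D1"
    hence "\<ominus>\<^bsub>?D1\<^esub> z \<in> f (n - 1) ` carrier (chain C (n - 1))" unfolding surj by simp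
    then obtain x where x: "x \<in> carrier (chain C (n - 1))" "f (n - 1) x = \<ominus>\<^bsub>?D1\<^esub> z" by force
    from imageI[OF val[OF x(1) D0.M.zero_closed], of snd] show "z \<in> snd ` ?I"
      using x(2) z dl(6) by (simp add: a_minus_def)
  qed
  have kerI: "{p \<in> ?I. snd p = \<zero>\<^bsub>?D1\<^esub>} = (\<lambda>u. (u, \<zero>\<^bsub>?D1\<^esub>)) ` ?N"
  proof (intro subset_antisym subsetI)
    fix p assume "p \<in> {p \<in> ?I. snd p = \<zero>\<^bsub>?D1\<^esub>}"
    hence pI: "p \<in> ?I" and sp: "snd p = \<zero>\<^bsub>?D1\<^esub>" by (simp_all only: mem_Collect_eq)
    from I_cases[OF pI] obtain x y where x: "x \<in> carrier (chain C (n - 1))" and y: "y \<in> carrier (chain D n)"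
      and p0: "p = (\<ominus>\<^bsub>?C2\<^esub> bdry C (n - 1) x, bdry D n y \<ominus>\<^bsub>?D1\<^esub> f (n - 1) x)" by (elim bexE)
    have eq: "bdry D n y \<ominus>\<^bsub>?D1\<^esub> f (n - 1) x = \<zero>\<^bsub>?D1\<^esub>" using sp unfolding p0 snd_conv .
    have p: "p = (\<ominus>\<^bsub>?C2\<^esub> bdry C (n - 1) x, \<zero>\<^bsub>?D1\<^esub>)" unfolding p0 eq ..
    have eq': "bdry D n y = f (n - 1) x" using eq dl(3)[OF y] fl(3)[OF x] by simp
    from y obtain z where z: "z \<in> carrier (chain C n)" "f n z = y" unfolding surj[symmetric] by blast
    let ?w = "bdry C n z \<ominus>\<^bsub>chain C (n - 1)\<^esub> x"
    note bz = cl(3)[OF z(1)]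
    have w: "?w \<in> carrier (chain C (n - 1))" using bz x by simp
    have "f (n - 1) ?w = \<zero>\<^bsub>?D1\<^esub>"
      using fl(8)[OF bz x] F(2)[OF z(1)] z(2) eq' fl(3)[OF x] by simp
    hence wk: "?w \<in> map_kernel C D f (n - 1)" using w unfolding map_kernel_def by blast
    have "bdry C (n - 1) ?w = \<ominus>\<^bsub>?C2\<^esub> bdry C (n - 1) x"
      using cl(8)[OF bz x] c(4)[OF z(1)] cl(3)[OF x] by (simp add: a_minus_def)
    with imageI[OF wk] show "p \<in> (\<lambda>u. (u, \<zero>\<^bsub>?D1\<^esub>)) ` ?N" unfolding p by (metis imageI)
  next
    fix p assume "p \<in> (\<lambda>u. (u, \<zero>\<^bsub>?D1\<^esub>)) ` ?N"
    then obtain x where xk: "x \<in> map_kernel C D f (n - 1)" and p: "p = (bdry C (n - 1) x, \<zero>\<^bsub>?D1\<^esub>)"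
      by (elim imageE) simp
    from xk have x: "x \<in> carrier (chain C (n - 1))" "f (n - 1) x = \<zero>\<^bsub>?D1\<^esub>"
      unfolding map_kernel_def by simp_all
    have "\<ominus>\<^bsub>chain C (n - 1)\<^esub> x \<in> carrier (chain C (n - 1))" using x by simp
    from val[OF this D0.M.zero_closed] have "p \<in> ?I"
      using x cl(3)[OF x(1)] cl(7)[OF x(1)] fl(7)[OF x(1)] dl(6) vectorspace_neg_zero[OF d(3)] unfolding p by (simp add: a_minus_def)
    thus "p \<in> {p \<in> ?I. snd p = \<zero>\<^bsub>?D1\<^esub>}" unfolding p by simp
  qed
  have N: "subspace K ?N ?C2" by (rule subspace_image[OF c(2) map_kernel_subspace[OF f]])
  have "sdim K (direct_sum ?C2 ?D1) ((\<lambda>u. (u, \<zero>\<^bsub>?D1\<^esub>)) ` ?N) = sdim K ?C2 ?N"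
    by (rule sdim_image_inj[OF maps(3) c(1) N]) simp
  moreover have "bdry_rank K ?M n = sdim K (direct_sum ?C2 ?D1) ?I"
    unfolding bdry_rank_def mapping_cone_simps(1)[of C D f "n - 1"] ..
  ultimately show ?thesis
    using rank_nullity_on[OF maps(2) finM I, unfolded sndI kerI] by simp
qed

text \<open>The cone of a surjection has the homology of the kernel complex, shifted by one; this is the
  resulting dimension formula in degree \<open>n - 1\<close> of the kernel.\<close>

lemma homology_cone_dim:
  assumes C: "fd_complex K C" and D: "fd_complex K D" and f: "chain_map K C D f"
    and surj: "\<And>n. f n ` carrier (chain C n) = carrier (chain D n)"
  shows "vectorspace.dim K (homology (mapping_cone C D f) n)
      + sdim K (chain C (n - 1 - 1)) (bdry C (n - 1) ` map_kernel C D f (n - 1))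
      + sdim K (chain C (n - 1)) (bdry C n ` map_kernel C D f n)
    = sdim K (chain C (n - 1)) (map_kernel C D f (n - 1))"
proof -
  note c = fd_complexD[OF C] and d = fd_complexD[OF D]
  have "vectorspace.dim K (chain C (n - 1)) = vectorspace.dim K (chain D (n - 1)) + sdim K (chain C (n - 1)) (map_kernel C D f (n - 1))"
    using rank_nullity_carrier[OF chain_mapD(1)[OF f] c(1), of "n - 1"] unfolding surj map_kernel_def by simp
  moreover have "vectorspace.dim K (chain (mapping_cone C D f) n) = vectorspace.dim K (chain C (n - 1)) + vectorspace.dim K (chain D n)"
    unfolding mapping_cone_simps by (rule direct_sum_dim(2)[OF c(3) d(3) c(1) d(1)])
  ultimately show ?thesis
    using homology_dim[OF fd_complex_mapping_cone[OF C D f], of n] bdry_rank_cone[OF C D f surj, of n]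
      bdry_rank_cone[OF C D f surj, of "n + 1"] by simp
qed

text \<open>The section splits the complex as \<open>C = ker f \<oplus> s D\<close>, compatibly with the differentials.\<close>

lemma bdry_rank_split:
  assumes C: "fd_complex K C" and f: "chain_map K C D f" and s: "chain_map K D C s"
    and fs: "\<And>n d. d \<in> carrier (chain D n) \<Longrightarrow> f n (s n d) = d"
  shows "bdry_rank K C n = sdim K (chain C (n - 1)) (bdry C n ` map_kernel C D f n) + bdry_rank K D n"
proof -
  note c = fd_complexD[OF C] and F = chain_mapD[OF f] and S = chain_mapD[OF s]
  note cl = linear_mapD[OF c(2)] and fl = linear_mapD[OF F(1)] and sl = linear_mapD[OF S(1)]
  interpret C0: vectorspace K "chain C n" by (rule c(3))
  interpret C1: vectorspace K "chain C (n - 1)" by (rule c(3))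
  interpret D0: vectorspace K "chain D n" by (rule fl(2))
  let ?I = "bdry C n ` carrier (chain C n)"
  have 1: "f (n - 1) ` ?I = bdry D n ` carrier (chain D n)"
  proof (intro subset_antisym subsetI)
    fix u assume "u \<in> f (n - 1) ` ?I"
    then obtain x where "x \<in> carrier (chain C n)" "u = f (n - 1) (bdry C n x)" by blast
    thus "u \<in> bdry D n ` carrier (chain D n)" using F(2) fl(3) by (metis imageI)
  next
    fix u assume "u \<in> bdry D n ` carrier (chain D n)"
    then obtain y where y: "y \<in> carrier (chain D n)" "u = bdry D n y" by blast
    hence "u = f (n - 1) (bdry C n (s n y))" using F(2)[OF sl(3)[OF y(1)]] fs[OF y(1)] by simp
    thus "u \<in> f (n - 1) ` ?I" using sl(3)[OF y(1)] by blast
  qed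
  have 2: "{u \<in> ?I. f (n - 1) u = \<zero>\<^bsub>chain D (n - 1)\<^esub>} = bdry C n ` map_kernel C D f n"
  proof (intro subset_antisym subsetI)
    fix u assume "u \<in> {u \<in> ?I. f (n - 1) u = \<zero>\<^bsub>chain D (n - 1)\<^esub>}"
    then obtain x where x: "x \<in> carrier (chain C n)" "u = bdry C n x" "f (n - 1) (bdry C n x) = \<zero>\<^bsub>chain D (n - 1)\<^esub>"
      by blast
    let ?y = "s n (f n x)"
    have y: "?y \<in> carrier (chain C n)" by (rule sl(3)[OF fl(3)[OF x(1)]])
    have "bdry C n ?y = s (n - 1) (bdry D n (f n x))" by (rule S(2)[OF fl(3)[OF x(1)], symmetric])
    also have "\<dots> = \<zero>\<^bsub>chain C (n - 1)\<^esub>" using x(3) sl(6) unfolding F(2)[OF x(1)] by simp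
    finally have "bdry C n (x \<ominus>\<^bsub>chain C n\<^esub> ?y) = u"
      using cl(8)[OF x(1) y] cl(3)[OF x(1)] vectorspace_neg_zero[OF c(3)] unfolding x(2) by (simp add: a_minus_def)
    moreover have "x \<ominus>\<^bsub>chain C n\<^esub> ?y \<in> map_kernel C D f n"
      unfolding map_kernel_def using x(1) y fl(8)[OF x(1) y] fs[OF fl(3)[OF x(1)]] fl(3)[OF x(1)] by simp
    ultimately show "u \<in> bdry C n ` map_kernel C D f n" by blast
  next
    fix u assume "u \<in> bdry C n ` map_kernel C D f n"
    then obtain x where x: "x \<in> carrier (chain C n)" "f n x = \<zero>\<^bsub>chain D n\<^esub>" "u = bdry C n x"
      unfolding map_kernel_def by blast
    have "bdry D n \<zero>\<^bsub>chain D n\<^esub> = f (n - 1) (bdry C n (s n \<zero>\<^bsub>chain D n\<^esub>))"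
      using F(2)[OF sl(3)[OF D0.M.zero_closed]] fs[OF D0.M.zero_closed] by simp
    also have "\<dots> = \<zero>\<^bsub>chain D (n - 1)\<^esub>" using sl(6) cl(6) fl(6) by simp
    finally show "u \<in> {u \<in> ?I. f (n - 1) u = \<zero>\<^bsub>chain D (n - 1)\<^esub>}" using F(2)[OF x(1)] x by simp
  qed
  show ?thesis
    using rank_nullity_on[OF F(1) c(1) bdry_image_subspace[OF C], of n] unfolding 1 2 bdry_rank_def by simp
qed

lemma chain_retraction_surj:
  assumes f: "chain_map K C D f" and s: "chain_map K D C s"
    and fs: "\<And>n d. d \<in> carrier (chain D n) \<Longrightarrow> f n (s n d) = d"
  shows "f n ` carrier (chain C n) = carrier (chain D n)"
proof (intro subset_antisym subsetI)
  fix y assume y: "y \<in> carrier (chain D n)"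
  show "y \<in> f n ` carrier (chain C n)"
    using fs[OF y] linear_mapD(3)[OF chain_mapD(1)[OF s] y] by (metis imageI)
qed (use linear_mapD(3)[OF chain_mapD(1)[OF f]] in blast)

text \<open>By \<open>bdry_rank_split\<close>, the homology of \<open>C\<close> is that of the kernel of \<open>f\<close> plus that of \<open>D\<close>, while the
  cone sees the kernel alone.\<close>

lemma homology_split_cone_dim:
  assumes C: "fd_complex K C" and D: "fd_complex K D" and f: "chain_map K C D f" and s: "chain_map K D C s"
    and fs: "\<And>n d. d \<in> carrier (chain D n) \<Longrightarrow> f n (s n d) = d"
  shows "vectorspace.dim K (homology (mapping_cone C D f) n) + vectorspace.dim K (homology D (n - 1))
    = vectorspace.dim K (homology C (n - 1))"
proof -
  have surj: "f m ` carrier (chain C m) = carrier (chain D m)" for m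
    by (rule chain_retraction_surj[OF f s]) (rule fs)
  have "vectorspace.dim K (chain C (n - 1)) = vectorspace.dim K (chain D (n - 1)) + sdim K (chain C (n - 1)) (map_kernel C D f (n - 1))"
    using rank_nullity_carrier[OF chain_mapD(1)[OF f] fd_complexD(1)[OF C], of "n - 1"] unfolding surj map_kernel_def by simp
  thus ?thesis
    using homology_cone_dim[OF C D f surj, of n] homology_dim[OF C, of "n - 1"] homology_dim[OF D, of "n - 1"]
      bdry_rank_split[OF C f s fs, of n] bdry_rank_split[OF C f s fs, of "n - 1"] by simp
qed

text \<open>Apply \<open>bdry_rank_split\<close> to a section that is a two-sided inverse: the kernels are zero.\<close>

lemma homology_iso_dim:
  assumes C: "fd_complex K C" and D: "fd_complex K D" and f: "chain_map K C D f" and s: "chain_map K D C s"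
    and fs: "\<And>n d. d \<in> carrier (chain D n) \<Longrightarrow> f n (s n d) = d"
    and sf: "\<And>n c. c \<in> carrier (chain C n) \<Longrightarrow> s n (f n c) = c"
  shows "vectorspace.dim K (homology C n) = vectorspace.dim K (homology D n)"
proof -
  have ker: "map_kernel C D f m = {\<zero>\<^bsub>chain C m\<^esub>}" for m
  proof (intro subset_antisym subsetI)
    fix x assume "x \<in> map_kernel C D f m"
    hence "x \<in> carrier (chain C m)" "f m x = \<zero>\<^bsub>chain D m\<^esub>" unfolding map_kernel_def by auto
    thus "x \<in> {\<zero>\<^bsub>chain C m\<^esub>}" using sf[of x m] linear_mapD(6)[OF chain_mapD(1)[OF s]] by simp
  qed (use subspaceD(3)[OF map_kernel_subspace[OF f]] in simp)
  have z: "sdim K (chain C m) {\<zero>\<^bsub>chain C m\<^esub>} = 0" for m by (rule sdim_zero[OF fd_complexD(3)[OF C]])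
  have "bdry C m ` {\<zero>\<^bsub>chain C m\<^esub>} = {\<zero>\<^bsub>chain C (m - 1)\<^esub>}" for m
    using linear_mapD(6)[OF fd_complexD(2)[OF C]] by simp
  hence r: "bdry_rank K C m = bdry_rank K D m" for m using bdry_rank_split[OF C f s fs, of m] z unfolding ker by simp
  have surj: "f m ` carrier (chain C m) = carrier (chain D m)" for m
    by (rule chain_retraction_surj[OF f s]) (rule fs)
  have "vectorspace.dim K (chain C n) = vectorspace.dim K (chain D n)"
    using rank_nullity_carrier[OF chain_mapD(1)[OF f] fd_complexD(1)[OF C], of n] z[of n]
    unfolding surj map_kernel_def[symmetric] ker by simp
  thus ?thesis using homology_dim[OF C, of n] homology_dim[OF D, of n] r by simp
qed

lemma chain_map_cone:
  assumes C: "fd_complex K C" and D: "fd_complex K D" and f: "chain_map K C D f"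
    and C': "fd_complex K C'" and D': "fd_complex K D'" and f': "chain_map K C' D' f'"
    and a: "chain_map K C C' a" and b: "chain_map K D D' b"
    and eq: "\<And>n c. c \<in> carrier (chain C n) \<Longrightarrow> b n (f n c) = f' n (a n c)"
  shows "chain_map K (mapping_cone C D f) (mapping_cone C' D' f') (\<lambda>n. map_prod (a (n - 1)) (b n))"
  unfolding chain_map_def
proof (intro allI conjI ballI)
  fix n
  note al = linear_mapD[OF chain_mapD(1)[OF a]] and bl = linear_mapD[OF chain_mapD(1)[OF b]] and fl = linear_mapD[OF chain_mapD(1)[OF f]]
  note cl = linear_mapD[OF fd_complexD(2)[OF C]] and dl = linear_mapD[OF fd_complexD(2)[OF D]]
  show "linear_map K (chain (mapping_cone C D f) n) (chain (mapping_cone C' D' f') n) (map_prod (a (n - 1)) (b n))"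
    by (rule linear_mapI[OF fd_complexD(3)[OF fd_complex_mapping_cone[OF C D f]] fd_complexD(3)[OF fd_complex_mapping_cone[OF C' D' f']]])
      (auto simp: mapping_cone_simps al(3-5) bl(3-5))
  fix p assume "p \<in> carrier (chain (mapping_cone C D f) n)"
  then obtain x y where p: "p = (x, y)" "x \<in> carrier (chain C (n - 1))" "y \<in> carrier (chain D n)"
    unfolding mapping_cone_simps by auto
  have 1: "a (n - 1 - 1) (\<ominus>\<^bsub>chain C (n - 1 - 1)\<^esub> bdry C (n - 1) x) = \<ominus>\<^bsub>chain C' (n - 1 - 1)\<^esub> bdry C' (n - 1) (a (n - 1) x)"
    unfolding al(7)[OF cl(3)[OF p(2)]] chain_mapD(2)[OF a p(2)] ..
  have 2: "b (n - 1) (bdry D n y \<ominus>\<^bsub>chain D (n - 1)\<^esub> f (n - 1) x) = bdry D' n (b n y) \<ominus>\<^bsub>chain D' (n - 1)\<^esub> f' (n - 1) (a (n - 1) x)"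
    unfolding bl(8)[OF dl(3)[OF p(3)] fl(3)[OF p(2)]] chain_mapD(2)[OF b p(3)] eq[OF p(2)] ..
  show "map_prod (a (n - 1 - 1)) (b (n - 1)) (bdry (mapping_cone C D f) n p)
      = bdry (mapping_cone C' D' f') n (map_prod (a (n - 1)) (b n) p)"
    unfolding p(1) map_prod_simp mapping_cone_simps 1 2 ..
qed

section \<open>The Chevalley-Eilenberg complex\<close>

lemma bracket_antisym:
  assumes L: "lie_algebra K L" and x: "x \<in> carrier L" and y: "y \<in> carrier L"
  shows "lie_bracket L x y = \<ominus>\<^bsub>L\<^esub> lie_bracket L y x"
proof -
  interpret lie_algebra K L by fact
  note c = bracket_closed[OF x y] bracket_closed[OF y x]
  have "\<zero>\<^bsub>L\<^esub> = lie_bracket L (x \<oplus>\<^bsub>L\<^esub> y) (x \<oplus>\<^bsub>L\<^esub> y)" by (rule bracket_self[symmetric]) (simp add: x y)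
  also have "\<dots> = lie_bracket L x y \<oplus>\<^bsub>L\<^esub> lie_bracket L y x"
    using x y c by (simp add: bracket_add_left bracket_add_right bracket_self[OF x] bracket_self[OF y] M.a_comm)
  finally show ?thesis using M.minus_equality[OF _ c(2) c(1)] by simp
qed

lemma jacobi_derivation:
  assumes L: "lie_algebra K L" and x: "x \<in> carrier L" and y: "y \<in> carrier L" and z: "z \<in> carrier L"
  shows "lie_bracket L x (lie_bracket L y z) = lie_bracket L (lie_bracket L x y) z \<oplus>\<^bsub>L\<^esub> lie_bracket L y (lie_bracket L x z)"
proof -
  interpret lie_algebra K L by fact
  let ?a = "lie_bracket L x (lie_bracket L y z)" and ?b = "lie_bracket L (lie_bracket L x y) z" and ?c = "lie_bracket L y (lie_bracket L x z)"
  note cl = bracket_closed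
  have c: "?a \<in> carrier L" "?b \<in> carrier L" "?c \<in> carrier L" using x y z by (simp_all add: cl)
  have 1: "lie_bracket L y (lie_bracket L z x) = \<ominus>\<^bsub>L\<^esub> ?c"
    unfolding bracket_antisym[OF L z x] by (rule linear_mapD(7)[OF bracket_linear_right[OF L y] cl[OF x z]])
  have 2: "lie_bracket L z (lie_bracket L x y) = \<ominus>\<^bsub>L\<^esub> ?b" by (rule bracket_antisym[OF L z cl[OF x y]])
  have "?a \<oplus>\<^bsub>L\<^esub> \<ominus>\<^bsub>L\<^esub> ?c \<oplus>\<^bsub>L\<^esub> \<ominus>\<^bsub>L\<^esub> ?b = \<zero>\<^bsub>L\<^esub>" using jacobi[OF x y z] unfolding 1 2 .
  hence "?a \<ominus>\<^bsub>L\<^esub> (?b \<oplus>\<^bsub>L\<^esub> ?c) = \<zero>\<^bsub>L\<^esub>" using c by (simp add: a_minus_def M.minus_add M.a_ac)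
  thus ?thesis using c by simp
qed

text \<open>\<open>L\<close> acts on its exterior powers: \<open>[\<theta>\<^sub>x, \<theta>\<^sub>y] = \<theta>\<^bsub>[x,y]\<^esub>\<close>. Both sides are derivations, and in degree 1
  the identity is Jacobi's.\<close>

lemma lie_der_bracket:
  assumes L: "lie_algebra K L" and x: "x \<in> carrier L" and y: "y \<in> carrier L" and t: "t \<in> carrier (ext_pow K L k)"
  shows "lie_der K L k x (lie_der K L k y t)
    = lie_der K L k (lie_bracket L x y) t \<oplus>\<^bsub>ext_pow K L k\<^esub> lie_der K L k y (lie_der K L k x t)"
proof -
  interpret lie_algebra K L by fact
  note V = vectorspace_axioms and D = lie_der_linear[OF L] and b = bracket_closed[OF x y]
  show ?thesis
  proof (rule ext_pow_induct_eq[where W = "ext_pow K L", OF V linear_map_comp[OF D[OF y] D[OF x]]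
        linear_map_add[OF D[OF b] linear_map_comp[OF D[OF x] D[OF y]]] _ _ t])
    interpret E0: vectorspace K "ext_pow K L 0" by (rule ext_pow_vectorspace[OF V])
    show "lie_der K L 0 x (lie_der K L 0 y (wedge K L [])) = lie_der K L 0 (lie_bracket L x y) (wedge K L [])
        \<oplus>\<^bsub>ext_pow K L 0\<^esub> lie_der K L 0 y (lie_der K L 0 x (wedge K L []))"
      by (simp add: lie_der_nil[OF L] x y b linear_mapD(6)[OF D])
    fix k z u
    assume z: "z \<in> carrier L" and u: "u \<in> carrier (ext_pow K L (k - 1))"
      and IH: "lie_der K L (k - 1) x (lie_der K L (k - 1) y u)
        = lie_der K L (k - 1) (lie_bracket L x y) u \<oplus>\<^bsub>ext_pow K L (k - 1)\<^esub> lie_der K L (k - 1) y (lie_der K L (k - 1) x u)"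
    let ?E = "ext_pow K L k"
    interpret E: vectorspace K ?E by (rule ext_pow_vectorspace[OF V])
    note lw = linear_mapD[OF lwedge_linear[OF V, where k = k]] and vl = linear_mapD[OF lwedge_vector_linear[OF V u]]
    note d = linear_mapD(3)[OF D[where k = "k - 1"]] and dk = linear_mapD[OF D[where k = k]]
    have two: "lie_der K L k p (lie_der K L k q (lwedge K L k z u))
      = (lwedge K L k (lie_bracket L p (lie_bracket L q z)) u \<oplus>\<^bsub>?E\<^esub> lwedge K L k (lie_bracket L q z) (lie_der K L (k - 1) p u))
        \<oplus>\<^bsub>?E\<^esub> (lwedge K L k (lie_bracket L p z) (lie_der K L (k - 1) q u) \<oplus>\<^bsub>?E\<^esub> lwedge K L k z (lie_der K L (k - 1) p (lie_der K L (k - 1) q u)))"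
      if p: "p \<in> carrier L" and q: "q \<in> carrier L" for p q
      unfolding lie_der_lwedge[OF L q z u] dk(4)[OF p lw(3)[OF bracket_closed[OF q z] u] lw(3)[OF z d[OF q u]]]
        lie_der_lwedge[OF L p bracket_closed[OF q z] u] lie_der_lwedge[OF L p z d[OF q u]] ..
    have jac: "lwedge K L k (lie_bracket L x (lie_bracket L y z)) u
        = lwedge K L k (lie_bracket L (lie_bracket L x y) z) u \<oplus>\<^bsub>?E\<^esub> lwedge K L k (lie_bracket L y (lie_bracket L x z)) u"
      unfolding jacobi_derivation[OF L x y z] by (rule vl(4)) (simp_all add: bracket_closed x y z)
    have ih: "lwedge K L k z (lie_der K L (k - 1) x (lie_der K L (k - 1) y u))
      = lwedge K L k z (lie_der K L (k - 1) (lie_bracket L x y) u) \<oplus>\<^bsub>?E\<^esub> lwedge K L k z (lie_der K L (k - 1) y (lie_der K L (k - 1) x u))"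
      unfolding IH by (rule lw(4)[OF z d[OF b u] d[OF y d[OF x u]]])
    show "lie_der K L k x (lie_der K L k y (lwedge K L k z u)) = lie_der K L k (lie_bracket L x y) (lwedge K L k z u)
        \<oplus>\<^bsub>?E\<^esub> lie_der K L k y (lie_der K L k x (lwedge K L k z u))"
      unfolding two[OF x y] two[OF y x] lie_der_lwedge[OF L b z u] jac ih
      using lw(3) d u x y z b bracket_closed by (simp add: E.M.a_ac)
  qed
qed

lemma ce_complex_simps [simp]:
  "chain (ce_complex K L) = ext_pow K L"
  by (simp add: ce_complex_def)

text \<open>This is what makes \<^const>\<open>ext_lift\<close> in the definition of the differential meaningful.\<close>

lemma ce_bdry_gen_alternating:
  assumes L: "lie_algebra K L"
  shows "alternating K L (ext_pow K L (k - 1)) k (ce_bdry_gen K L k)"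
proof -
  note a = ce_wedge_alternating[OF L, of k]
  have eq: "ce_bdry_gen K L k (us @ x # vs) = ce_wedge K L k (us @ x # vs)"
    if "set us \<subseteq> carrier L" "set vs \<subseteq> carrier L" "int (length us + length vs) + 1 = k" "x \<in> carrier L" for us x vs
    by (rule ce_bdry_gen_eq[OF L]) (use that in \<open>auto simp: tuples_def\<close>)
  show ?thesis unfolding alternating_def multilinear_def
  proof (intro conjI allI ballI impI)
    fix us vs assume *: "set us \<subseteq> carrier L \<and> set vs \<subseteq> carrier L \<and> int (length us + length vs) + 1 = k"
    hence "linear_map K L (ext_pow K L (k - 1)) (\<lambda>x. ce_wedge K L k (us @ x # vs))"
      using multilinear_slot[OF alternatingD(1)[OF a]] by blast
    note l = linear_mapD[OF this]
    interpret lie_algebra K L by fact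
    show "linear_map K L (ext_pow K L (k - 1)) (\<lambda>x. ce_bdry_gen K L k (us @ x # vs))"
      by (rule linear_mapI[OF l(1,2)]) (use * in \<open>simp_all add: eq l(3-5)\<close>)
  next
    show "ce_bdry_gen K L k [] \<in> carrier (ext_pow K L (k - 1))" if "k = 0"
      using ce_bdry_gen_eq[OF L, of "[]" k] ce_wedge_closed[OF L, of "[]" k] that by (simp add: tuples_def)
    show "ce_bdry_gen K L k xs = \<zero>\<^bsub>ext_pow K L (k - 1)\<^esub>" if "xs \<in> tuples L k" "\<not> distinct xs" for xs
      using ce_bdry_gen_eq[OF L that(1)] alternatingD(2)[OF a that] by simp
  qed
qed

lemma ce_bdry_linear:
  assumes L: "lie_algebra K L"
  shows "linear_map K (ext_pow K L k) (ext_pow K L (k - 1)) (bdry (ce_complex K L) k)"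
  unfolding ce_complex_def
  using ext_lift_linear[OF lie_algebra_vs[OF L] ext_pow_vectorspace[OF lie_algebra_vs[OF L]] ce_bdry_gen_alternating[OF L]] by simp

lemma ce_bdry_wedge:
  assumes L: "lie_algebra K L" and xs: "xs \<in> tuples L k"
  shows "bdry (ce_complex K L) k (wedge K L xs) = ce_wedge K L k xs"
  unfolding ce_complex_def
  using ext_lift_wedge[OF lie_algebra_vs[OF L] ext_pow_vectorspace[OF lie_algebra_vs[OF L]] ce_bdry_gen_alternating[OF L] xs]
    ce_bdry_gen_eq[OF L xs] by simp

lemma ce_bdry_nil:
  assumes L: "lie_algebra K L"
  shows "bdry (ce_complex K L) 0 (wedge K L []) = \<zero>\<^bsub>ext_pow K L (0 - 1)\<^esub>"
  using ce_bdry_wedge[OF L, of "[]" 0] by (simp add: tuples_def)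

lemma ce_bdry_lwedge:
  assumes L: "lie_algebra K L" and x: "x \<in> carrier L" and t: "t \<in> carrier (ext_pow K L (k - 1))"
  shows "bdry (ce_complex K L) k (lwedge K L k x t) = \<ominus>\<^bsub>ext_pow K L (k - 1)\<^esub>
    (lwedge K L (k - 1) x (bdry (ce_complex K L) (k - 1) t) \<oplus>\<^bsub>ext_pow K L (k - 1)\<^esub> lie_der K L (k - 1) x t)"
proof -
  note V = lie_algebra_vs[OF L]
  show ?thesis
  proof (rule ext_pow_eqI[OF V linear_map_comp[OF lwedge_linear[OF V x] ce_bdry_linear[OF L]]
      linear_map_neg[OF linear_map_add[OF linear_map_comp[OF ce_bdry_linear[OF L] lwedge_linear[OF V x]] lie_der_linear[OF L x]]] _ t])
    fix xs assume xs: "xs \<in> tuples L (k - 1)"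
    hence "x # xs \<in> tuples L k" using x by (simp add: tuples_Cons)
    from ce_bdry_wedge[OF L this] show "bdry (ce_complex K L) k (lwedge K L k x (wedge K L xs)) = \<ominus>\<^bsub>ext_pow K L (k - 1)\<^esub>
      (lwedge K L (k - 1) x (bdry (ce_complex K L) (k - 1) (wedge K L xs)) \<oplus>\<^bsub>ext_pow K L (k - 1)\<^esub> lie_der K L (k - 1) x (wedge K L xs))"
      unfolding lwedge_wedge[OF V x xs] ce_bdry_wedge[OF L xs] lie_der_wedge[OF L x xs] ce_wedge.simps .
  qed
qed

text \<open>The induction step compares both sides on \<open>y \<and> u\<close>. The recursion for \<open>\<partial>\<close> and the Leibniz rule for
  \<open>\<theta>\<^sub>x\<close> leave the discrepancy \<open>\<theta>\<^bsub>[x,y]\<^esub> u + \<theta>\<^sub>y \<theta>\<^sub>x u - \<theta>\<^sub>x \<theta>\<^sub>y u\<close>, which is zero.\<close>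

lemma lie_der_ce_bdry:
  assumes L: "lie_algebra K L" and x: "x \<in> carrier L" and t: "t \<in> carrier (ext_pow K L k)"
  shows "bdry (ce_complex K L) k (lie_der K L k x t) = lie_der K L (k - 1) x (bdry (ce_complex K L) k t)"
proof -
  interpret lie_algebra K L by fact
  let ?d = "bdry (ce_complex K L)"
  note V = vectorspace_axioms and D = lie_der_linear[OF L] and dl = ce_bdry_linear[OF L]
  show ?thesis
  proof (rule ext_pow_induct_eq[where W = "\<lambda>k. ext_pow K L (k - 1)", OF V linear_map_comp[OF D[OF x] dl]
        linear_map_comp[OF dl D[OF x]] _ _ t])
    show "?d 0 (lie_der K L 0 x (wedge K L [])) = lie_der K L (0 - 1) x (?d 0 (wedge K L []))"
      unfolding lie_der_nil[OF L x] ce_bdry_nil[OF L] linear_mapD(6)[OF D[OF x]] by (rule linear_mapD(6)[OF dl])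
    fix k y u
    assume y: "y \<in> carrier L" and u: "u \<in> carrier (ext_pow K L (k - 1))"
      and IH: "?d (k - 1) (lie_der K L (k - 1) x u) = lie_der K L (k - 1 - 1) x (?d (k - 1) u)"
    let ?E = "ext_pow K L (k - 1)"
    interpret E: vectorspace K ?E by (rule ext_pow_vectorspace[OF V])
    note b = bracket_closed[OF x y]
    note dk = linear_mapD[OF dl[where k = k]] and dk1 = linear_mapD(3)[OF dl[where k = "k - 1"]]
    note lw = linear_mapD(3)[OF lwedge_linear[OF V]] and Dc = linear_mapD[OF D[where k = "k - 1"]]
    have du: "?d (k - 1) u \<in> carrier (ext_pow K L (k - 1 - 1))" by (rule dk1[OF u])
    have Du: "lie_der K L (k - 1) z u \<in> carrier ?E" if "z \<in> carrier L" for z by (rule Dc(3)[OF that u])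
    have c1: "lwedge K L (k - 1) z (?d (k - 1) u) \<in> carrier ?E" if "z \<in> carrier L" for z by (rule lw[OF that du])
    have c2: "lwedge K L (k - 1) y (lie_der K L (k - 1 - 1) x (?d (k - 1) u)) \<in> carrier ?E"
      by (rule lw[OF y linear_mapD(3)[OF D[OF x] du]])
    have c3: "lie_der K L (k - 1) y (lie_der K L (k - 1) x u) \<in> carrier ?E" by (rule Dc(3)[OF y Du[OF x]])
    have lhs: "?d k (lie_der K L k x (lwedge K L k y u))
      = \<ominus>\<^bsub>?E\<^esub> (lwedge K L (k - 1) (lie_bracket L x y) (?d (k - 1) u) \<oplus>\<^bsub>?E\<^esub> lie_der K L (k - 1) (lie_bracket L x y) u)
        \<oplus>\<^bsub>?E\<^esub> \<ominus>\<^bsub>?E\<^esub> (lwedge K L (k - 1) y (lie_der K L (k - 1 - 1) x (?d (k - 1) u)) \<oplus>\<^bsub>?E\<^esub> lie_der K L (k - 1) y (lie_der K L (k - 1) x u))"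
      unfolding lie_der_lwedge[OF L x y u] dk(4)[OF lw[OF b u] lw[OF y Du[OF x]]]
        ce_bdry_lwedge[OF L b u] ce_bdry_lwedge[OF L y Du[OF x]] IH ..
    have rhs: "lie_der K L (k - 1) x (?d k (lwedge K L k y u))
      = \<ominus>\<^bsub>?E\<^esub> ((lwedge K L (k - 1) (lie_bracket L x y) (?d (k - 1) u) \<oplus>\<^bsub>?E\<^esub> lwedge K L (k - 1) y (lie_der K L (k - 1 - 1) x (?d (k - 1) u)))
        \<oplus>\<^bsub>?E\<^esub> (lie_der K L (k - 1) (lie_bracket L x y) u \<oplus>\<^bsub>?E\<^esub> lie_der K L (k - 1) y (lie_der K L (k - 1) x u)))"
      unfolding ce_bdry_lwedge[OF L y u] Dc(7)[OF x E.M.a_closed[OF c1[OF y] Du[OF y]]] Dc(4)[OF x c1[OF y] Du[OF y]]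
        lie_der_lwedge[OF L x y du] lie_der_bracket[OF L x y u] ..
    show "?d k (lie_der K L k x (lwedge K L k y u)) = lie_der K L (k - 1) x (?d k (lwedge K L k y u))"
      unfolding lhs rhs using c1[OF b] Du[OF b] c2 c3 by (simp add: E.M.minus_add E.M.a_ac)
  qed
qed

text \<open>Applying \<open>\<partial>\<close> to \<open>-(x \<and> \<partial>u + \<theta>\<^sub>x u)\<close> yields \<open>x \<and> \<partial>\<partial>u + \<theta>\<^sub>x \<partial>u - \<partial>\<theta>\<^sub>x u\<close>. The first term vanishes by
  induction, the others cancel because \<open>\<theta>\<^sub>x\<close> commutes with \<open>\<partial>\<close>.\<close>

lemma ce_bdry_square:
  assumes L: "lie_algebra K L" and t: "t \<in> carrier (ext_pow K L k)"
  shows "bdry (ce_complex K L) (k - 1) (bdry (ce_complex K L) k t) = \<zero>\<^bsub>ext_pow K L (k - 1 - 1)\<^esub>"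
proof -
  let ?d = "bdry (ce_complex K L)"
  note V = lie_algebra_vs[OF L] and dl = ce_bdry_linear[OF L]
  show ?thesis
  proof (rule ext_pow_induct_eq[where W = "\<lambda>k. ext_pow K L (k - 1 - 1)", OF V linear_map_comp[OF dl dl]
        linear_map_zero[OF ext_pow_vectorspace[OF V] ext_pow_vectorspace[OF V]] _ _ t])
    show "?d (0 - 1) (?d 0 (wedge K L [])) = \<zero>\<^bsub>ext_pow K L (0 - 1 - 1)\<^esub>"
      unfolding ce_bdry_nil[OF L] by (rule linear_mapD(6)[OF dl])
    fix k x u
    assume x: "x \<in> carrier L" and u: "u \<in> carrier (ext_pow K L (k - 1))"
      and IH: "?d (k - 1 - 1) (?d (k - 1) u) = \<zero>\<^bsub>ext_pow K L (k - 1 - 1 - 1)\<^esub>"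
    let ?E1 = "ext_pow K L (k - 1)" and ?E2 = "ext_pow K L (k - 1 - 1)"
    interpret E1: vectorspace K ?E1 by (rule ext_pow_vectorspace[OF V])
    interpret E2: vectorspace K ?E2 by (rule ext_pow_vectorspace[OF V])
    note d1 = linear_mapD[OF dl[where k = "k - 1"]] and lw = linear_mapD[OF lwedge_linear[OF V x]]
    have du: "?d (k - 1) u \<in> carrier ?E2" by (rule d1(3)[OF u])
    have Du: "lie_der K L (k - 1) x u \<in> carrier ?E1" by (rule linear_mapD(3)[OF lie_der_linear[OF L x] u])
    have c: "lie_der K L (k - 1 - 1) x (?d (k - 1) u) \<in> carrier ?E2" by (rule linear_mapD(3)[OF lie_der_linear[OF L x] du])
    have "?d (k - 1) (lwedge K L (k - 1) x (?d (k - 1) u)) = \<ominus>\<^bsub>?E2\<^esub> (\<zero>\<^bsub>?E2\<^esub> \<oplus>\<^bsub>?E2\<^esub> lie_der K L (k - 1 - 1) x (?d (k - 1) u))"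
      unfolding ce_bdry_lwedge[OF L x du] IH lw(6) ..
    also have "\<dots> = \<ominus>\<^bsub>?E2\<^esub> lie_der K L (k - 1 - 1) x (?d (k - 1) u)" unfolding E2.M.l_zero[OF c] ..
    finally have 1: "?d (k - 1) (lwedge K L (k - 1) x (?d (k - 1) u)) = \<ominus>\<^bsub>?E2\<^esub> lie_der K L (k - 1 - 1) x (?d (k - 1) u)" .
    have "?d (k - 1) (?d k (lwedge K L k x u)) = \<ominus>\<^bsub>?E2\<^esub> (\<ominus>\<^bsub>?E2\<^esub> lie_der K L (k - 1 - 1) x (?d (k - 1) u) \<oplus>\<^bsub>?E2\<^esub> lie_der K L (k - 1 - 1) x (?d (k - 1) u))"
      unfolding ce_bdry_lwedge[OF L x u] d1(7)[OF E1.M.a_closed[OF lw(3)[OF du] Du]] d1(4)[OF lw(3)[OF du] Du] 1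
        lie_der_ce_bdry[OF L x u] ..
    also have "\<dots> = \<zero>\<^bsub>?E2\<^esub>" unfolding E2.M.l_neg[OF c] by (rule vectorspace_neg_zero[OF E2.vectorspace_axioms])
    finally show "?d (k - 1) (?d k (lwedge K L k x u)) = \<zero>\<^bsub>?E2\<^esub>" .
  qed
qed

lemma ce_complex_fd:
  assumes L: "lie_algebra K L" and fin: "vectorspace.fin_dim K L"
  shows "fd_complex K (ce_complex K L)"
  unfolding fd_complex_def ce_complex_simps
  using ext_pow_fin_dim[OF lie_algebra_vs[OF L] fin] ce_bdry_linear[OF L] ce_bdry_square[OF L] by blast

section \<open>Homomorphisms, ideals and quotients of Lie algebras\<close>

definition lie_hom :: "('k, 'm) ring_scheme \<Rightarrow> ('k, 'a, 'y) lie_alg_scheme \<Rightarrow> ('k, 'b, 'z) lie_alg_scheme \<Rightarrow> ('a \<Rightarrow> 'b) \<Rightarrow> bool" where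
  "lie_hom K L M h \<longleftrightarrow> lie_algebra K L \<and> lie_algebra K M \<and> linear_map K L M h \<and>
     (\<forall>x\<in>carrier L. \<forall>y\<in>carrier L. h (lie_bracket L x y) = lie_bracket M (h x) (h y))"

lemma lie_homD:
  assumes "lie_hom K L M h"
  shows "lie_algebra K L" "lie_algebra K M" "linear_map K L M h"
    "\<And>x y. \<lbrakk>x \<in> carrier L; y \<in> carrier L\<rbrakk> \<Longrightarrow> h (lie_bracket L x y) = lie_bracket M (h x) (h y)"
  using assms unfolding lie_hom_def by blast+

lemma ext_map_lwedge:
  assumes h: "linear_map K V W h" and x: "x \<in> carrier V" and t: "t \<in> carrier (ext_pow K V (k - 1))"
  shows "ext_map K W h k (lwedge K V k x t) = lwedge K W k (h x) (ext_map K W h (k - 1) t)"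
proof -
  note h' = linear_mapD[OF h]
  show ?thesis
  proof (rule ext_pow_eqI[OF h'(1) linear_map_comp[OF lwedge_linear[OF h'(1) x] ext_map_linear[OF h]]
        linear_map_comp[OF ext_map_linear[OF h] lwedge_linear[OF h'(2) h'(3)[OF x]]] _ t])
    fix xs assume xs: "xs \<in> tuples V (k - 1)"
    have 1: "x # xs \<in> tuples V k" using x xs by (simp add: tuples_Cons)
    have 2: "map h xs \<in> tuples W (k - 1)" by (rule map_tuples[OF xs h'(3)])
    show "ext_map K W h k (lwedge K V k x (wedge K V xs)) = lwedge K W k (h x) (ext_map K W h (k - 1) (wedge K V xs))"
      unfolding lwedge_wedge[OF h'(1) x xs] ext_map_wedge[OF h 1] ext_map_wedge[OF h xs] lwedge_wedge[OF h'(2) h'(3)[OF x] 2] by simp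
  qed
qed

lemma ext_map_nil:
  assumes h: "linear_map K V W h"
  shows "ext_map K W h 0 (wedge K V []) = wedge K W []"
  using ext_map_wedge[OF h, of "[]" 0] by (simp add: tuples_def)

lemma ext_map_lie_der:
  assumes h: "lie_hom K L M h" and x: "x \<in> carrier L" and t: "t \<in> carrier (ext_pow K L k)"
  shows "ext_map K M h k (lie_der K L k x t) = lie_der K M k (h x) (ext_map K M h k t)"
proof -
  note H = lie_homD[OF h] and h' = linear_mapD[OF lie_homD(3)[OF h]]
  note E = ext_map_linear[OF H(3)] and D = lie_der_linear[OF H(1) x] and D' = lie_der_linear[OF H(2) h'(3)[OF x]]
  interpret lie_algebra K L by (rule H)
  show ?thesis
  proof (rule ext_pow_induct_eq[where W = "ext_pow K M", OF h'(1) linear_map_comp[OF D E] linear_map_comp[OF E D'] _ _ t])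
    show "ext_map K M h 0 (lie_der K L 0 x (wedge K L [])) = lie_der K M 0 (h x) (ext_map K M h 0 (wedge K L []))"
      unfolding lie_der_nil[OF H(1) x] ext_map_nil[OF H(3)] lie_der_nil[OF H(2) h'(3)[OF x]] by (rule linear_mapD(6)[OF E])
    fix k y u
    assume y: "y \<in> carrier L" and u: "u \<in> carrier (ext_pow K L (k - 1))"
      and IH: "ext_map K M h (k - 1) (lie_der K L (k - 1) x u) = lie_der K M (k - 1) (h x) (ext_map K M h (k - 1) u)"
    note b = bracket_closed[OF x y]
    have Du: "lie_der K L (k - 1) x u \<in> carrier (ext_pow K L (k - 1))" by (rule linear_mapD(3)[OF D u])
    show "ext_map K M h k (lie_der K L k x (lwedge K L k y u)) = lie_der K M k (h x) (ext_map K M h k (lwedge K L k y u))"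
      unfolding lie_der_lwedge[OF H(1) x y u]
        linear_mapD(4)[OF E linear_mapD(3)[OF lwedge_linear[OF h'(1) b] u] linear_mapD(3)[OF lwedge_linear[OF h'(1) y] Du]]
        ext_map_lwedge[OF H(3) b u] ext_map_lwedge[OF H(3) y Du] ext_map_lwedge[OF H(3) y u] IH H(4)[OF x y]
        lie_der_lwedge[OF H(2) h'(3)[OF x] h'(3)[OF y] linear_mapD(3)[OF E u]] ..
  qed
qed

text \<open>The map induced on exterior powers respects \<open>x \<and> _\<close> and \<open>\<theta>\<^sub>x\<close>, hence also the operator that the
  recursion builds from them.\<close>

lemma ext_map_chain_map:
  assumes h: "lie_hom K L M h"
  shows "chain_map K (ce_complex K L) (ce_complex K M) (ext_map K M h)"
  unfolding chain_map_def ce_complex_simps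
proof (intro allI conjI ballI)
  note H = lie_homD[OF h] and h' = linear_mapD[OF lie_homD(3)[OF h]]
  note E = ext_map_linear[OF H(3)] and dl = ce_bdry_linear[OF H(1)] and dm = ce_bdry_linear[OF H(2)]
  let ?d = "bdry (ce_complex K L)" and ?e = "bdry (ce_complex K M)"
  show "linear_map K (ext_pow K L k) (ext_pow K M k) (ext_map K M h k)" for k by (rule E)
  show "ext_map K M h (k - 1) (?d k t) = ?e k (ext_map K M h k t)" if t: "t \<in> carrier (ext_pow K L k)" for k t
  proof (rule ext_pow_induct_eq[where W = "\<lambda>k. ext_pow K M (k - 1)", OF h'(1) linear_map_comp[OF dl E] linear_map_comp[OF E dm] _ _ t])
    show "ext_map K M h (0 - 1) (?d 0 (wedge K L [])) = ?e 0 (ext_map K M h 0 (wedge K L []))"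
      unfolding ext_map_nil[OF H(3)] ce_bdry_nil[OF H(1)] ce_bdry_nil[OF H(2)] by (rule linear_mapD(6)[OF E])
    fix k x u
    assume x: "x \<in> carrier L" and u: "u \<in> carrier (ext_pow K L (k - 1))"
      and IH: "ext_map K M h (k - 1 - 1) (?d (k - 1) u) = ?e (k - 1) (ext_map K M h (k - 1) u)"
    interpret EL: vectorspace K "ext_pow K L (k - 1)" by (rule ext_pow_vectorspace[OF h'(1)])
    have du: "?d (k - 1) u \<in> carrier (ext_pow K L (k - 1 - 1))" by (rule linear_mapD(3)[OF dl u])
    have c1: "lwedge K L (k - 1) x (?d (k - 1) u) \<in> carrier (ext_pow K L (k - 1))" by (rule linear_mapD(3)[OF lwedge_linear[OF h'(1) x] du])
    have c2: "lie_der K L (k - 1) x u \<in> carrier (ext_pow K L (k - 1))" by (rule linear_mapD(3)[OF lie_der_linear[OF H(1) x] u])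
    show "ext_map K M h (k - 1) (?d k (lwedge K L k x u)) = ?e k (ext_map K M h k (lwedge K L k x u))"
      unfolding ce_bdry_lwedge[OF H(1) x u] linear_mapD(7)[OF E EL.M.a_closed[OF c1 c2]] linear_mapD(4)[OF E c1 c2]
        ext_map_lwedge[OF H(3) x du] ext_map_lie_der[OF h x u] ext_map_lwedge[OF H(3) x u] IH
        ce_bdry_lwedge[OF H(2) h'(3)[OF x] linear_mapD(3)[OF E u]] ..
  qed
qed

lemma lie_idealD:
  assumes "lie_ideal K L N"
  shows "subspace K N L" "\<And>x y. \<lbrakk>x \<in> carrier L; y \<in> N\<rbrakk> \<Longrightarrow> lie_bracket L x y \<in> N"
  using assms unfolding lie_ideal_def by blast+

lemma lie_ideal_left:
  assumes L: "lie_algebra K L" and N: "lie_ideal K L N" and x: "x \<in> N" and y: "y \<in> carrier L"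
  shows "lie_bracket L x y \<in> N"
  unfolding bracket_antisym[OF L subspace_mem[OF lie_idealD(1)[OF N] x] y]
  by (rule subspaceD(7)[OF lie_idealD(1)[OF N] lie_idealD(2)[OF N y x]])

text \<open>As for vector spaces, the axioms for the bracket on cosets are inherited along the projection.\<close>

lemma lie_algebra_image:
  assumes L: "lie_algebra K L" and h: "linear_map K L M h" and surj: "h ` carrier L = carrier M"
    and br: "\<And>x y. \<lbrakk>x \<in> carrier L; y \<in> carrier L\<rbrakk> \<Longrightarrow> lie_bracket M (h x) (h y) = h (lie_bracket L x y)"
  shows "lie_algebra K M"
proof -
  interpret lie_algebra K L by fact
  note h' = linear_mapD[OF h]
  interpret M: vectorspace K M by (rule h')
  have ex: "\<exists>x\<in>carrier L. u = h x" if "u \<in> carrier M" for u using that unfolding surj[symmetric] by blast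
  show ?thesis
  proof (unfold_locales)
    fix u v assume "u \<in> carrier M" "v \<in> carrier M"
    then obtain x y where x: "x \<in> carrier L" "u = h x" and y: "y \<in> carrier L" "v = h y" using ex by meson
    note b = bracket_closed[OF x(1) y(1)]
    show "lie_bracket M u v \<in> carrier M" unfolding x(2) y(2) br[OF x(1) y(1)] by (rule h'(3)[OF b])
    fix w assume "w \<in> carrier M"
    then obtain z where z: "z \<in> carrier L" "w = h z" using ex by meson
    show "lie_bracket M (u \<oplus>\<^bsub>M\<^esub> v) w = lie_bracket M u w \<oplus>\<^bsub>M\<^esub> lie_bracket M v w"
      unfolding x(2) y(2) z(2) using x(1) y(1) z(1)
      by (simp add: br bracket_closed bracket_add_left h'(4)[symmetric])
    show "lie_bracket M u (v \<oplus>\<^bsub>M\<^esub> w) = lie_bracket M u v \<oplus>\<^bsub>M\<^esub> lie_bracket M u w"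
      unfolding x(2) y(2) z(2) using x(1) y(1) z(1)
      by (simp add: br bracket_closed bracket_add_right h'(4)[symmetric])
    show "lie_bracket M u (lie_bracket M v w) \<oplus>\<^bsub>M\<^esub> lie_bracket M v (lie_bracket M w u)
        \<oplus>\<^bsub>M\<^esub> lie_bracket M w (lie_bracket M u v) = \<zero>\<^bsub>M\<^esub>"
      unfolding x(2) y(2) z(2) using x(1) y(1) z(1)
      by (simp add: br bracket_closed h'(4)[symmetric] jacobi h'(6))
  next
    fix c u v assume c: "c \<in> carrier K" and "u \<in> carrier M" "v \<in> carrier M"
    then obtain x y where x: "x \<in> carrier L" "u = h x" and y: "y \<in> carrier L" "v = h y" using ex by meson
    show "lie_bracket M (c \<odot>\<^bsub>M\<^esub> u) v = c \<odot>\<^bsub>M\<^esub> lie_bracket M u v"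
      unfolding x(2) y(2) using x(1) y(1) c
      by (simp add: br bracket_closed bracket_smult_left h'(5)[symmetric])
    show "lie_bracket M u (c \<odot>\<^bsub>M\<^esub> v) = c \<odot>\<^bsub>M\<^esub> lie_bracket M u v"
      unfolding x(2) y(2) using x(1) y(1) c
      by (simp add: br bracket_closed bracket_smult_right h'(5)[symmetric])
  next
    fix u assume "u \<in> carrier M"
    then obtain x where x: "x \<in> carrier L" "u = h x" using ex by meson
    show "lie_bracket M u u = \<zero>\<^bsub>M\<^esub>" unfolding x(2) br[OF x(1) x(1)] bracket_self[OF x(1)] by (rule h'(6))
  qed
qed

lemma lie_quot_map:
  assumes L: "lie_algebra K L" and N: "lie_ideal K L N"
  shows "lie_hom K L (lie_quot L N) (a_r_coset L N)"
    and "a_r_coset L N ` carrier L = carrier (lie_quot L N)"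
    and "\<And>x. x \<in> carrier L \<Longrightarrow> a_r_coset L N x = \<zero>\<^bsub>lie_quot L N\<^esub> \<longleftrightarrow> x \<in> N"
proof -
  interpret lie_algebra K L by fact
  note S = lie_idealD(1)[OF N]
  let ?Q = "lie_quot L N"
  have Q: "carrier ?Q = a_rcosets\<^bsub>L\<^esub> N" "\<zero>\<^bsub>?Q\<^esub> = N" "add ?Q = set_add L" "smult ?Q = quot_smult L N"
    by (simp_all add: lie_quot_def)
  note q = quotient_map[OF S Q]
  show surj: "a_r_coset L N ` carrier L = carrier ?Q" by (rule q(3))
  show "a_r_coset L N x = \<zero>\<^bsub>?Q\<^esub> \<longleftrightarrow> x \<in> N" if "x \<in> carrier L" for x by (rule q(4)[OF that])
  have br: "lie_bracket ?Q (N +>\<^bsub>L\<^esub> x) (N +>\<^bsub>L\<^esub> y) = N +>\<^bsub>L\<^esub> lie_bracket L x y" if x: "x \<in> carrier L" and y: "y \<in> carrier L" for x y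
  proof -
    have const: "N +>\<^bsub>L\<^esub> lie_bracket L x' y' = N +>\<^bsub>L\<^esub> lie_bracket L x y" if "x' \<in> N +>\<^bsub>L\<^esub> x" "y' \<in> N +>\<^bsub>L\<^esub> y" for x' y'
    proof -
      from that have x': "x' \<in> carrier L" "x' \<ominus>\<^bsub>L\<^esub> x \<in> N" and y': "y' \<in> carrier L" "y' \<ominus>\<^bsub>L\<^esub> y \<in> N"
        using coset_mem[OF S x] coset_mem[OF S y] by blast+
      have "lie_bracket L x' y' \<ominus>\<^bsub>L\<^esub> lie_bracket L x y
        = (lie_bracket L x' y' \<ominus>\<^bsub>L\<^esub> lie_bracket L x y') \<oplus>\<^bsub>L\<^esub> (lie_bracket L x y' \<ominus>\<^bsub>L\<^esub> lie_bracket L x y)"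
        by (rule abelian_group_telescope[symmetric, OF M.abelian_group_axioms]) (simp_all add: bracket_closed x y x' y')
      also have "\<dots> = lie_bracket L (x' \<ominus>\<^bsub>L\<^esub> x) y' \<oplus>\<^bsub>L\<^esub> lie_bracket L x (y' \<ominus>\<^bsub>L\<^esub> y)"
        unfolding linear_mapD(8)[OF bracket_linear_left[OF L y'(1)] x'(1) x] linear_mapD(8)[OF bracket_linear_right[OF L x] y'(1) y] ..
      also have "\<dots> \<in> N"
        by (rule subspaceD(4)[OF S lie_ideal_left[OF L N x'(2) y'(1)] lie_idealD(2)[OF N x y'(2)]])
      finally show ?thesis using coset_eq_iff[OF S bracket_closed[OF x'(1) y'(1)] bracket_closed[OF x y]] by blast
    qed
    interpret W: abelian_subgroup N L by (rule subspace_abelian_subgroup[OF S])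
    have "x \<in> N +>\<^bsub>L\<^esub> x" "y \<in> N +>\<^bsub>L\<^esub> y" using W.a_rcos_self x y by blast+
    hence "(\<Union>x'\<in>N +>\<^bsub>L\<^esub> x. \<Union>y'\<in>N +>\<^bsub>L\<^esub> y. N +>\<^bsub>L\<^esub> lie_bracket L x' y') = N +>\<^bsub>L\<^esub> lie_bracket L x y"
      using const by blast
    thus ?thesis by (simp add: lie_quot_def)
  qed
  have "lie_algebra K ?Q" by (rule lie_algebra_image[OF L q(2) surj br])
  thus "lie_hom K L ?Q (a_r_coset L N)"
    unfolding lie_hom_def using L q(2) br by simp
qed

lemma lie_quot_algebra:
  assumes "lie_algebra K L" "lie_ideal K L N"
  shows "lie_algebra K (lie_quot L N)"
  by (rule lie_homD(2)[OF lie_quot_map(1)[OF assms]])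

lemma lie_quot_fin_dim:
  assumes "lie_algebra K L" "lie_ideal K L N" "vectorspace.fin_dim K L"
  shows "vectorspace.fin_dim K (lie_quot L N)"
  by (rule fin_dim_image[OF lie_homD(3)[OF lie_quot_map(1)[OF assms(1,2)]] assms(3) lie_quot_map(2)[OF assms(1,2)]])

lemma lie_ideal_image:
  assumes L: "lie_algebra K L" and N: "lie_ideal K L N" and J: "lie_ideal K L J"
  shows "lie_ideal K (lie_quot L N) (quot_image L N J)"
proof -
  note q = lie_quot_map[OF L N]
  show ?thesis unfolding lie_ideal_def quot_image_def
  proof (intro conjI ballI)
    show "subspace K (a_r_coset L N ` J) (lie_quot L N)"
      by (rule subspace_image[OF lie_homD(3)[OF q(1)] lie_idealD(1)[OF J]])
    fix X Y assume "X \<in> carrier (lie_quot L N)" "Y \<in> a_r_coset L N ` J"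
    then obtain x y where x: "x \<in> carrier L" "X = a_r_coset L N x" and y: "y \<in> J" "Y = a_r_coset L N y"
      unfolding q(2)[symmetric] by blast
    have "lie_bracket (lie_quot L N) X Y = a_r_coset L N (lie_bracket L x y)"
      unfolding x(2) y(2) by (rule lie_homD(4)[OF q(1) x(1) subspace_mem[OF lie_idealD(1)[OF J] y(1)], symmetric])
    thus "lie_bracket (lie_quot L N) X Y \<in> a_r_coset L N ` J" using lie_idealD(2)[OF J x(1) y(1)] by blast
  qed
qed

lemma lie_ideal_carrier:
  assumes L: "lie_algebra K L"
  shows "lie_ideal K L (carrier L)"
proof -
  interpret lie_algebra K L by fact
  show ?thesis unfolding lie_ideal_def using subspace_carrier[OF vectorspace_axioms] bracket_closed by blast
qed

lemma lie_ideal_subalgebra: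
  assumes L: "lie_algebra K L" and J: "lie_ideal K L J"
  shows "lie_hom K (L\<lparr>carrier := J\<rparr>) L (\<lambda>x. x)"
proof -
  interpret lie_algebra K L by fact
  note S = lie_idealD(1)[OF J] and m = subspace_mem[OF lie_idealD(1)[OF J]]
  interpret J: vectorspace K "L\<lparr>carrier := J\<rparr>" by (rule subspaceD(6)[OF S])
  have "lie_algebra K (L\<lparr>carrier := J\<rparr>)"
    by unfold_locales (simp_all add: m bracket_add_left bracket_add_right bracket_smult_left bracket_smult_right bracket_self jacobi lie_idealD(2)[OF J])
  moreover have "linear_map K (L\<lparr>carrier := J\<rparr>) L (\<lambda>x. x)"
    by (rule linear_map_domain[OF linear_map_identity[OF vectorspace_axioms] S])
  ultimately show ?thesis unfolding lie_hom_def using L by simp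
qed

lemma lie_hom_comp:
  assumes g: "lie_hom K L M g" and h: "lie_hom K M N h"
  shows "lie_hom K L N (\<lambda>x. h (g x))"
  unfolding lie_hom_def
  using lie_homD[OF g] lie_homD[OF h] linear_map_comp[OF lie_homD(3)[OF g] lie_homD(3)[OF h]] linear_mapD(3)[OF lie_homD(3)[OF g]]
  by simp

lemma lie_hom_inverse:
  assumes h: "lie_hom K L M h" and bij: "bij_betw h (carrier L) (carrier M)"
  shows "lie_hom K M L (inv_into (carrier L) h)"
proof -
  let ?g = "inv_into (carrier L) h"
  note H = lie_homD[OF h]
  note lin = linear_map_inv_into[OF H(3) bij]
  interpret lie_algebra K L by (rule H)
  have "?g (lie_bracket M u v) = lie_bracket L (?g u) (?g v)" if u: "u \<in> carrier M" and v: "v \<in> carrier M" for u v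
  proof -
    have g: "?g u \<in> carrier L" "?g v \<in> carrier L" "h (?g u) = u" "h (?g v) = v"
      using linear_mapD(3)[OF lin] u v bij by (simp_all add: bij_betw_def f_inv_into_f)
    have "?g (h (lie_bracket L (?g u) (?g v))) = lie_bracket L (?g u) (?g v)"
      using bij bracket_closed[OF g(1,2)] by (simp add: bij_betw_def)
    thus ?thesis unfolding H(4)[OF g(1,2)] g(3,4) .
  qed
  thus ?thesis unfolding lie_hom_def using H lin by blast
qed

lemma lie_hom_zero:
  assumes L: "lie_algebra K L" and M: "lie_algebra K M"
  shows "lie_hom K L M (\<lambda>_. \<zero>\<^bsub>M\<^esub>)"
proof -
  interpret M: lie_algebra K M by fact
  show ?thesis unfolding lie_hom_def
    using L M linear_map_zero[OF lie_algebra_vs[OF L] lie_algebra_vs[OF M]] M.bracket_self[OF M.M.zero_closed] by simp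
qed

section \<open>Homology of a pair\<close>

lemma pair_complex_fd:
  assumes L: "lie_algebra K L" and fin: "vectorspace.fin_dim K L" and N: "lie_ideal K L N"
  shows "fd_complex K (pair_complex K L N)"
  unfolding pair_complex_def
  by (rule fd_complex_mapping_cone[OF ce_complex_fd[OF L fin]
        ce_complex_fd[OF lie_quot_algebra[OF L N] lie_quot_fin_dim[OF L N fin]] ext_map_chain_map[OF lie_quot_map(1)[OF L N]]])

text \<open>The degree \<open>n\<close> part of the kernel of \<open>C\<^sub>*(L) \<rightarrow> C\<^sub>*(L/N)\<close>.\<close>

definition ce_ideal :: "('k, 'm) ring_scheme \<Rightarrow> ('k, 'a, 'z) lie_alg_scheme \<Rightarrow> 'a set \<Rightarrow> int \<Rightarrow> ('a list \<Rightarrow> 'k) set set" where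
  "ce_ideal K L N n = {t \<in> carrier (ext_pow K L n). ext_map K (lie_quot L N) (a_r_coset L N) n t = \<zero>\<^bsub>ext_pow K (lie_quot L N) n\<^esub>}"

lemma ce_ideal_subspace:
  assumes L: "lie_algebra K L" and N: "lie_ideal K L N"
  shows "subspace K (ce_ideal K L N n) (ext_pow K L n)"
  unfolding ce_ideal_def
  by (rule subspace_kernel[OF ext_map_linear[OF lie_homD(3)[OF lie_quot_map(1)[OF L N]]]
        subspace_carrier[OF ext_pow_vectorspace[OF lie_algebra_vs[OF L]]]])

lemma homology_pair_dim:
  assumes L: "lie_algebra K L" and fin: "vectorspace.fin_dim K L" and N: "lie_ideal K L N"
  shows "vectorspace.dim K (homology (pair_complex K L N) n)
      + sdim K (ext_pow K L (n - 1 - 1)) (bdry (ce_complex K L) (n - 1) ` ce_ideal K L N (n - 1))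
      + sdim K (ext_pow K L (n - 1)) (bdry (ce_complex K L) n ` ce_ideal K L N n)
    = sdim K (ext_pow K L (n - 1)) (ce_ideal K L N (n - 1))"
proof -
  note q = lie_quot_map[OF L N]
  have ker: "map_kernel (ce_complex K L) (ce_complex K (lie_quot L N)) (ext_map K (lie_quot L N) (a_r_coset L N)) m = ce_ideal K L N m" for m
    unfolding map_kernel_def ce_ideal_def by simp
  have surj: "ext_map K (lie_quot L N) (a_r_coset L N) m ` carrier (chain (ce_complex K L) m) = carrier (chain (ce_complex K (lie_quot L N)) m)" for m
    unfolding ce_complex_simps by (rule ext_map_surj[OF lie_homD(3)[OF q(1)] q(2)])
  show ?thesis
    using homology_cone_dim[OF ce_complex_fd[OF L fin] ce_complex_fd[OF lie_quot_algebra[OF L N] lie_quot_fin_dim[OF L N fin]]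
        ext_map_chain_map[OF q(1)] surj, of n]
    unfolding ker ce_complex_simps pair_complex_def .
qed

lemma lie_quot_carrier_zero:
  assumes L: "lie_algebra K L"
  shows "carrier (lie_quot L (carrier L)) = {\<zero>\<^bsub>lie_quot L (carrier L)\<^esub>}"
proof -
  note q = lie_quot_map[OF L lie_ideal_carrier[OF L]]
  have "a_r_coset L (carrier L) ` carrier L = (\<lambda>_. \<zero>\<^bsub>lie_quot L (carrier L)\<^esub>) ` carrier L"
    using q(3) by (intro image_cong refl) blast
  moreover have "carrier L \<noteq> {}" using subspaceD(3)[OF subspace_carrier[OF lie_algebra_vs[OF L]]] by blast
  ultimately show ?thesis unfolding q(2) by (simp add: image_constant_conv)
qed

text \<open>\<open>\<Lambda>\<^sup>m\<close> of the zero algebra vanishes for \<open>m \<ge> 1\<close>, so in these degrees \<^const>\<open>ce_ideal\<close> is all of \<open>\<Lambda>\<^sup>m L\<close>.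
  The bound on \<open>n\<close> excludes degree 0, where \<open>\<Lambda>\<^sup>0\<close> of any algebra is the base field.\<close>

lemma homology_pair_carrier_dim:
  assumes L: "lie_algebra K L" and fin: "vectorspace.fin_dim K L" and n: "2 \<le> n"
  shows "vectorspace.dim K (homology (pair_complex K L (carrier L)) n) = vectorspace.dim K (homology (ce_complex K L) (n - 1))"
proof -
  note N = lie_ideal_carrier[OF L] and V = lie_algebra_vs[OF L]
  note Q = lie_algebra_vs[OF lie_quot_algebra[OF L N]]
  have all: "ce_ideal K L (carrier L) m = carrier (ext_pow K L m)" if m: "1 \<le> m" for m
    unfolding ce_ideal_def
    using linear_mapD(3)[OF ext_map_linear[OF lie_homD(3)[OF lie_quot_map(1)[OF L N]]], of _ m]
      ext_pow_zero_space[OF Q lie_quot_carrier_zero[OF L] m] by auto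
  have "sdim K (ext_pow K L (n - 1)) (carrier (ext_pow K L (n - 1))) = vectorspace.dim K (ext_pow K L (n - 1))" by simp
  thus ?thesis
    using homology_pair_dim[OF L fin N, of n] homology_dim[OF ce_complex_fd[OF L fin], of "n - 1"] n
    unfolding bdry_rank_def ce_complex_simps by (simp add: all)
qed

section \<open>The multiplier of a split triple\<close>

text \<open>Two representatives of a coset of \<open>J\<close> differ by an element of \<open>I + J\<close>, so the set inside
  \<^const>\<open>the_elem\<close> is a singleton.\<close>

lemma quot_quot_map_coset:
  assumes L: "lie_algebra K L" and I: "lie_ideal K L I" and J: "lie_ideal K L J"
    and sub: "J \<subseteq> I <+>\<^bsub>L\<^esub> J" and IJ: "lie_ideal K L (I <+>\<^bsub>L\<^esub> J)" and x: "x \<in> carrier L"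
  shows "quot_quot_map L I J (J +>\<^bsub>L\<^esub> x) = quot_image L I (I <+>\<^bsub>L\<^esub> J) +>\<^bsub>lie_quot L I\<^esub> (I +>\<^bsub>L\<^esub> x)"
proof -
  let ?M = "lie_quot L I" and ?N = "quot_image L I (I <+>\<^bsub>L\<^esub> J)"
  note q = lie_quot_map[OF L I] and ql = linear_mapD[OF lie_homD(3)[OF lie_quot_map(1)[OF L I]]]
  note N = lie_idealD(1)[OF lie_ideal_image[OF L I IJ]]
  have const: "?N +>\<^bsub>?M\<^esub> (I +>\<^bsub>L\<^esub> y) = ?N +>\<^bsub>?M\<^esub> (I +>\<^bsub>L\<^esub> x)" if "y \<in> J +>\<^bsub>L\<^esub> x" for y
  proof -
    from that have y: "y \<in> carrier L" "y \<ominus>\<^bsub>L\<^esub> x \<in> J" using coset_mem[OF lie_idealD(1)[OF J] x] by blast+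
    have "(I +>\<^bsub>L\<^esub> y) \<ominus>\<^bsub>?M\<^esub> (I +>\<^bsub>L\<^esub> x) = I +>\<^bsub>L\<^esub> (y \<ominus>\<^bsub>L\<^esub> x)" by (rule ql(8)[OF y(1) x, symmetric])
    also have "\<dots> \<in> ?N" unfolding quot_image_def by (rule imageI[OF subsetD[OF sub y(2)]])
    finally show ?thesis using coset_eq_iff[OF N ql(3)[OF y(1)] ql(3)[OF x]] by blast
  qed
  interpret W: abelian_subgroup J L by (rule subspace_abelian_subgroup[OF lie_idealD(1)[OF J]])
  have "(\<lambda>y. ?N +>\<^bsub>?M\<^esub> (I +>\<^bsub>L\<^esub> y)) ` (J +>\<^bsub>L\<^esub> x) = {?N +>\<^bsub>?M\<^esub> (I +>\<^bsub>L\<^esub> x)}"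
    using const W.a_rcos_self[OF x] by blast
  thus ?thesis unfolding quot_quot_map_def by simp
qed

text \<open>The inverse \<open>\<sigma>\<close> of \<open>J \<rightarrow> L/I\<close> provides a section of the map of pairs
  \<open>(L, J) \<rightarrow> (L/I, L/I)\<close>. It is compatible with the quotient maps that define the two cones because its
  values in \<open>J\<close> vanish in \<open>L/J\<close>, as does the only map from the zero algebra.\<close>

theorem multiplier_triple_dim:
  assumes L: "lie_algebra K L" and fin: "vectorspace.fin_dim K L"
    and I: "lie_ideal K L I" and J: "lie_ideal K L J"
    and sum: "carrier L = I <+>\<^bsub>L\<^esub> J" and int: "I \<inter> J = {\<zero>\<^bsub>L\<^esub>}"
  shows "vectorspace.dim K (schur_multiplier_triple K L I J) + vectorspace.dim K (schur_multiplier K (L\<lparr>carrier := J\<rparr>))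
    = vectorspace.dim K (schur_multiplier_pair K L J)"
proof -
  let ?M = "lie_quot L I" and ?JJ = "L\<lparr>carrier := J\<rparr>" and ?P = "lie_quot L J"
  let ?Z = "lie_quot ?M (carrier ?M)" and ?q = "a_r_coset L I" and ?r = "a_r_coset L J"
  note q = lie_quot_map[OF L I] and r = lie_quot_map[OF L J]
  note M = lie_quot_algebra[OF L I] and finM = lie_quot_fin_dim[OF L I fin]
  note P = lie_quot_algebra[OF L J] and finP = lie_quot_fin_dim[OF L J fin]
  note cM = lie_ideal_carrier[OF M]
  note z = lie_quot_map[OF M cM] and Z = lie_quot_algebra[OF M cM] and finZ = lie_quot_fin_dim[OF M cM finM]
  note Jm = subspace_mem[OF lie_idealD(1)[OF J]] and Im = subspace_mem[OF lie_idealD(1)[OF I]]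
  interpret M: vectorspace K ?M by (rule lie_algebra_vs[OF M])
  note Zzero = lie_quot_carrier_zero[OF M]
  have N: "quot_image L I (I <+>\<^bsub>L\<^esub> J) = carrier ?M"
    unfolding sum[symmetric] quot_image_def by (rule q(2))
  have N2: "quot_image L I (carrier L) = carrier ?M" unfolding quot_image_def by (rule q(2))
  \<comment> \<open>surjectivity uses \<open>L = I + J\<close>, injectivity \<open>I \<inter> J = 0\<close>\<close>
  note incl = lie_ideal_subalgebra[OF L J]
  note j = lie_hom_comp[OF incl q(1)]
  have bij: "bij_betw ?q (carrier ?JJ) (carrier ?M)"
  proof (unfold bij_betw_def, intro conjI)
    show "inj_on ?q (carrier ?JJ)"
    proof (rule linear_map_inj_onI[OF lie_homD(3)[OF j] subspace_carrier[OF lie_algebra_vs[OF lie_homD(1)[OF j]]]])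
      fix x assume "x \<in> carrier ?JJ" "?q x = \<zero>\<^bsub>?M\<^esub>"
      hence "x \<in> I \<inter> J" using q(3)[OF Jm[of x]] by simp
      thus "x = \<zero>\<^bsub>?JJ\<^esub>" unfolding int by simp
    qed
    show "?q ` carrier ?JJ = carrier ?M"
    proof (intro subset_antisym subsetI)
      fix X assume "X \<in> carrier ?M"
      then obtain x where x: "x \<in> carrier L" "X = ?q x" unfolding q(2)[symmetric] by blast
      from x(1) obtain i k where ik: "i \<in> I" "k \<in> J" "x = i \<oplus>\<^bsub>L\<^esub> k"
        unfolding sum set_add_def' by blast
      have "?q x = ?q i \<oplus>\<^bsub>?M\<^esub> ?q k" unfolding ik(3) by (rule linear_mapD(4)[OF lie_homD(3)[OF q(1)] Im[OF ik(1)] Jm[OF ik(2)]])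
      also have "?q i = \<zero>\<^bsub>?M\<^esub>" using q(3)[OF Im[OF ik(1)]] ik(1) by blast
      also have "\<zero>\<^bsub>?M\<^esub> \<oplus>\<^bsub>?M\<^esub> ?q k = ?q k"
        by (rule M.M.l_zero[OF linear_mapD(3)[OF lie_homD(3)[OF q(1)] Jm[OF ik(2)]]])
      finally show "X \<in> ?q ` carrier ?JJ" unfolding x(2) using ik(2) by simp
    qed (use linear_mapD(3)[OF lie_homD(3)[OF j]] in auto)
  qed
  define \<sigma> where "\<sigma> = inv_into (carrier ?JJ) ?q"
  have \<sigma>J: "lie_hom K ?M ?JJ \<sigma>" unfolding \<sigma>_def by (rule lie_hom_inverse[OF j bij])
  note \<sigma> = lie_hom_comp[OF \<sigma>J incl]
  have \<sigma>_mem: "\<sigma> X \<in> J" if "X \<in> carrier ?M" for X using linear_mapD(3)[OF lie_homD(3)[OF \<sigma>J] that] by simp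
  have q\<sigma>: "?q (\<sigma> X) = X" if "X \<in> carrier ?M" for X
    unfolding \<sigma>_def by (rule bij_betw_inv_into_right[OF bij that])
  have \<sigma>q: "\<sigma> (?q x) = x" if "x \<in> carrier ?JJ" for x
    unfolding \<sigma>_def by (rule bij_betw_inv_into_left[OF bij that])
  have finJ: "vectorspace.fin_dim K ?JJ" by (rule fin_dim_subspace[OF fin lie_idealD(1)[OF J]])
  \<comment> \<open>\<open>?Z\<close> is the zero algebra \<open>(L/I)/(L/I)\<close>, so that \<open>?qq\<close> and \<open>?\<zeta>\<close> are zero maps\<close>
  let ?\<zeta> = "\<lambda>_. \<zero>\<^bsub>?P\<^esub>" and ?qq = "quot_quot_map L I J"
  have qqr: "?qq (?r x) = a_r_coset ?M (carrier ?M) (?q x)" if "x \<in> carrier L" for x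
    using quot_quot_map_coset[OF L I J _ _ that, folded sum, OF subspaceD(2)[OF lie_idealD(1)[OF J]] lie_ideal_carrier[OF L]]
    unfolding N2 .
  have qqc: "?qq X = \<zero>\<^bsub>?Z\<^esub>" if "X \<in> carrier ?P" for X
  proof -
    from that obtain x where x: "x \<in> carrier L" "X = ?r x" unfolding r(2)[symmetric] by blast
    note c = linear_mapD(3)[OF lie_homD(3)[OF q(1)] x(1)]
    show ?thesis unfolding x(2) qqr[OF x(1)] by (rule iffD2[OF z(3)[OF c] c])
  qed
  have qq: "lie_hom K ?P ?Z ?qq"
  proof -
    note zz = lie_homD[OF lie_hom_zero[OF P Z]] and zl = linear_mapD[OF lie_homD(3)[OF lie_hom_zero[OF P Z]]]
    interpret P: lie_algebra K ?P by (rule P)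
    have "linear_map K ?P ?Z ?qq"
      by (rule linear_mapI[OF zl(1,2)]) (use zl(3-5) in \<open>simp_all add: qqc\<close>)
    thus ?thesis unfolding lie_hom_def using zz P.bracket_closed by (simp add: qqc)
  qed
  note \<zeta> = lie_hom_zero[OF Z P]
  let ?f = "ext_map K ?P ?r" and ?f' = "ext_map K ?Z (a_r_coset ?M (carrier ?M))"
  let ?s = "\<lambda>n. map_prod (ext_map K L \<sigma> (n - 1)) (ext_map K ?P ?\<zeta> n)"
  note cL = ce_complex_fd[OF L fin] and cP = ce_complex_fd[OF P finP] and ceM = ce_complex_fd[OF M finM] and cZ = ce_complex_fd[OF Z finZ]
  note f = ext_map_chain_map[OF r(1)] and f' = ext_map_chain_map[OF z(1)]
  have T: "chain_map K (pair_complex K L J) (pair_complex K ?M (carrier ?M)) (triple_map K L I J)"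
    unfolding pair_complex_def triple_map_def N
  proof (rule chain_map_cone[OF cL cP f ceM cZ f' ext_map_chain_map[OF q(1)] ext_map_chain_map[OF qq]])
    fix n c assume "c \<in> carrier (chain (ce_complex K L) n)"
    hence c: "c \<in> carrier (ext_pow K L n)" by simp
    note comp = linear_map_comp[OF lie_homD(3)[OF q(1)] lie_homD(3)[OF z(1)]]
    show "ext_map K ?Z ?qq n (?f n c) = ?f' n (ext_map K ?M ?q n c)"
      using ext_map_comp[OF lie_homD(3)[OF r(1)] lie_homD(3)[OF qq] comp qqr c]
        ext_map_comp[OF lie_homD(3)[OF q(1)] lie_homD(3)[OF z(1)] comp refl c] by simp
  qed
  have S: "chain_map K (pair_complex K ?M (carrier ?M)) (pair_complex K L J) ?s"
    unfolding pair_complex_def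
  proof (rule chain_map_cone[OF ceM cZ f' cL cP f ext_map_chain_map[OF \<sigma>] ext_map_chain_map[OF \<zeta>]])
    fix n c assume "c \<in> carrier (chain (ce_complex K ?M) n)"
    hence c: "c \<in> carrier (ext_pow K ?M n)" by simp
    note comp = linear_map_comp[OF lie_homD(3)[OF z(1)] lie_homD(3)[OF \<zeta>]]
    have rs: "?r (\<sigma> X) = \<zero>\<^bsub>?P\<^esub>" if "X \<in> carrier ?M" for X using r(3)[OF Jm[OF \<sigma>_mem[OF that]]] \<sigma>_mem[OF that] by blast
    show "ext_map K ?P ?\<zeta> n (?f' n c) = ?f n (ext_map K L \<sigma> n c)"
      using ext_map_comp[OF lie_homD(3)[OF z(1)] lie_homD(3)[OF \<zeta>] comp refl c]
        ext_map_comp[OF lie_homD(3)[OF \<sigma>] lie_homD(3)[OF r(1)] comp rs c] by simp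
  qed
  have TS: "triple_map K L I J n (?s n p) = p" if "p \<in> carrier (chain (pair_complex K ?M (carrier ?M)) n)" for n p
  proof -
    from that obtain c d where p: "p = (c, d)" "c \<in> carrier (ext_pow K ?M (n - 1))" "d \<in> carrier (ext_pow K ?Z n)"
      unfolding pair_complex_def mapping_cone_simps by auto
    have zz: "?qq (?\<zeta> X) = X" if "X \<in> carrier ?Z" for X
    proof -
      have "\<zero>\<^bsub>?P\<^esub> \<in> carrier ?P" using subspaceD(3)[OF subspace_carrier[OF lie_algebra_vs[OF P]]] .
      from qqc[OF this] show ?thesis using that Zzero by simp
    qed
    show ?thesis unfolding p(1) triple_map_def N map_prod_simp
      using ext_map_inverse[OF lie_homD(3)[OF \<sigma>] lie_homD(3)[OF q(1)] q\<sigma> p(2)]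
        ext_map_inverse[OF lie_homD(3)[OF \<zeta>] lie_homD(3)[OF qq] zz p(3)] by simp
  qed
  have "vectorspace.dim K (homology (triple_complex K L I J) 4) + vectorspace.dim K (homology (pair_complex K ?M (carrier ?M)) (4 - 1))
      = vectorspace.dim K (homology (pair_complex K L J) (4 - 1))"
    unfolding triple_complex_def N
    by (rule homology_split_cone_dim[OF pair_complex_fd[OF L fin J] pair_complex_fd[OF M finM cM] T S]) (rule TS)
  moreover have "vectorspace.dim K (homology (pair_complex K ?M (carrier ?M)) 3) = vectorspace.dim K (homology (ce_complex K ?M) 2)"
    using homology_pair_carrier_dim[OF M finM, of 3] by simp
  moreover have "vectorspace.dim K (homology (ce_complex K ?M) 2) = vectorspace.dim K (homology (ce_complex K ?JJ) 2)"
  proof (rule homology_iso_dim[OF ceM ce_complex_fd[OF lie_homD(1)[OF j] finJ] ext_map_chain_map[OF \<sigma>J] ext_map_chain_map[OF j]])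
    show "ext_map K ?JJ \<sigma> n (ext_map K ?M ?q n d) = d" if "d \<in> carrier (chain (ce_complex K ?JJ) n)" for n d
      by (rule ext_map_inverse[OF lie_homD(3)[OF j] lie_homD(3)[OF \<sigma>J] \<sigma>q]) (use that in simp_all)
    show "ext_map K ?M ?q n (ext_map K ?JJ \<sigma> n c) = c" if "c \<in> carrier (chain (ce_complex K ?M) n)" for n c
      by (rule ext_map_inverse[OF lie_homD(3)[OF \<sigma>J] lie_homD(3)[OF j] q\<sigma>]) (use that in simp_all)
  qed
  ultimately show ?thesis
    unfolding schur_multiplier_triple_def schur_multiplier_pair_def schur_multiplier_def by simp
qed

section \<open>The differential in low degrees\<close>

lemma ce_bdry_2:
  assumes L: "lie_algebra K L" and x: "x \<in> carrier L" and y: "y \<in> carrier L"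
  shows "bdry (ce_complex K L) 2 (wedge K L [x, y]) = \<ominus>\<^bsub>ext_pow K L 1\<^esub> wedge K L [lie_bracket L x y]"
proof -
  interpret lie_algebra K L by fact
  note V = vectorspace_axioms and b = bracket_closed[OF x y]
  interpret E0: vectorspace K "ext_pow K L 0" by (rule ext_pow_vectorspace[OF V])
  interpret E1: vectorspace K "ext_pow K L 1" by (rule ext_pow_vectorspace[OF V])
  have w: "wedge K L [lie_bracket L x y] \<in> carrier (ext_pow K L 1)"
    by (rule wedge_closed[OF V]) (simp add: tuples_def b)
  have lz: "lwedge K L k z \<zero>\<^bsub>ext_pow K L (k - 1)\<^esub> = \<zero>\<^bsub>ext_pow K L k\<^esub>" if "z \<in> carrier L" for z k
    by (rule linear_mapD(6)[OF lwedge_linear[OF V that]])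
  have 1: "ce_wedge K L 1 [y] = \<zero>\<^bsub>ext_pow K L 0\<^esub>"
  proof -
    have "ce_wedge K L 1 [y] = \<ominus>\<^bsub>ext_pow K L 0\<^esub> (lwedge K L 0 y \<zero>\<^bsub>ext_pow K L (0 - 1)\<^esub> \<oplus>\<^bsub>ext_pow K L 0\<^esub> \<zero>\<^bsub>ext_pow K L 0\<^esub>)" by simp
    also have "\<dots> = \<zero>\<^bsub>ext_pow K L 0\<^esub>"
      unfolding lz[OF y] E0.M.l_zero[OF E0.M.zero_closed] by (rule vectorspace_neg_zero[OF E0.vectorspace_axioms])
    finally show ?thesis .
  qed
  have 2: "ad_wedge K L 1 x [y] = wedge K L [lie_bracket L x y]"
  proof -
    have "ad_wedge K L 1 x [y] = wedge K L [lie_bracket L x y] \<oplus>\<^bsub>ext_pow K L 1\<^esub> lwedge K L 1 y \<zero>\<^bsub>ext_pow K L (1 - 1)\<^esub>" by simp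
    thus ?thesis unfolding lz[OF y] E1.M.r_zero[OF w] .
  qed
  have "bdry (ce_complex K L) 2 (wedge K L [x, y]) = ce_wedge K L 2 [x, y]"
    by (rule ce_bdry_wedge[OF L]) (simp add: tuples_def x y)
  also have "\<dots> = \<ominus>\<^bsub>ext_pow K L 1\<^esub> (lwedge K L 1 x (ce_wedge K L 1 [y]) \<oplus>\<^bsub>ext_pow K L 1\<^esub> ad_wedge K L 1 x [y])"
    unfolding ce_wedge.simps(2)[of K L 2 x] by simp
  also have "\<dots> = \<ominus>\<^bsub>ext_pow K L 1\<^esub> wedge K L [lie_bracket L x y]"
  proof -
    have "lwedge K L 1 x \<zero>\<^bsub>ext_pow K L 0\<^esub> = \<zero>\<^bsub>ext_pow K L 1\<^esub>" using lz[OF x, of 1] by simp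
    thus ?thesis unfolding 1 2 using E1.M.l_zero[OF w] by simp
  qed
  finally show ?thesis .
qed

lemma wedge_zero:
  assumes V: "vectorspace K V" and us: "set us \<subseteq> carrier V" "set vs \<subseteq> carrier V" and k: "int (length us + length vs) + 1 = k"
  shows "wedge K V (us @ \<zero>\<^bsub>V\<^esub> # vs) = \<zero>\<^bsub>ext_pow K V k\<^esub>"
  by (rule linear_mapD(6)[OF wedge_slot[OF V us k]])

lemma ad_wedge_central:
  assumes L: "lie_algebra K L" and z: "\<And>y. y \<in> carrier L \<Longrightarrow> lie_bracket L z y = \<zero>\<^bsub>L\<^esub>" and ys: "ys \<in> tuples L k"
  shows "ad_wedge K L k z ys = \<zero>\<^bsub>ext_pow K L k\<^esub>"
  using ys
proof (induction ys arbitrary: k)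
  case (Cons y ys)
  note V = lie_algebra_vs[OF L]
  interpret E: vectorspace K "ext_pow K L k" by (rule ext_pow_vectorspace[OF V])
  from Cons.prems have y: "y \<in> carrier L" and ys: "ys \<in> tuples L (k - 1)" by (simp_all add: tuples_Cons)
  have "wedge K L (\<zero>\<^bsub>L\<^esub> # ys) = \<zero>\<^bsub>ext_pow K L k\<^esub>"
    using wedge_zero[OF V, of "[]" ys k] ys by (simp add: tuples_def)
  thus ?case using z[OF y] Cons.IH[OF ys] linear_mapD(6)[OF lwedge_linear[OF V y, of k]] by simp
qed simp

text \<open>For central \<open>z\<close> the term \<open>\<theta>\<^sub>z\<close> of the recursion is zero.\<close>

lemma ce_bdry_central_wedge:
  assumes L: "lie_algebra K L" and zc: "z \<in> carrier L" and z: "\<And>y. y \<in> carrier L \<Longrightarrow> lie_bracket L z y = \<zero>\<^bsub>L\<^esub>"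
    and x: "x \<in> carrier L" and y: "y \<in> carrier L"
  shows "bdry (ce_complex K L) 3 (wedge K L [z, x, y]) = wedge K L [z, lie_bracket L x y]"
proof -
  interpret lie_algebra K L by fact
  note V = vectorspace_axioms and b = bracket_closed[OF x y]
  interpret E2: vectorspace K "ext_pow K L 2" by (rule ext_pow_vectorspace[OF V])
  have xy: "[x, y] \<in> tuples L (3 - 1)" and xyz: "[z, x, y] \<in> tuples L 3" and b1: "[lie_bracket L x y] \<in> tuples L (2 - 1)"
    using x y zc b by (simp_all add: tuples_def)
  have w: "wedge K L [z, lie_bracket L x y] \<in> carrier (ext_pow K L 2)"
    by (rule wedge_closed[OF V]) (simp add: tuples_def b zc)
  have w1: "wedge K L [lie_bracket L x y] \<in> carrier (ext_pow K L (2 - 1))" by (rule wedge_closed[OF V b1])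
  have d: "ce_wedge K L 2 [x, y] = \<ominus>\<^bsub>ext_pow K L (2 - 1)\<^esub> wedge K L [lie_bracket L x y]"
    using ce_bdry_wedge[OF L, of "[x, y]" 2] ce_bdry_2[OF L x y] x y by (simp add: tuples_def)
  have ad: "ad_wedge K L 2 z [x, y] = \<zero>\<^bsub>ext_pow K L 2\<^esub>"
    by (rule ad_wedge_central[OF L z]) (simp_all add: tuples_def x y)
  have "bdry (ce_complex K L) 3 (wedge K L [z, x, y]) = ce_wedge K L 3 [z, x, y]" by (rule ce_bdry_wedge[OF L xyz])
  also have "\<dots> = \<ominus>\<^bsub>ext_pow K L 2\<^esub> (lwedge K L 2 z (ce_wedge K L 2 [x, y]) \<oplus>\<^bsub>ext_pow K L 2\<^esub> ad_wedge K L 2 z [x, y])"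
    unfolding ce_wedge.simps(2)[of K L 3 z] by simp
  also have "\<dots> = \<ominus>\<^bsub>ext_pow K L 2\<^esub> (\<ominus>\<^bsub>ext_pow K L 2\<^esub> wedge K L [z, lie_bracket L x y] \<oplus>\<^bsub>ext_pow K L 2\<^esub> \<zero>\<^bsub>ext_pow K L 2\<^esub>)"
    unfolding d ad linear_mapD(7)[OF lwedge_linear[OF V zc] w1] lwedge_wedge[OF V zc b1] ..
  also have "\<dots> = wedge K L [z, lie_bracket L x y]" using w by simp
  finally show ?thesis .
qed

lemma abelian_homology_dim:
  assumes L: "lie_algebra K L" and fin: "vectorspace.fin_dim K L"
    and ab: "\<And>x y. \<lbrakk>x \<in> carrier L; y \<in> carrier L\<rbrakk> \<Longrightarrow> lie_bracket L x y = \<zero>\<^bsub>L\<^esub>"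
  shows "vectorspace.dim K (homology (ce_complex K L) n) = vectorspace.dim K (ext_pow K L n)"
proof -
  note V = lie_algebra_vs[OF L] and C = ce_complex_fd[OF L fin]
  have ce: "ce_wedge K L k xs = \<zero>\<^bsub>ext_pow K L (k - 1)\<^esub>" if "xs \<in> tuples L k" for xs k
    using that
  proof (induction xs arbitrary: k)
    case (Cons x xs)
    interpret E: vectorspace K "ext_pow K L (k - 1)" by (rule ext_pow_vectorspace[OF V])
    from Cons.prems have x: "x \<in> carrier L" and xs: "xs \<in> tuples L (k - 1)" by (simp_all add: tuples_Cons)
    have "lwedge K L (k - 1) x (ce_wedge K L (k - 1) xs) = \<zero>\<^bsub>ext_pow K L (k - 1)\<^esub>"
      unfolding Cons.IH[OF xs] by (rule linear_mapD(6)[OF lwedge_linear[OF V x]])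
    moreover have "ad_wedge K L (k - 1) x xs = \<zero>\<^bsub>ext_pow K L (k - 1)\<^esub>"
      by (rule ad_wedge_central[OF L ab[OF x] xs])
    ultimately show ?case using vectorspace_neg_zero[OF E.vectorspace_axioms] by simp
  qed simp
  have "bdry (ce_complex K L) k t = \<zero>\<^bsub>ext_pow K L (k - 1)\<^esub>" if t: "t \<in> carrier (ext_pow K L k)" for k t
    by (rule ext_pow_eqI[OF V ce_bdry_linear[OF L] linear_map_zero[OF ext_pow_vectorspace[OF V] ext_pow_vectorspace[OF V]] _ t])
      (simp add: ce_bdry_wedge[OF L] ce)
  hence im: "bdry (ce_complex K L) k ` carrier (ext_pow K L k) \<subseteq> {\<zero>\<^bsub>ext_pow K L (k - 1)\<^esub>}" for k by blast
  have "bdry_rank K (ce_complex K L) k = 0" for k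
  proof -
    have "bdry (ce_complex K L) k ` carrier (ext_pow K L k) = {\<zero>\<^bsub>ext_pow K L (k - 1)\<^esub>}"
      by (rule subset_antisym[OF im]) (use subspaceD(3)[OF bdry_image_subspace[OF C, of k]] in simp)
    thus ?thesis unfolding bdry_rank_def using sdim_zero[OF ext_pow_vectorspace[OF V]] by simp
  qed
  thus ?thesis using homology_dim[OF C, of n] by simp
qed

section \<open>Central ideals and the multiplier of a pair\<close>

text \<open>Lift a basis of \<open>V/D\<close>. The conclusion says that \<open>D\<close> and \<open>U\<close> together span \<open>V\<close>, phrased in terms of
  arbitrary subspaces \<open>P\<close> so that it can serve as an induction principle.\<close>

lemma complement_generators:
  assumes D: "subspace K D V" and fin: "vectorspace.fin_dim K V"
  obtains U where "finite U" "U \<subseteq> carrier V" "card U \<le> vectorspace.dim K (quot_space V D)"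
    "\<And>P. \<lbrakk>subspace K P V; D \<subseteq> P; U \<subseteq> P\<rbrakk> \<Longrightarrow> carrier V \<subseteq> P"
proof -
  note q = quot_space_map[OF D]
  let ?Q = "quot_space V D" and ?q = "a_r_coset V D"
  interpret V: vectorspace K V by (rule subspaceD[OF D])
  interpret Q: vectorspace K ?Q by (rule q)
  obtain B where B: "finite B" "Q.basis B" using Q.finite_basis_exists[OF fin_dim_image[OF q(2) fin q(3)]] by blast
  hence BQ: "B \<subseteq> carrier ?Q" and spB: "Q.span B = carrier ?Q" unfolding Q.basis_def by auto
  let ?U = "inv_into (carrier V) ?q ` B"
  have g: "inv_into (carrier V) ?q b \<in> carrier V" "?q (inv_into (carrier V) ?q b) = b" if "b \<in> B" for b
  proof -
    have "b \<in> ?q ` carrier V" unfolding q(3) using that BQ by blast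
    thus "inv_into (carrier V) ?q b \<in> carrier V" "?q (inv_into (carrier V) ?q b) = b"
      by (rule inv_into_into, rule f_inv_into_f)
  qed
  show thesis
  proof (rule that[of ?U])
    show "finite ?U" using B(1) by (rule finite_imageI)
    show "?U \<subseteq> carrier V" using g(1) by blast
    show "card ?U \<le> Q.dim" using card_image_le[OF B(1)] Q.dim_basis[OF B] by simp
    fix P assume P: "subspace K P V" and DP: "D \<subseteq> P" and UP: "?U \<subseteq> P"
    have "B \<subseteq> ?q ` P"
    proof
      fix b assume b: "b \<in> B"
      hence "?q (inv_into (carrier V) ?q b) \<in> ?q ` P" using UP by blast
      thus "b \<in> ?q ` P" unfolding g(2)[OF b] .
    qed
    from Q.span_is_subset[OF this subspaceD(9)[OF subspace_image[OF q(2) P]]]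
    have sub: "carrier ?Q \<subseteq> ?q ` P" unfolding spB .
    show "carrier V \<subseteq> P"
    proof
      fix x assume x: "x \<in> carrier V"
      hence "?q x \<in> ?q ` P" using sub linear_mapD(3)[OF q(2) x] by blast
      then obtain p where p: "p \<in> P" "?q x = ?q p" by blast
      note pc = subspace_mem[OF P p(1)]
      have "x \<ominus>\<^bsub>V\<^esub> p \<in> D" using coset_eq_iff[OF D x pc] p(2) by blast
      hence "(x \<ominus>\<^bsub>V\<^esub> p) \<oplus>\<^bsub>V\<^esub> p \<in> P" using subspaceD(4)[OF P _ p(1)] DP by blast
      moreover have "(x \<ominus>\<^bsub>V\<^esub> p) \<oplus>\<^bsub>V\<^esub> p = x" using x pc by (simp add: a_minus_def V.M.a_assoc V.M.l_neg)
      ultimately show "x \<in> P" by simp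
    qed
  qed
qed

text \<open>\<open>L/J\<close> and \<open>(L/N)/(J/N)\<close> are quotients of \<open>L\<close> by the same subspace. By \<open>ext_map_kernel_mono\<close>, in both
  directions, the maps that they induce on exterior powers have the same kernel.\<close>

lemma ce_ideal_quotient:
  assumes L: "lie_algebra K L" and fin: "vectorspace.fin_dim K L" and N: "lie_ideal K L N" and J: "lie_ideal K L J"
    and NJ: "N \<subseteq> J"
  shows "ce_ideal K L J n = {t \<in> carrier (ext_pow K L n).
    ext_map K (lie_quot L N) (a_r_coset L N) n t \<in> ce_ideal K (lie_quot L N) (quot_image L N J) n}"
    and "ext_map K (lie_quot L N) (a_r_coset L N) n ` ce_ideal K L J n = ce_ideal K (lie_quot L N) (quot_image L N J) n"
proof -
  let ?M = "lie_quot L N" and ?q = "a_r_coset L N" and ?J' = "quot_image L N J"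
  let ?P = "lie_quot L J" and ?r = "a_r_coset L J" and ?P' = "lie_quot ?M ?J'" and ?r' = "a_r_coset ?M ?J'"
  interpret lie_algebra K L by fact
  note q = lie_quot_map[OF L N] and r = lie_quot_map[OF L J]
  note r' = lie_quot_map[OF lie_quot_algebra[OF L N] lie_ideal_image[OF L N J]]
  note ql = linear_mapD[OF lie_homD(3)[OF q(1)]]
  note comp = linear_map_comp[OF lie_homD(3)[OF q(1)] lie_homD(3)[OF r'(1)]]
  have surj: "(\<lambda>x. ?r' (?q x)) ` carrier L = carrier ?P'"
    unfolding image_image[symmetric] q(2) r'(2) ..
  have ker: "?r' (?q x) = \<zero>\<^bsub>?P'\<^esub> \<longleftrightarrow> ?r x = \<zero>\<^bsub>?P\<^esub>" if x: "x \<in> carrier L" for x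
  proof -
    have "?q x \<in> ?q ` J \<longleftrightarrow> x \<in> J"
    proof
      assume "?q x \<in> ?q ` J"
      then obtain j where j: "j \<in> J" "?q x = ?q j" by blast
      note jc = subspace_mem[OF lie_idealD(1)[OF J] j(1)]
      have "x \<ominus>\<^bsub>L\<^esub> j \<in> J" using coset_eq_iff[OF lie_idealD(1)[OF N] x jc] j(2) NJ by blast
      from subspaceD(4)[OF lie_idealD(1)[OF J] this j(1)] show "x \<in> J"
        using x jc by (simp add: a_minus_def M.a_assoc M.l_neg)
    qed (rule imageI)
    moreover have "?r' (?q x) = \<zero>\<^bsub>?P'\<^esub> \<longleftrightarrow> ?q x \<in> ?q ` J"
      using r'(3)[OF ql(3)[OF x]] unfolding quot_image_def .
    ultimately show ?thesis using r(3)[OF x] by metis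
  qed
  have iff: "ext_map K ?P ?r n t = \<zero>\<^bsub>ext_pow K ?P n\<^esub> \<longleftrightarrow> ext_map K ?P' ?r' n (ext_map K ?M ?q n t) = \<zero>\<^bsub>ext_pow K ?P' n\<^esub>"
    if t: "t \<in> carrier (ext_pow K L n)" for t
  proof -
    have "ext_map K ?P' ?r' n (ext_map K ?M ?q n t) = ext_map K ?P' (\<lambda>x. ?r' (?q x)) n t"
      by (rule ext_map_comp[OF lie_homD(3)[OF q(1)] lie_homD(3)[OF r'(1)] comp refl t])
    moreover have "ext_map K ?P ?r n t = \<zero>\<^bsub>ext_pow K ?P n\<^esub> \<Longrightarrow> ext_map K ?P' (\<lambda>x. ?r' (?q x)) n t = \<zero>\<^bsub>ext_pow K ?P' n\<^esub>"
      by (rule ext_map_kernel_mono[OF lie_homD(3)[OF r(1)] comp assms(2) r(2) iffD2[OF ker] t])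
    moreover have "ext_map K ?P' (\<lambda>x. ?r' (?q x)) n t = \<zero>\<^bsub>ext_pow K ?P' n\<^esub> \<Longrightarrow> ext_map K ?P ?r n t = \<zero>\<^bsub>ext_pow K ?P n\<^esub>"
      by (rule ext_map_kernel_mono[OF comp lie_homD(3)[OF r(1)] assms(2) surj iffD1[OF ker] t])
    ultimately show ?thesis by metis
  qed
  note E = linear_mapD(3)[OF ext_map_linear[OF lie_homD(3)[OF q(1)], of n]]
  show 1: "ce_ideal K L J n = {t \<in> carrier (ext_pow K L n). ext_map K ?M ?q n t \<in> ce_ideal K ?M ?J' n}"
  proof (intro subset_antisym subsetI)
    fix t assume "t \<in> ce_ideal K L J n"
    hence t: "t \<in> carrier (ext_pow K L n)" "ext_map K ?P ?r n t = \<zero>\<^bsub>ext_pow K ?P n\<^esub>" unfolding ce_ideal_def by simp_all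
    thus "t \<in> {t \<in> carrier (ext_pow K L n). ext_map K ?M ?q n t \<in> ce_ideal K ?M ?J' n}"
      unfolding ce_ideal_def using iffD1[OF iff[OF t(1)] t(2)] E[OF t(1)] by simp
  next
    fix t assume "t \<in> {t \<in> carrier (ext_pow K L n). ext_map K ?M ?q n t \<in> ce_ideal K ?M ?J' n}"
    hence t: "t \<in> carrier (ext_pow K L n)" "ext_map K ?P' ?r' n (ext_map K ?M ?q n t) = \<zero>\<^bsub>ext_pow K ?P' n\<^esub>"
      unfolding ce_ideal_def by simp_all
    show "t \<in> ce_ideal K L J n" unfolding ce_ideal_def using iffD2[OF iff[OF t(1)] t(2)] t(1) by simp
  qed
  show "ext_map K ?M ?q n ` ce_ideal K L J n = ce_ideal K ?M ?J' n"
  proof (intro subset_antisym subsetI)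
    fix u assume u: "u \<in> ce_ideal K ?M ?J' n"
    hence "u \<in> ext_map K ?M ?q n ` carrier (ext_pow K L n)"
      unfolding ext_map_surj[OF lie_homD(3)[OF q(1)] q(2)] ce_ideal_def by simp
    then obtain t where t: "t \<in> carrier (ext_pow K L n)" "u = ext_map K ?M ?q n t" by blast
    hence "t \<in> ce_ideal K L J n" unfolding 1 using u by simp
    thus "u \<in> ext_map K ?M ?q n ` ce_ideal K L J n" unfolding t(2) by (rule imageI)
  next
    fix u assume "u \<in> ext_map K ?M ?q n ` ce_ideal K L J n"
    thus "u \<in> ce_ideal K ?M ?J' n" unfolding 1 by blast
  qed
qed

lemma wedge_mem_ce_ideal:
  assumes L: "lie_algebra K L" and J: "lie_ideal K L J"
    and xs: "us @ x # vs \<in> tuples L n" and x: "x \<in> J"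
  shows "wedge K L (us @ x # vs) \<in> ce_ideal K L J n"
proof -
  note r = lie_quot_map[OF L J] and rl = linear_mapD[OF lie_homD(3)[OF lie_quot_map(1)[OF L J]]]
  have "a_r_coset L J x = \<zero>\<^bsub>lie_quot L J\<^esub>" using r(3)[OF subspace_mem[OF lie_idealD(1)[OF J] x]] x by blast
  hence "wedge K (lie_quot L J) (map (a_r_coset L J) (us @ x # vs)) = \<zero>\<^bsub>ext_pow K (lie_quot L J) n\<^esub>"
    using wedge_zero[OF rl(2), of "map (a_r_coset L J) us" "map (a_r_coset L J) vs" n] xs rl(3)
    by (auto simp: tuples_def)
  thus ?thesis unfolding ce_ideal_def
    using wedge_closed[OF rl(1) xs] ext_map_wedge[OF lie_homD(3)[OF r(1)] xs] by simp
qed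

text \<open>The kernel is spanned by the products \<open>z \<and> y\<close> with \<open>z \<in> N\<close>. For fixed \<open>z\<close>, the vectors \<open>y\<close> with
  \<open>z \<and> y\<close> in a given subspace form a subspace, so only three kinds of \<open>y\<close> matter: brackets, covered by
  \<open>B\<close>; elements of \<open>N\<close>, covered by the image of \<open>\<Lambda>\<^sup>2 N\<close>, whose dimension is at most that of
  \<open>\<Lambda>\<^sup>2 N \<cong> M(N)\<close>; and lifts \<open>u\<close> of a basis of \<open>L/(L\<^sup>2+N)\<close>, for which \<open>z\<close> may be restricted to a basis
  of \<open>N\<close>.\<close>

lemma central_kernel_dim:
  assumes L: "lie_algebra K L" and fin: "vectorspace.fin_dim K L" and N: "lie_ideal K L N" and Nz: "N \<subseteq> lie_center L"
    and B: "subspace K B (ext_pow K L 2)"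
    and NB: "\<And>z x y. \<lbrakk>z \<in> N; x \<in> carrier L; y \<in> carrier L\<rbrakk> \<Longrightarrow> wedge K L [z, lie_bracket L x y] \<in> B"
  shows "sdim K (ext_pow K L 2) {t \<in> carrier (ext_pow K L 2).
      ext_map K (lie_quot L N) (a_r_coset L N) 2 t = \<zero>\<^bsub>ext_pow K (lie_quot L N) 2\<^esub>}
    \<le> sdim K (ext_pow K L 2) B + vectorspace.dim K (schur_multiplier K (L\<lparr>carrier := N\<rparr>))
      + vectorspace.dim K (quot_space L (commutator K L (carrier L) (carrier L) <+>\<^bsub>L\<^esub> N)) * vectorspace.dim K (L\<lparr>carrier := N\<rparr>)"
    (is "sdim K ?E ?X \<le> _ + _ + vectorspace.dim K (quot_space L ?D) * _")
proof -
  let ?NN = "L\<lparr>carrier := N\<rparr>" and ?C = "commutator K L (carrier L) (carrier L)" and ?G = "{lie_bracket L x y | x y. x \<in> carrier L \<and> y \<in> carrier L}"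
  note S = lie_idealD(1)[OF N] and q = lie_quot_map[OF L N] and incl = lie_ideal_subalgebra[OF L N]
  note V = lie_algebra_vs[OF L] and m = subspace_mem[OF lie_idealD(1)[OF N]]
  note E = ext_pow_vectorspace[OF V, of 2] and finE = ext_pow_fin_dim[OF V fin, of 2]
  note NNv = linear_mapD(1)[OF lie_homD(3)[OF incl]] and finN = fin_dim_subspace[OF fin S]
  interpret V: vectorspace K L by (rule V)
  interpret E: vectorspace K ?E by (rule E)
  interpret NN: vectorspace K ?NN by (rule NNv)
  have br: "lie_bracket L x y \<in> carrier L" if "x \<in> carrier L" "y \<in> carrier L" for x y
    using L that by (rule lie_algebra.bracket_closed)
  have GL: "?G \<subseteq> carrier L" using br by blast
  have C: "subspace K ?C L" unfolding commutator_def by (rule V.span_is_subspace[OF GL])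
  have Deq: "?D = {a \<oplus>\<^bsub>L\<^esub> b | a b. a \<in> ?C \<and> b \<in> N}" unfolding set_add_def' by blast
  have D: "subspace K ?D L" unfolding Deq by (rule subspace_Collect_sum(1)[OF C S])
  obtain U where U: "finite U" "U \<subseteq> carrier L" "card U \<le> vectorspace.dim K (quot_space L ?D)"
    and gen: "\<And>P. \<lbrakk>subspace K P L; ?D \<subseteq> P; U \<subseteq> P\<rbrakk> \<Longrightarrow> carrier L \<subseteq> P"
    using complement_generators[OF D fin] by blast
  obtain A where A: "finite A" "NN.basis A" using NN.finite_basis_exists[OF finN] by blast
  hence AN: "A \<subseteq> carrier ?NN" and spA: "NN.span A = carrier ?NN" and cardA: "card A = NN.dim"
    using NN.dim_basis[OF A] unfolding NN.basis_def by auto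
  define G where "G = (\<lambda>(a, u). wedge K L [a, u]) ` (A \<times> U)"
  have G: "finite G" "G \<subseteq> carrier ?E"
  proof -
    show "finite G" unfolding G_def using A(1) U(1) by simp
    have "wedge K L [a, u] \<in> carrier ?E" if "a \<in> A" "u \<in> U" for a u
    proof (rule wedge_closed[OF V])
      have "a \<in> carrier L" "u \<in> carrier L" using m[of a] that AN U(2) by auto
      thus "[a, u] \<in> tuples L 2" by (simp add: tuples_def)
    qed
    thus "G \<subseteq> carrier ?E" unfolding G_def by (intro image_subsetI) (simp add: split_beta mem_Times_iff)
  qed
  have cardG: "card G \<le> vectorspace.dim K (quot_space L ?D) * NN.dim"
  proof -
    have "card G \<le> card (A \<times> U)" unfolding G_def by (rule card_image_le) (simp add: A U)
    also have "\<dots> = card U * NN.dim" by (simp add: card_cartesian_product cardA)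
    also have "\<dots> \<le> vectorspace.dim K (quot_space L ?D) * NN.dim" by (rule mult_le_mono1[OF U(3)])
    finally show ?thesis .
  qed
  let ?e = "ext_map K L (\<lambda>x. x) 2"
  define T where "T = ?e ` carrier (ext_pow K ?NN 2)"
  note el = ext_map_linear[OF lie_homD(3)[OF incl], of 2]
  note NNE = ext_pow_vectorspace[OF NNv, of 2]
  have T: "subspace K T ?E" unfolding T_def by (rule subspace_image[OF el subspace_carrier[OF NNE]])
  have "lie_bracket ?NN x y = \<zero>\<^bsub>?NN\<^esub>" if "x \<in> carrier ?NN" "y \<in> carrier ?NN" for x y
    using that Nz m unfolding lie_center_def by auto
  hence Ndim: "vectorspace.dim K (schur_multiplier K ?NN) = vectorspace.dim K (ext_pow K ?NN 2)"
    unfolding schur_multiplier_def by (rule abelian_homology_dim[OF lie_homD(1)[OF incl] finN])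
  have dimT: "sdim K ?E T \<le> vectorspace.dim K (schur_multiplier K ?NN)"
    unfolding T_def Ndim using rank_nullity_carrier[OF el ext_pow_fin_dim[OF NNv finN]] by simp
  have H: "subspace K (E.span G) ?E" by (rule E.span_is_subspace[OF G(2)])
  have dimH: "sdim K ?E (E.span G) \<le> vectorspace.dim K (quot_space L ?D) * NN.dim"
    using sdim_span_le[OF E G] cardG by linarith
  define BT where "BT = {a \<oplus>\<^bsub>?E\<^esub> b | a b. a \<in> B \<and> b \<in> T}"
  have BT: "subspace K BT ?E" unfolding BT_def by (rule subspace_Collect_sum(1)[OF B T])
  have dimBT: "sdim K ?E BT \<le> sdim K ?E B + sdim K ?E T" unfolding BT_def by (rule subspace_Collect_sum(2)[OF B T finE])
  define R where "R = {a \<oplus>\<^bsub>?E\<^esub> b | a b. a \<in> BT \<and> b \<in> E.span G}"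
  have R: "subspace K R ?E" unfolding R_def by (rule subspace_Collect_sum(1)[OF BT H])
  have dimR: "sdim K ?E R \<le> sdim K ?E BT + sdim K ?E (E.span G)" unfolding R_def by (rule subspace_Collect_sum(2)[OF BT H finE])
  have BTR: "BT \<subseteq> R" and HR: "E.span G \<subseteq> R" unfolding R_def by (rule subspace_sum_upper[OF BT H])+
  have "B \<subseteq> BT" and "T \<subseteq> BT" unfolding BT_def by (rule subspace_sum_upper[OF B T])+
  hence BR: "B \<subseteq> R" and TR: "T \<subseteq> R" using BTR by blast+
  have slot2: "linear_map K L ?E (\<lambda>y. wedge K L [z, y])" if "z \<in> carrier L" for z
    using wedge_slot[OF V, of "[z]" "[]" 2] that by simp
  have slot1: "linear_map K L ?E (\<lambda>z. wedge K L [z, y])" if "y \<in> carrier L" for y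
    using wedge_slot[OF V, of "[]" "[y]" 2] that by simp
  have main: "wedge K L [z, y] \<in> R" if z: "z \<in> N" and y: "y \<in> carrier L" for z y
  proof -
    have P: "subspace K {y \<in> carrier L. wedge K L [z, y] \<in> R} L" (is "subspace K ?P L")
      by (rule subspace_preimage[OF slot2[OF m[OF z]] subspace_carrier[OF V] R])
    have "?G \<subseteq> ?P" using NB[OF z] BR br by blast
    hence CP: "?C \<subseteq> ?P" unfolding commutator_def by (rule V.span_is_subset[OF _ subspaceD(9)[OF P]])
    have NP: "N \<subseteq> ?P"
    proof
      fix x assume x: "x \<in> N"
      have t: "[z, x] \<in> tuples ?NN 2" using x z by (simp add: tuples_def)
      have "?e (wedge K ?NN [z, x]) = wedge K L (map (\<lambda>x. x) [z, x])" by (rule ext_map_wedge[OF lie_homD(3)[OF incl] t])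
      hence "wedge K L [z, x] \<in> T" unfolding T_def using wedge_closed[OF NNv t] by (metis imageI list.map_ident)
      thus "x \<in> ?P" using m[OF x] TR by blast
    qed
    have "?D \<subseteq> ?P"
    proof
      fix d assume "d \<in> ?D"
      then obtain a b where "a \<in> ?C" "b \<in> N" "d = a \<oplus>\<^bsub>L\<^esub> b" unfolding Deq by blast
      thus "d \<in> ?P" using subspaceD(4)[OF P subsetD[OF CP] subsetD[OF NP], of a b] by metis
    qed
    moreover have "U \<subseteq> ?P"
    proof
      fix u assume u: "u \<in> U"
      hence uL: "u \<in> carrier L" using U(2) by blast
      have "wedge K L [z, u] \<in> R"
      proof (rule linear_map_image_span[OF linear_map_domain[OF slot1[OF uL] S] R AN spA])
        show "wedge K L [a, u] \<in> R" if "a \<in> A" for a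
        proof -
          have "wedge K L [a, u] \<in> G" unfolding G_def using that u by force
          thus ?thesis using E.in_own_span[OF G(2)] HR by blast
        qed
        show "z \<in> carrier ?NN" using z by simp
      qed
      thus "u \<in> ?P" using uL by blast
    qed
    ultimately show ?thesis using gen[OF P] y by blast
  qed
  have X: "subspace K ?X ?E"
    by (rule subspace_kernel[OF ext_map_linear[OF lie_homD(3)[OF q(1)]] subspace_carrier[OF E]])
  have "?X \<subseteq> R"
  proof
    fix t assume "t \<in> ?X"
    hence t: "t \<in> carrier ?E" "ext_map K (lie_quot L N) (a_r_coset L N) 2 t = \<zero>\<^bsub>ext_pow K (lie_quot L N) 2\<^esub>" by simp_all
    show "t \<in> R"
    proof (rule ext_map_kernel_degree_2[OF lie_homD(3)[OF q(1)] fin q(2) R _ t])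
      show "wedge K L [x, y] \<in> R" if "x \<in> carrier L" "a_r_coset L N x = \<zero>\<^bsub>lie_quot L N\<^esub>" "y \<in> carrier L" for x y
        using main[OF _ that(3)] q(3)[OF that(1)] that(2) by blast
    qed
  qed
  from sdim_mono[OF finE X R this] show ?thesis using dimR dimBT dimT dimH by linarith
qed

text \<open>Rank and nullity for \<open>L \<rightarrow> L/N\<close> on the chains of degree 2 and on the boundaries of degrees 1 and 2
  turns the difference of the two relative multipliers into \<open>dim X - dim A - dim B\<close>, with the kernels
  \<open>X\<close>, \<open>A\<close>, \<open>B\<close> named below. Brackets of \<open>L\<close> with \<open>J\<close> give the lower bound for \<open>A\<close>, and \<open>B\<close> satisfies the
  hypothesis of \<open>central_kernel_dim\<close>, which bounds \<open>X\<close>.\<close>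

theorem multiplier_pair_central_bound:
  assumes L: "lie_algebra K L" and fin: "vectorspace.fin_dim K L" and J: "lie_ideal K L J" and N: "lie_ideal K L N"
    and NJ: "N \<subseteq> J" and Nz: "N \<subseteq> lie_center L"
  shows "vectorspace.dim K (schur_multiplier_pair K L J) + vectorspace.dim K (L\<lparr>carrier := N \<inter> commutator K L (carrier L) J\<rparr>)
    \<le> vectorspace.dim K (schur_multiplier_pair K (lie_quot L N) (quot_image L N J))
      + vectorspace.dim K (schur_multiplier K (L\<lparr>carrier := N\<rparr>))
      + vectorspace.dim K (quot_space L (commutator K L (carrier L) (carrier L) <+>\<^bsub>L\<^esub> N)) * vectorspace.dim K (L\<lparr>carrier := N\<rparr>)"
proof -
  let ?M = "lie_quot L N" and ?J' = "quot_image L N J" and ?d = "bdry (ce_complex K L)" and ?d' = "bdry (ce_complex K (lie_quot L N))"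
  let ?R = "ce_ideal K L J" and ?R' = "ce_ideal K (lie_quot L N) (quot_image L N J)" and ?p = "ext_map K (lie_quot L N) (a_r_coset L N)"
  note q = lie_quot_map[OF L N] and M = lie_quot_algebra[OF L N] and finM = lie_quot_fin_dim[OF L N fin] and J' = lie_ideal_image[OF L N J]
  note V = lie_algebra_vs[OF L] and quo = ce_ideal_quotient[OF L fin N J NJ]
  note pl = ext_map_linear[OF lie_homD(3)[OF q(1)]]
  note finE = ext_pow_fin_dim[OF V fin] and Jm = subspace_mem[OF lie_idealD(1)[OF J]] and Nm = subspace_mem[OF lie_idealD(1)[OF N]]
  interpret V: vectorspace K L by (rule V)
  interpret E1: vectorspace K "ext_pow K L 1" by (rule ext_pow_vectorspace[OF V])
  have br: "lie_bracket L x y \<in> carrier L" if "x \<in> carrier L" "y \<in> carrier L" for x y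
    using L that by (rule lie_algebra.bracket_closed)
  have R: "subspace K (?R n) (ext_pow K L n)" for n by (rule ce_ideal_subspace[OF L J])
  have dR: "subspace K (?d n ` ?R n) (ext_pow K L (n - 1))" for n by (rule subspace_image[OF ce_bdry_linear[OF L] R])
  have pd: "?p (n - 1) ` ?d n ` ?R n = ?d' n ` ?R' n" for n
  proof -
    have "?p (n - 1) ` ?d n ` ?R n = (\<lambda>t. ?d' n (?p n t)) ` ?R n"
      unfolding image_image
      by (rule image_cong[OF refl]) (use chain_mapD(2)[OF ext_map_chain_map[OF q(1)], of _ n] subspace_mem[OF R] in simp)
    also have "\<dots> = ?d' n ` ?R' n" unfolding image_image[symmetric] quo(2) ..
    finally show ?thesis .
  qed
  let ?X = "{t \<in> carrier (ext_pow K L 2). ?p 2 t = \<zero>\<^bsub>ext_pow K ?M 2\<^esub>}"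
  let ?A = "{t \<in> ?d 2 ` ?R 2. ?p 1 t = \<zero>\<^bsub>ext_pow K ?M 1\<^esub>}"
  let ?B = "{t \<in> ?d 3 ` ?R 3. ?p 2 t = \<zero>\<^bsub>ext_pow K ?M 2\<^esub>}"
  have XR: "{t \<in> ?R 2. ?p 2 t = \<zero>\<^bsub>ext_pow K ?M 2\<^esub>} = ?X"
  proof -
    have "\<zero>\<^bsub>ext_pow K ?M 2\<^esub> \<in> ?R' 2" by (rule subspaceD(3)[OF ce_ideal_subspace[OF M J']])
    thus ?thesis unfolding quo(1) by auto
  qed
  have r2: "sdim K (ext_pow K L 2) (?R 2) = sdim K (ext_pow K ?M 2) (?R' 2) + sdim K (ext_pow K L 2) ?X"
    using rank_nullity_on[OF pl finE R, of 2] unfolding quo(2) XR .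
  have b2: "sdim K (ext_pow K L 1) (?d 2 ` ?R 2) = sdim K (ext_pow K ?M 1) (?d' 2 ` ?R' 2) + sdim K (ext_pow K L 1) ?A"
    using rank_nullity_on[OF pl finE dR, of 2] unfolding pd by simp
  have b3: "sdim K (ext_pow K L 2) (?d 3 ` ?R 3) = sdim K (ext_pow K ?M 2) (?d' 3 ` ?R' 3) + sdim K (ext_pow K L 2) ?B"
    using rank_nullity_on[OF pl finE dR, of 3] unfolding pd by simp
  have hL: "vectorspace.dim K (schur_multiplier_pair K L J) + sdim K (ext_pow K L 1) (?d 2 ` ?R 2) + sdim K (ext_pow K L 2) (?d 3 ` ?R 3)
      = sdim K (ext_pow K L 2) (?R 2)"
    using homology_pair_dim[OF L fin J, of 3] unfolding schur_multiplier_pair_def by simp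
  have hM: "vectorspace.dim K (schur_multiplier_pair K ?M ?J') + sdim K (ext_pow K ?M 1) (?d' 2 ` ?R' 2) + sdim K (ext_pow K ?M 2) (?d' 3 ` ?R' 3)
      = sdim K (ext_pow K ?M 2) (?R' 2)"
    using homology_pair_dim[OF M finM J', of 3] unfolding schur_multiplier_pair_def by simp
  have dR2: "subspace K (?d 2 ` ?R 2) (ext_pow K L 1)" and dR3: "subspace K (?d 3 ` ?R 3) (ext_pow K L 2)"
    using dR[of 2] dR[of 3] by simp_all
  have A: "subspace K ?A (ext_pow K L 1)" by (rule subspace_kernel[OF pl dR2])
  have B: "subspace K ?B (ext_pow K L 2)" by (rule subspace_kernel[OF pl dR3])
  \<comment> \<open>\<open>[L, J]\<close>, regarded in degree 1, consists of boundaries of chains in \<open>?R 2\<close>\<close>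
  let ?w = "\<lambda>x. wedge K L [x]" and ?C = "commutator K L (carrier L) J" and ?G = "{lie_bracket L x y | x y. x \<in> carrier L \<and> y \<in> J}"
  note w = wedge_singleton[OF V]
  have GL: "?G \<subseteq> carrier L" using br Jm by blast
  have C: "subspace K ?C L" unfolding commutator_def by (rule V.span_is_subspace[OF GL])
  have "?G \<subseteq> {x \<in> carrier L. ?w x \<in> ?d 2 ` ?R 2}"
  proof
    fix g assume "g \<in> ?G"
    then obtain x y where x: "x \<in> carrier L" and y: "y \<in> J" and g: "g = lie_bracket L x y" by blast
    have "[x] @ y # [] \<in> tuples L 2" using x Jm[OF y] by (simp add: tuples_def)
    from wedge_mem_ce_ideal[OF L J this y] have "?d 2 (wedge K L [x, y]) \<in> ?d 2 ` ?R 2" by simp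
    from subspaceD(7)[OF dR2 this] have "?w g \<in> ?d 2 ` ?R 2"
      unfolding ce_bdry_2[OF L x Jm[OF y]] g using linear_mapD(3)[OF w(1) br[OF x Jm[OF y]]] by simp
    thus "g \<in> {x \<in> carrier L. ?w x \<in> ?d 2 ` ?R 2}" using br[OF x Jm[OF y]] g by simp
  qed
  hence CP: "?C \<subseteq> {x \<in> carrier L. ?w x \<in> ?d 2 ` ?R 2}"
    unfolding commutator_def
    by (rule V.span_is_subset[OF _ subspaceD(9)[OF subspace_preimage[OF w(1) subspace_carrier[OF V] dR2]]])
  have NC: "subspace K (N \<inter> ?C) L" by (rule subspace_Int[OF lie_idealD(1)[OF N] C])
  have "?w ` (N \<inter> ?C) \<subseteq> ?A"
  proof
    fix t assume "t \<in> ?w ` (N \<inter> ?C)"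
    then obtain x where x: "x \<in> N" "x \<in> ?C" "t = ?w x" by blast
    have 1: "t \<in> ?d 2 ` ?R 2" unfolding x(3) using CP x(2) by blast
    have "[] @ x # [] \<in> tuples L 1" using Nm[OF x(1)] by (simp add: tuples_def)
    from wedge_mem_ce_ideal[OF L N this x(1)] have "?p 1 t = \<zero>\<^bsub>ext_pow K ?M 1\<^esub>" unfolding x(3) ce_ideal_def by simp
    thus "t \<in> ?A" using 1 by simp
  qed
  from sdim_mono[OF finE subspace_image[OF w(1) NC] A this]
  have a: "sdim K L (N \<inter> ?C) \<le> sdim K (ext_pow K L 1) ?A"
    using sdim_image_inj[OF w(1) fin NC] w(2) subspace_mem[OF NC] by simp
  \<comment> \<open>\<open>z \<and> [x, y]\<close> is the boundary of \<open>z \<and> x \<and> y\<close>, which lies in \<open>?R 3\<close> because \<open>z \<in> J\<close>\<close>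
  have NB: "wedge K L [z, lie_bracket L x y] \<in> ?B" if z: "z \<in> N" and x: "x \<in> carrier L" and y: "y \<in> carrier L" for z x y
  proof -
    have zz: "lie_bracket L z u = \<zero>\<^bsub>L\<^esub>" if "u \<in> carrier L" for u using z Nz that unfolding lie_center_def by blast
    have d: "?d 3 (wedge K L [z, x, y]) = wedge K L [z, lie_bracket L x y]"
      by (rule ce_bdry_central_wedge[OF L Nm[OF z] _ x y]) (rule zz)
    have "[] @ z # [x, y] \<in> tuples L 3" using Nm[OF z] x y by (simp add: tuples_def)
    from wedge_mem_ce_ideal[OF L J this] have "?d 3 (wedge K L [z, x, y]) \<in> ?d 3 ` ?R 3" using z NJ by auto
    hence 1: "wedge K L [z, lie_bracket L x y] \<in> ?d 3 ` ?R 3" unfolding d .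
    have "[] @ z # [lie_bracket L x y] \<in> tuples L 2" using Nm[OF z] br[OF x y] by (simp add: tuples_def)
    from wedge_mem_ce_ideal[OF L N this z] have "?p 2 (wedge K L [z, lie_bracket L x y]) = \<zero>\<^bsub>ext_pow K ?M 2\<^esub>"
      unfolding ce_ideal_def by simp
    thus ?thesis using 1 by simp
  qed
  show ?thesis using central_kernel_dim[OF L fin N Nz B NB] hL hM r2 b2 b3 a by linarith
qed

section \<open>Split triples and central ideals\<close>

theorem theorem1p3:
  fixes F :: "('k, 'm) ring_scheme" and L :: "('k, 'a) lie_alg" and I J :: "'a set"
  assumes "lie_algebra F L"
    and "vectorspace.fin_dim F L"
    and "lie_ideal F L I"
    and "lie_ideal F L J"
    and "carrier L = I <+>\<^bsub>L\<^esub> J"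
    and "I \<inter> J = {\<zero>\<^bsub>L\<^esub>}"
  shows
    "int (vectorspace.dim F (schur_multiplier_triple F L I J)) =
       int (vectorspace.dim F (schur_multiplier_pair F L J))
       - int (vectorspace.dim F (schur_multiplier F (L\<lparr>carrier := J\<rparr>)))
     \<and>
     (\<forall>K. lie_ideal F L K \<and> K \<subseteq> J \<inter> lie_center L \<longrightarrow>
       vectorspace.dim F (schur_multiplier_triple F L I J)
       + vectorspace.dim F (schur_multiplier F (L\<lparr>carrier := J\<rparr>))
       + vectorspace.dim F (L\<lparr>carrier := K \<inter> commutator F L (carrier L) J\<rparr>)
       \<le> vectorspace.dim F (schur_multiplier_pair F (lie_quot L K) (quot_image L K J))
         + vectorspace.dim F (schur_multiplier F (L\<lparr>carrier := K\<rparr>))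
         + vectorspace.dim F (quot_space L (commutator F L (carrier L) (carrier L) <+>\<^bsub>L\<^esub> K))
           * vectorspace.dim F (L\<lparr>carrier := K\<rparr>))"
proof -
  have triple: "vectorspace.dim F (schur_multiplier_triple F L I J) + vectorspace.dim F (schur_multiplier F (L\<lparr>carrier := J\<rparr>))
      = vectorspace.dim F (schur_multiplier_pair F L J)"
    by (rule multiplier_triple_dim[OF assms])
  show ?thesis
  proof (intro conjI allI impI)
    show "int (vectorspace.dim F (schur_multiplier_triple F L I J)) =
       int (vectorspace.dim F (schur_multiplier_pair F L J))
       - int (vectorspace.dim F (schur_multiplier F (L\<lparr>carrier := J\<rparr>)))"
      using triple by linarith
  next
    fix K assume "lie_ideal F L K \<and> K \<subseteq> J \<inter> lie_center L"
    hence K: "lie_ideal F L K" "K \<subseteq> J" "K \<subseteq> lie_center L" by blast+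
    show "vectorspace.dim F (schur_multiplier_triple F L I J)
       + vectorspace.dim F (schur_multiplier F (L\<lparr>carrier := J\<rparr>))
       + vectorspace.dim F (L\<lparr>carrier := K \<inter> commutator F L (carrier L) J\<rparr>)
       \<le> vectorspace.dim F (schur_multiplier_pair F (lie_quot L K) (quot_image L K J))
         + vectorspace.dim F (schur_multiplier F (L\<lparr>carrier := K\<rparr>))
         + vectorspace.dim F (quot_space L (commutator F L (carrier L) (carrier L) <+>\<^bsub>L\<^esub> K))
           * vectorspace.dim F (L\<lparr>carrier := K\<rparr>)"
      unfolding triple by (rule multiplier_pair_central_bound[OF assms(1,2,4) K])
  qed
qed

end
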